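(* Let $\mathcal{R}$ be a cylinder and $t$ a tiling of $\mathcal{R}$. The twist $\mathrm{Tw}(t)$ is an integer, and: (i) if a tiling $t_1$ of $\mathcal{R}$ is obtained from a tiling $t_0$ by a flip, then $\mathrm{Tw}(t_1)=\mathrm{Tw}(t_0)$; (ii) if a tiling $t_1$ of $\mathcal{R}$ is obtained from a tiling $t_0$ by a single positive trit, then $\mathrm{Tw}(t_1)-\mathrm{Tw}(t_0)=1$; (iii) if $\mathcal{R}=\mathcal{D}\times[0,2]$ is a duplex region, then $\mathrm{Tw}(t)=P_t'(1)$ for every tiling $t$ of $\mathcal{R}$; (iv) if $\mathcal{R}=\bigcup_{1\le i\le m}\mathcal{R}_i$ where each $\mathcal{R}_i$ is a cylinder (not necessarily with the same axis) and $\mathrm{int}(\mathcal{R}_i)\cap\mathrm{int}(\mathcal{R}_j)=\emptyset$ for $i\neq j$, then there is a constant $K\in\mathbb{Z}$ such that for every family $(t_i)_{1\le i\le m}$ with $t_i$ a tiling of $\mathcal{R}_i$, $$\mathrm{Tw}\Big(\bigsqcup_{1\le i\le m}t_i\Big)=K+\sum_{1\le i\le m}\mathrm{Tw}(t_i).$$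
   Context: A basic cube is $[x,x+1]\times[y,y+1]\times[z,z+1]$, $(x,y,z)\in\mathbb{Z}^3$; white if $x+y+z$ even, black if odd. A region is a finite union of basic cubes; a domino is the union of two basic cubes sharing a face; a tiling of a region is a covering by dominoes with pairwise disjoint interiors. A flip removes two dominoes whose union is a $2\times2\times1$ box (any orientation, integer vertices) and replaces them by the other pair of dominoes tiling that box. Trits: let $B=[l,l+2]\times[m,m+2]\times[n,n+2]$ ($l,m,n\in\mathbb{Z}$) and suppose exactly three dominoes of a tiling $t$ of $\mathcal{R}$ lie in $B\cap\mathcal{R}$, pairwise non-parallel. They cover six cubes of $B$; the other two cubes $h,h'$ are opposite corners of $B$. Replacing the three dominoes by the unique other set of three dominoes covering the same six cubes is a trit. Each of these dominoes consists of a cube $a$ sharing a face with $h$ and a cube $b$ sharing a face with $h'$; with $c_X$ the center of cube $X$, $\chi=\det(c_a-c_h,c_b-c_a,c_{h'}-c_b)\in\{\pm1\}$ is independent of the choices; the trit is positive if the new dominoes have $\chi=+1$ (the removed ones having $\chi=-1$). Let $\Delta=\{e_x,e_y,e_z\}$ be the standard basis and $\Phi=\{\pm e_x,\pm e_y,\pm e_z\}$. A basic plane is a plane $x=k$, $y=k$ or $z=k$ with $k\in\mathbb{Z}$; a planar region in it is a finite union of unit squares with integer vertices. A cylinder is $\mathcal{R}=\mathcal{D}+[0,N]w=\{p+sw: p\in\mathcal{D}, s\in[0,N]\}$ where $w\in\Delta$, $\mathcal{D}$ is a simply connected planar region with connected interior in a basic plane with normal $w$, and $N$ is a positive integer (axis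 $w$, depth $N$). For a domino $d$ let $v(d)\in\Phi$ be the center of its black cube minus the center of its white cube. For $X\subset\mathbb{R}^3$ and $u\in\Phi$ let $S^u(X)$ be the interior of $(X+[0,\infty)u)\setminus X$. For dominoes $d_0,d_1$ set $\tau^u(d_0,d_1)=\tfrac14\det(v(d_1),v(d_0),u)$ if $d_1\cap S^u(d_0)\neq\emptyset$, and $0$ otherwise. The $u$-pretwist of a tiling $t$ is $T^u(t)=\sum_{d_0,d_1\in t}\tau^u(d_0,d_1)$ (sum over ordered pairs). For a tiling $t$ of a cylinder, $T^{e_x}(t)=T^{e_y}(t)=T^{e_z}(t)$, and this common value is the twist $\mathrm{Tw}(t)$. For a duplex region $\mathcal{D}\times[0,2]$ ($\mathcal{D}\subset\mathbb{R}^2$ simply connected with connected interior), $P_t$ is defined as follows: the unit square $[x,x+1]\times[y,y+1]$ has $c=1$ (black) if $x+y$ is even and $c=-1$ (white) if odd; orient each domino from the center of its white cube to that of its black cube and project onto $z=0$; dominoes parallel to $e_z$ project onto single squares (jewels), the others onto oriented unit segments forming disjoint oriented closed curves; for a jewel $j$ with center $p_j$ put $k_t(j)=\sum_\gamma\mathrm{wind}(\gamma,p_j)$ over these curves, and $P_t(q)=\sum_j c(j)q^{k_t(j)}$. *)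

theory Defs
  imports "HOL-Complex_Analysis.Complex_Analysis"
begin

section \<open>Cubes, dominoes and tilings\<close>

definition lattice_pt :: "int ^ 3 \<Rightarrow> real ^ 3" where
  "lattice_pt p = (\<chi> i. of_int (p $ i))"

definition basic_cube :: "int ^ 3 \<Rightarrow> (real ^ 3) set" where
  "basic_cube p = cbox (lattice_pt p) (lattice_pt (p + 1))"

definition cube_center :: "int ^ 3 \<Rightarrow> real ^ 3" where
  "cube_center p = (\<chi> i. of_int (p $ i) + 1 / 2)"

definition white :: "int ^ 3 \<Rightarrow> bool" where
  "white p \<longleftrightarrow> even (p $ 1 + p $ 2 + p $ 3)"

definition share_face :: "int ^ 3 \<Rightarrow> int ^ 3 \<Rightarrow> bool" where
  "share_face p q \<longleftrightarrow> (\<exists>i. q = p + axis i 1 \<or> p = q + axis i 1)"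

definition domino :: "(real ^ 3) set \<Rightarrow> bool" where
  "domino d \<longleftrightarrow> (\<exists>p q. share_face p q \<and> d = basic_cube p \<union> basic_cube q)"

definition white_cube :: "(real ^ 3) set \<Rightarrow> int ^ 3" where
  "white_cube d = (THE p. white p \<and> basic_cube p \<subseteq> d)"

definition black_cube :: "(real ^ 3) set \<Rightarrow> int ^ 3" where
  "black_cube d = (THE p. \<not> white p \<and> basic_cube p \<subseteq> d)"

definition domino_dir :: "(real ^ 3) set \<Rightarrow> real ^ 3" where
  "domino_dir d = cube_center (black_cube d) - cube_center (white_cube d)"

definition parallel :: "(real ^ 3) set \<Rightarrow> (real ^ 3) set \<Rightarrow> bool" where
  "parallel d d' \<longleftrightarrow> domino_dir d = domino_dir d' \<or> domino_dir d = - domino_dir d'"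

definition tiling :: "(real ^ 3) set \<Rightarrow> (real ^ 3) set set \<Rightarrow> bool" where
  "tiling R t \<longleftrightarrow> (\<forall>d\<in>t. domino d)
     \<and> pairwise (\<lambda>d d'. interior d \<inter> interior d' = {}) t \<and> \<Union>t = R"

section \<open>Flips and trits\<close>

definition is_flip :: "(real ^ 3) set set \<Rightarrow> (real ^ 3) set set \<Rightarrow> bool" where
  "is_flip t0 t1 \<longleftrightarrow> (\<exists>p i j s s'. i \<noteq> j
     \<and> (let Q = cbox (lattice_pt p) (lattice_pt (p + 1 + axis i 1 + axis j 1)) in
          s \<subseteq> t0 \<and> tiling Q s \<and> tiling Q s' \<and> s' \<noteq> s \<and> t1 = (t0 - s) \<union> s'))"

definition det3 :: "real ^ 3 \<Rightarrow> real ^ 3 \<Rightarrow> real ^ 3 \<Rightarrow> real" where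
  "det3 a b c = det (vector [a, b, c] :: real ^ 3 ^ 3)"

definition trit_sign :: "int ^ 3 \<Rightarrow> int ^ 3 \<Rightarrow> (real ^ 3) set \<Rightarrow> real" where
  "trit_sign h h' d = (THE c. \<exists>a b. d = basic_cube a \<union> basic_cube b
     \<and> share_face a h \<and> share_face b h'
     \<and> c = det3 (cube_center a - cube_center h) (cube_center b - cube_center a)
                (cube_center h' - cube_center b))"

text \<open>
  The trit replaces the set \<open>s\<close> of three dominoes by the set \<open>s'\<close>; \<open>h\<close> and \<open>h'\<close> are the two
  cubes of the \<open>2 \<times> 2 \<times> 2\<close> box that are not covered by \<open>s\<close>.
\<close>

definition trit_step ::
  "(real ^ 3) set \<Rightarrow> (real ^ 3) set set \<Rightarrow> (real ^ 3) set set \<Rightarrow>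
   (real ^ 3) set set \<Rightarrow> (real ^ 3) set set \<Rightarrow> int ^ 3 \<Rightarrow> int ^ 3 \<Rightarrow> bool" where
  "trit_step R t0 t1 s s' h h' \<longleftrightarrow> (\<exists>l.
     (let B = cbox (lattice_pt l) (lattice_pt (l + 2)) in
        s = {d \<in> t0. d \<subseteq> B \<inter> R} \<and> card s = 3 \<and> pairwise (\<lambda>d d'. \<not> parallel d d') s
      \<and> h \<noteq> h' \<and> {h, h'} = {p. basic_cube p \<subseteq> B \<and> \<not> basic_cube p \<subseteq> \<Union>s}
      \<and> tiling (\<Union>s) s' \<and> card s' = 3 \<and> s' \<noteq> s
      \<and> t1 = (t0 - s) \<union> s'))"

definition is_positive_trit ::
  "(real ^ 3) set \<Rightarrow> (real ^ 3) set set \<Rightarrow> (real ^ 3) set set \<Rightarrow> bool" where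
  "is_positive_trit R t0 t1 \<longleftrightarrow>
     (\<exists>s s' h h'. trit_step R t0 t1 s s' h h' \<and> (\<forall>d\<in>s'. trit_sign h h' d = 1))"

section \<open>Cylinders\<close>

definition basic_plane :: "3 \<Rightarrow> int \<Rightarrow> (real ^ 3) set" where
  "basic_plane i k = {x. x $ i = of_int k}"

definition planar_region :: "3 \<Rightarrow> int \<Rightarrow> (real ^ 3) set \<Rightarrow> bool" where
  "planar_region i k D \<longleftrightarrow> (\<exists>S. finite S \<and> (\<forall>p\<in>S. p $ i = k)
     \<and> D = (\<Union>p\<in>S. cbox (lattice_pt p) (lattice_pt (p + 1 - axis i 1))))"

text \<open>The interior of a planar region is taken relative to its plane.\<close>

definition cylinder_base :: "3 \<Rightarrow> int \<Rightarrow> (real ^ 3) set \<Rightarrow> bool" where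
  "cylinder_base i k D \<longleftrightarrow> planar_region i k D \<and> simply_connected D
     \<and> connected (top_of_set (basic_plane i k) interior_of D)"

definition extrude :: "(real ^ 3) set \<Rightarrow> nat \<Rightarrow> real ^ 3 \<Rightarrow> (real ^ 3) set" where
  "extrude D N w = {p + s *\<^sub>R w | p s. p \<in> D \<and> s \<in> {0..real N}}"

definition cylinder :: "(real ^ 3) set \<Rightarrow> bool" where
  "cylinder R \<longleftrightarrow> (\<exists>i k D N. cylinder_base i k D \<and> N > 0 \<and> R = extrude D N (axis i 1))"

text \<open>Here the plane \<open>\<real>\<^sup>2\<close> is identified with the plane \<open>z = 0\<close> in \<open>\<real>\<^sup>3\<close>.\<close>

definition duplex :: "(real ^ 3) set \<Rightarrow> bool" where
  "duplex R \<longleftrightarrow> (\<exists>D. cylinder_base 3 0 D \<and> R = extrude D 2 (axis 3 1))"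

section \<open>Twist\<close>

definition shade :: "real ^ 3 \<Rightarrow> (real ^ 3) set \<Rightarrow> (real ^ 3) set" where
  "shade u X = interior ({x + s *\<^sub>R u | x s. x \<in> X \<and> s \<ge> 0} - X)"

definition effect :: "real ^ 3 \<Rightarrow> (real ^ 3) set \<Rightarrow> (real ^ 3) set \<Rightarrow> real" where
  "effect u d0 d1 = (if d1 \<inter> shade u d0 \<noteq> {}
     then 1 / 4 * det3 (domino_dir d1) (domino_dir d0) u else 0)"

definition pretwist :: "real ^ 3 \<Rightarrow> (real ^ 3) set set \<Rightarrow> real" where
  "pretwist u t = (\<Sum>(d0, d1) \<in> t \<times> t. effect u d0 d1)"

text \<open>The twist is meaningful only if the three pretwists coincide.\<close>

definition twist :: "(real ^ 3) set set \<Rightarrow> real" where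
  "twist t = (THE T. \<forall>i. pretwist (axis i 1) t = T)"

section \<open>The polynomial \<open>P\<^sub>t\<close> of a tiling of a duplex region\<close>

text \<open>
  The plane of projection is identified with the complex plane, so that the library's
  \<^const>\<open>winding_number\<close> applies. A jewel is represented by the lower left corner of its square.
\<close>

definition proj :: "real ^ 3 \<Rightarrow> complex" where
  "proj x = Complex (x $ 1) (x $ 2)"

definition parallel_z :: "(real ^ 3) set \<Rightarrow> bool" where
  "parallel_z d \<longleftrightarrow> domino_dir d = axis 3 1 \<or> domino_dir d = - axis 3 1"

definition jewels :: "(real ^ 3) set set \<Rightarrow> (int \<times> int) set" where
  "jewels t = (\<lambda>d. (white_cube d $ 1, white_cube d $ 2)) ` {d \<in> t. parallel_z d}"

definition jewel_color :: "int \<times> int \<Rightarrow> real" where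
  "jewel_color j = (if even (fst j + snd j) then 1 else - 1)"

definition jewel_center :: "int \<times> int \<Rightarrow> complex" where
  "jewel_center j = Complex (of_int (fst j) + 1 / 2) (of_int (snd j) + 1 / 2)"

definition segments :: "(real ^ 3) set set \<Rightarrow> (complex \<times> complex) set" where
  "segments t = (\<lambda>d. (proj (cube_center (white_cube d)), proj (cube_center (black_cube d))))
     ` {d \<in> t. \<not> parallel_z d}"

text \<open>
  A closed curve is represented by its set of oriented segments: the segments joining the
  consecutive points of a cyclic sequence of distinct points.
\<close>

definition traverses :: "complex list \<Rightarrow> (complex \<times> complex) set \<Rightarrow> bool" where
  "traverses xs C \<longleftrightarrow> xs \<noteq> [] \<and> distinct xs \<and> C = set (zip xs (rotate1 xs))"

definition curves :: "(real ^ 3) set set \<Rightarrow> (complex \<times> complex) set set" where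
  "curves t = {C. C \<subseteq> segments t \<and> (\<exists>xs. traverses xs C)}"

fun polyline :: "complex list \<Rightarrow> real \<Rightarrow> complex" where
  "polyline [] = linepath 0 0"
| "polyline [x] = linepath x x"
| "polyline [x, y] = linepath x y"
| "polyline (x # y # z # zs) = linepath x y +++ polyline (y # z # zs)"

text \<open>The choice of \<open>xs\<close> only fixes the starting point on the curve.\<close>

definition curve_wind :: "(complex \<times> complex) set \<Rightarrow> complex \<Rightarrow> complex" where
  "curve_wind C p = (let xs = (SOME xs. traverses xs C)
                     in winding_number (polyline (xs @ [hd xs])) p)"

definition jewel_wind :: "(real ^ 3) set set \<Rightarrow> int \<times> int \<Rightarrow> int" where
  "jewel_wind t j = (THE k. of_int k = (\<Sum>C \<in> curves t. curve_wind C (jewel_center j)))"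

text \<open>The exponents may be negative, so \<open>P\<^sub>t\<close> is a Laurent polynomial, taken as a function of \<open>q\<close>.\<close>

definition duplex_poly :: "(real ^ 3) set set \<Rightarrow> real \<Rightarrow> real" where
  "duplex_poly t q = (\<Sum>j \<in> jewels t. jewel_color j * q powi jewel_wind t j)"

end

theory Submission
  imports Defs "HOL-Combinatorics.Cycles"
begin

text \<open>
  Let \<open>\<epsilon>\<close> be the colouring by signs, \<open>K v\<close> the product of the signs of the coordinates of \<open>v\<close>, and
  \<open>\<langle>P, Q\<rangle> = \<Sum>p\<in>P, q\<in>Q. \<epsilon> p \<epsilon> q K (q - p)\<close> for finite sets of cubes, an antisymmetric form. If \<open>C\<^sub>i\<close> is
  the union of the dominoes parallel to the \<open>i\<close>-th axis, then summing over the two cubes of a domino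
  turns one sign function into an indicator, so that the \<open>k\<close>-th pretwist is \<open>\<langle>C\<^sub>k\<^sub>+\<^sub>1, C\<^sub>k\<^sub>+\<^sub>2\<rangle> / 4\<close>.
  For a \<open>2 \<times> 2 \<times> 1\<close> square \<open>S\<close> of cubes, \<open>\<langle>S, d\<rangle> = 0\<close> for every domino \<open>d\<close> orthogonal to \<open>S\<close> and disjoint
  from it, and \<open>\<langle>S, R\<rangle> = 0\<close> for every cylinder \<open>R\<close> containing \<open>S\<close>.

  By antisymmetry two pretwists differ by \<open>\<langle>R, C\<^sub>j\<rangle> / 4\<close>. This is the total of a weight on the dominoes
  which is closed on squares, hence exact because the base is simply connected, hence the same for all
  tilings; comparison with a tiling by dominoes along the axis gives 0. The same argument applied to
  the mixed terms of a union gives additivity. Flips and trits change the sets \<open>C\<^sub>i\<close> by squares.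
  For a duplex region \<open>\<langle>C\<^sub>2, C\<^sub>3\<rangle>\<close> is a sum over the jewels, in which each jewel counts the signed
  crossings of the curves with its row, i.e. four times a winding number. Integrality is a count
  modulo 4 in each column of the cylinder.
\<close>

text \<open>The kernel treats the three axes alike, which is why it can compare the pretwists: all
  three are values of one form on different pairs of classes. Being integral, it leaves the division
  by 4 to the very end.

  Tilings of a cylinder need not be connected by flips, so invariance of a weight on squares does
  not by itself make its total the same for all tilings; the potential replaces a chain of flips.
  Exactness comes from the base: the sum of a closed weight along a closed walk is a sum of curls
  weighted by winding numbers, and no walk winds about a missing square.

  An axial comparison tiling needs even depth. For odd depth it is replaced by a cancellation of
  signs along each column, which makes every single cube pair to 0 with the cylinder.

  Divisibility by 4 is the only global arithmetic fact: a single pair of dominoes contributes 0, 1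
  or -1 to \<open>twist4\<close>. Only after the cubes are told apart as lower and upper ones does a
  coefficient 4 split off, and the rest is a parity question about the multigraph that the
  transverse dominoes draw on the base.\<close>

no_notation fps_nth (infixl \<open>$\<close> 75)

section \<open>An antisymmetric form on sets of cubes\<close>

abbreviation ax :: "3 \<Rightarrow> int ^ 3" where
  "ax i \<equiv> axis i 1"

definition colour :: "int ^ 3 \<Rightarrow> int" where
  "colour p = (if white p then 1 else - 1)"

lemma UNIV_3_rot: "(UNIV :: 3 set) = {k, k + 1, k + 2}"
proof -
  have *: "(4 :: 3) = 1" "(5 :: 3) = 2" by simp_all
  show ?thesis using exhaust_3[of k] UNIV_3 by (auto simp: *)
qed

lemma rot_3:
  fixes j :: 3
  shows "j + 1 + 1 = j + 2" "j + 1 + 2 = j" "j + 2 + 1 = j" "j + 2 + 2 = j + 1"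
    "j + 1 \<noteq> j" "j + 2 \<noteq> j" "j + 1 \<noteq> j + 2"
  by simp_all

lemma exhaust_3_rot: "i = k \<or> i = k + 1 \<or> i = k + 2" for i k :: 3
  using UNIV_3_rot[of k] by auto

lemma exhaust_3_distinct:
  fixes i j k l :: 3
  assumes "j \<noteq> k" "k \<noteq> l" "j \<noteq> l"
  shows "i = j \<or> i = k \<or> i = l"
  using assms exhaust_3[of i] exhaust_3[of j] exhaust_3[of k] exhaust_3[of l] by auto

lemma colour_add_ax [simp]: "colour (p + ax i) = - colour p"
  using exhaust_3[of i] by (auto simp: colour_def white_def axis_def)

lemma colour_mult_self [simp]: "colour p * colour p = 1"
  by (simp add: colour_def)

lemma colour_cases: "colour p = 1 \<or> colour p = - 1"
  by (simp add: colour_def)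

definition sgn3 :: "int ^ 3 \<Rightarrow> int" where
  "sgn3 v = sgn (v $ 1) * sgn (v $ 2) * sgn (v $ 3)"

lemma sgn3_distinct:
  assumes "j \<noteq> k" "k \<noteq> l" "j \<noteq> l"
  shows "sgn3 v = sgn (v $ j) * sgn (v $ k) * sgn (v $ l)"
  using assms exhaust_3[of j] exhaust_3[of k] exhaust_3[of l] by (auto simp: sgn3_def)

lemma sgn3_minus: "sgn3 (p - q) = - sgn3 (q - p)"
proof -
  have "sgn (a - b) = - sgn (b - a)" for a b :: int
    by (simp add: sgn_if)
  from this[of "p $ 1" "q $ 1"] this[of "p $ 2" "q $ 2"] this[of "p $ 3" "q $ 3"]
  show ?thesis by (simp add: sgn3_def)
qed

definition pairing :: "(int ^ 3) set \<Rightarrow> (int ^ 3) set \<Rightarrow> int" where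
  "pairing P Q = (\<Sum>p\<in>P. \<Sum>q\<in>Q. colour p * colour q * sgn3 (q - p))"

lemma pairing_swap: "pairing P Q = - pairing Q P"
proof -
  have "colour p * colour q * sgn3 (q - p) = - (colour q * colour p * sgn3 (p - q))" for p q
    using sgn3_minus[of p q] by simp
  then have "pairing P Q = - (\<Sum>p\<in>P. \<Sum>q\<in>Q. colour q * colour p * sgn3 (p - q))"
    unfolding pairing_def sum_negf[symmetric] by (intro sum.cong refl)
  then show ?thesis
    unfolding pairing_def by (subst (2) sum.swap)
qed

lemma pairing_self [simp]: "pairing P P = 0"
  using pairing_swap[of P P] by simp

lemma pairing_empty [simp]: "pairing {} Q = 0" "pairing P {} = 0"
  by (simp_all add: pairing_def)

lemma pairing_Un_left:
  "finite P \<Longrightarrow> finite P' \<Longrightarrow> P \<inter> P' = {} \<Longrightarrow> pairing (P \<union> P') Q = pairing P Q + pairing P' Q"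
  by (simp add: pairing_def sum.union_disjoint)

lemma pairing_Un_right:
  "finite Q \<Longrightarrow> finite Q' \<Longrightarrow> Q \<inter> Q' = {} \<Longrightarrow> pairing P (Q \<union> Q') = pairing P Q + pairing P Q'"
  by (simp add: pairing_def sum.union_disjoint sum.distrib)

lemma pairing_Diff_right:
  assumes "finite Q" "Q' \<subseteq> Q"
  shows "pairing P (Q - Q') = pairing P Q - pairing P Q'"
  using pairing_Un_right[of "Q - Q'" Q' P] assms
  by (simp add: Diff_Int_distrib2 Un_absorb2 finite_subset)

lemma pairing_left_sum: "pairing P Q = (\<Sum>p\<in>P. pairing {p} Q)"
  by (simp add: pairing_def)

lemma pairing_right_sum: "pairing P Q = (\<Sum>q\<in>Q. pairing P {q})"
  unfolding pairing_def by (subst sum.swap) simp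

lemma pairing_Diff_left:
  assumes "finite Q" "Q' \<subseteq> Q"
  shows "pairing (Q - Q') P = pairing Q P - pairing Q' P"
  using pairing_Un_left[of "Q - Q'" Q' P] assms
  by (simp add: Diff_Int_distrib2 Un_absorb2 finite_subset)

text \<open>A domino is coded by its lower cube and its direction.\<close>

definition edge :: "(int ^ 3) \<times> 3 \<Rightarrow> (int ^ 3) set" where
  "edge m = {fst m, fst m + ax (snd m)}"

definition square :: "int ^ 3 \<Rightarrow> 3 \<Rightarrow> 3 \<Rightarrow> (int ^ 3) set" where
  "square c j k = {c, c + ax j, c + ax k, c + ax j + ax k}"

lemma ax_neq_0 [simp]: "ax i \<noteq> 0"
  by (simp add: axis_eq_0_iff)

lemma ax_nth: "ax i $ j = (if j = i then 1 else 0)"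
  by (simp add: axis_def)

lemma ax_eq_iff [simp]: "ax i = ax j \<longleftrightarrow> i = j"
  by (auto simp: axis_eq_axis)

lemma finite_edge [simp]: "finite (edge m)"
  by (simp add: edge_def)

lemma finite_square [simp]: "finite (square c j k)"
  by (simp add: square_def)

lemma edge_sum: "(\<Sum>p\<in>edge (a, i). F p) = F a + F (a + ax i)"
  by (simp add: edge_def)

lemma ax_add_neq [simp]: "ax j + ax k \<noteq> 0"
proof
  assume "ax j + ax k = 0"
  then have "(ax j + ax k) $ j = 0 $ j" by simp
  then show False by (auto simp: ax_nth split: if_splits)
qed

lemma square_sum:
  assumes "j \<noteq> k"
  shows "(\<Sum>p\<in>square c j k. F p) = F c + F (c + ax j) + F (c + ax k) + F (c + ax j + ax k)"
proof -
  have "c \<noteq> c + ax j" "c \<noteq> c + ax k" "c + ax j \<noteq> c + ax k" "c \<noteq> c + ax j + ax k"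
    "c + ax j \<noteq> c + ax j + ax k" "c + ax k \<noteq> c + ax j + ax k"
    using assms by (simp_all add: add.assoc)
  then show ?thesis
    unfolding square_def by (simp del: add_left_cancel add_cancel_left_right add: add.assoc)
qed

text \<open>The signed sum over the eight pairs of cubes factors into one difference of consecutive
  signs per coordinate. Each difference is, up to sign, the indicator of two consecutive integers,
  and all three are nonzero only if square and domino share a cube.\<close>

lemma pairing_square_edge:
  assumes jkl: "j \<noteq> k" "k \<noteq> l" "j \<noteq> l"
    and disj: "square c j k \<inter> edge (a, l) = {}"
  shows "pairing (square c j k) (edge (a, l)) = 0"
proof -
  define f where "f = (\<lambda>n :: int. sgn n - sgn (n - 1))"
  define g where "g = (\<lambda>n :: int. sgn n - sgn (n + 1))"
  have expand: "e * (A0 * B0 * C0) - e * (A0 * B0 * C1) + (e * (A1 * B0 * C1) - e * (A1 * B0 * C0))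
    + (e * (A0 * B1 * C1) - e * (A0 * B1 * C0)) + (e * (A1 * B1 * C0) - e * (A1 * B1 * C1))
    = e * ((A0 - A1) * (B0 - B1) * (C0 - C1))" for e A0 A1 B0 B1 C0 C1 :: int
    by (simp add: algebra_simps)
  have "pairing (square c j k) (edge (a, l)) =
    colour c * colour a * (f (a $ j - c $ j) * f (a $ k - c $ k) * g (a $ l - c $ l))"
    using jkl unfolding pairing_def
    by (simp add: square_sum edge_sum sgn3_distinct[OF jkl] ax_nth f_def g_def
        diff_diff_eq[of "a $ j" "c $ j" 1] diff_diff_eq[of "a $ k" "c $ k" 1]
        diff_add_eq[of "a $ l" "c $ l" 1] expand)
  moreover have False if "f (a $ j - c $ j) * f (a $ k - c $ k) * g (a $ l - c $ l) \<noteq> 0"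
  proof -
    have *: "n = 0 \<or> n = 1" if "f n \<noteq> 0" for n
      using that by (auto simp: f_def sgn_if split: if_splits)
    have **: "n = 0 \<or> n = - 1" if "g n \<noteq> 0" for n
      using that by (auto simp: g_def sgn_if split: if_splits)
    have j: "a $ j = c $ j \<or> a $ j = c $ j + 1" and k: "a $ k = c $ k \<or> a $ k = c $ k + 1"
      and l: "c $ l = a $ l \<or> c $ l = a $ l + 1"
      using *[of "a $ j - c $ j"] *[of "a $ k - c $ k"] **[of "a $ l - c $ l"] that by auto
    \<comment> \<open>The common cube: the coordinate along \<open>l\<close> comes from the square,
      the other two from the domino.\<close>
    define x where "x = (\<chi> i. if i = l then c $ l else a $ i)"
    have "x \<in> edge (a, l)"
      using l by (auto simp: edge_def x_def vec_eq_iff ax_nth)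
    moreover have "x \<in> square c j k"
    proof -
      have "x = c + (if a $ j = c $ j then 0 else ax j) + (if a $ k = c $ k then 0 else ax k)"
        unfolding vec_eq_iff
      proof
        fix i
        consider "i = j" | "i = k" | "i = l"
          using exhaust_3_distinct[OF jkl] by auto
        then show "x $ i = (c + (if a $ j = c $ j then 0 else ax j) + (if a $ k = c $ k then 0
            else ax k)) $ i"
          using j k jkl by cases (auto simp: x_def ax_nth)
      qed
      then show ?thesis
        by (auto simp: square_def)
    qed
    ultimately show False using disj by auto
  qed
  ultimately show ?thesis by auto
qed

section \<open>Tilings in lattice coordinates and their direction classes\<close>

definition lattice_tiling :: "(int ^ 3) set \<Rightarrow> ((int ^ 3) \<times> 3) set \<Rightarrow> bool" where
  "lattice_tiling C M \<longleftrightarrow> disjoint_family_on edge M \<and> (\<Union>m\<in>M. edge m) = C"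

definition dir_cells :: "3 \<Rightarrow> ((int ^ 3) \<times> 3) set \<Rightarrow> (int ^ 3) set" where
  "dir_cells i M = (\<Union>m\<in>{m\<in>M. snd m = i}. edge m)"

text \<open>Four times the pretwist along \<open>k\<close>, by \<open>pretwist_codes\<close>.
  Staying in the integers turns integrality of the twist into divisibility by 4.\<close>

definition twist4 :: "3 \<Rightarrow> ((int ^ 3) \<times> 3) set \<Rightarrow> int" where
  "twist4 k M = pairing (dir_cells (k + 1) M) (dir_cells (k + 2) M)"

lemma lattice_tiling_finite:
  assumes "lattice_tiling C M" "finite C"
  shows "finite M"
proof (rule finite_subset)
  show "M \<subseteq> C \<times> UNIV"
  proof
    fix m assume "m \<in> M"
    then have "fst m \<in> C"
      using assms by (auto simp: lattice_tiling_def edge_def)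
    then show "m \<in> C \<times> UNIV"
      by (cases m) simp
  qed
qed (use assms in simp)

lemma lattice_tiling_sum:
  assumes "lattice_tiling C M" "finite C"
  shows "(\<Sum>p\<in>C. F p) = (\<Sum>m\<in>M. \<Sum>p\<in>edge m. F p)"
proof -
  have C: "C = (\<Union>m\<in>M. edge m)"
    using assms(1) by (simp add: lattice_tiling_def)
  show ?thesis
    unfolding C using assms lattice_tiling_finite[OF assms]
    by (intro sum.UNION_disjoint) (simp_all add: lattice_tiling_def disjoint_family_on_def)
qed

lemma lattice_tiling_eqI: "lattice_tiling C M \<Longrightarrow> m \<in> M \<Longrightarrow> m' \<in> M \<Longrightarrow> p \<in> edge m \<Longrightarrow> p \<in> edge m' \<Longrightarrow> m = m'"
  by (auto simp: lattice_tiling_def disjoint_family_on_def)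

lemma dir_cells_subset: "lattice_tiling C M \<Longrightarrow> dir_cells i M \<subseteq> C"
  by (auto simp: lattice_tiling_def dir_cells_def)

lemma dir_cells_disjoint:
  assumes "lattice_tiling C M" "i \<noteq> j"
  shows "dir_cells i M \<inter> dir_cells j M = {}"
proof -
  have False if "p \<in> dir_cells i M" "p \<in> dir_cells j M" for p
    using that assms(2) lattice_tiling_eqI[OF assms(1)] unfolding dir_cells_def by blast
  then show ?thesis by blast
qed

lemma lattice_tiling_dir_cells: 
  assumes "lattice_tiling C M"
  shows "C = dir_cells k M \<union> dir_cells (k + 1) M \<union> dir_cells (k + 2) M"
proof -
  have "C = (\<Union>m\<in>M. edge m)" using assms by (simp add: lattice_tiling_def)
  also have "M = {m\<in>M. snd m = k} \<union> {m\<in>M. snd m = k + 1} \<union> {m\<in>M. snd m = k + 2}"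
    using exhaust_3_rot[of _ k] by blast
  also have "(\<Union>m\<in>\<dots>. edge m) = dir_cells k M \<union> dir_cells (k + 1) M \<union> dir_cells (k + 2) M"
    by (simp add: dir_cells_def UN_Un)
  finally show ?thesis .
qed

lemma lattice_tiling_dir_cells_sum:
  assumes "lattice_tiling C M" "finite C"
  shows "(\<Sum>p\<in>dir_cells i M. F p) = (\<Sum>m\<in>{m\<in>M. snd m = i}. \<Sum>p\<in>edge m. F p)"
  unfolding dir_cells_def using assms lattice_tiling_finite[OF assms] 
  by (intro sum.UNION_disjoint) (auto simp: lattice_tiling_def disjoint_family_on_def)

lemma pairing_dir_cells_right:
  assumes "lattice_tiling C M" "finite C"
  shows "pairing P (dir_cells i M) = (\<Sum>m\<in>{m\<in>M. snd m = i}. pairing P (edge m))"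
  unfolding pairing_right_sum[of P "dir_cells i M"] lattice_tiling_dir_cells_sum[OF assms]
  by (rule sum.cong[OF refl], rule pairing_right_sum[symmetric])

lemma pairing_dir_cells_left:
  assumes "lattice_tiling C M" "finite C"
  shows "pairing (dir_cells i M) P = (\<Sum>m\<in>{m\<in>M. snd m = i}. pairing (edge m) P)"
  unfolding pairing_left_sum[of "dir_cells i M" P] lattice_tiling_dir_cells_sum[OF assms]
  by (rule sum.cong[OF refl], rule pairing_left_sum[symmetric])

lemma pairing_lattice_tiling:
  assumes "lattice_tiling C M" "finite C"
  shows "pairing P C = pairing P (dir_cells k M) + pairing P (dir_cells (k + 1) M) + pairing P
      (dir_cells (k + 2) M)"
proof -
  have fin: "finite (dir_cells i M)" for i
    by (rule finite_subset[OF dir_cells_subset[OF assms(1)] assms(2)])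
  have "dir_cells k M \<inter> dir_cells (k + 1) M = {}" "dir_cells k M \<inter> dir_cells (k + 2) M = {}"
    "dir_cells (k + 1) M \<inter> dir_cells (k + 2) M = {}"
    by (rule dir_cells_disjoint[OF assms(1)], simp)+
  moreover have "pairing P C = pairing P (dir_cells k M \<union> dir_cells (k + 1) M \<union> dir_cells (k + 2)
      M)"
    using lattice_tiling_dir_cells[OF assms(1), of k] by simp
  ultimately show ?thesis
    using fin by (simp add: pairing_Un_right Int_Un_distrib2)
qed

lemma pairing_square_dir_cells:
  assumes "lattice_tiling C M" "finite C" "j \<noteq> k" "k \<noteq> l" "j \<noteq> l" "square c j k \<inter> dir_cells l M =
      {}"
  shows "pairing (square c j k) (dir_cells l M) = 0"
  unfolding pairing_dir_cells_right[OF assms(1,2)]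
proof (intro sum.neutral ballI)
  fix m assume m: "m \<in> {m \<in> M. snd m = l}"
  then have "square c j k \<inter> edge (fst m, l) = {}"
    using assms(6) by (force simp: dir_cells_def)
  then show "pairing (square c j k) (edge m) = 0"
    using pairing_square_edge[OF assms(3-5), of c "fst m"] m by auto
qed

text \<open>As \<^term>\<open>pairing\<close> is antisymmetric, \<open>pairing C\<^sub>j C\<^sub>j\<close> vanishes, and the three classes add up
  to \<open>C\<close>.\<close>

lemma twist4_diff:
  assumes "lattice_tiling C M" "finite C"
  shows "twist4 (j + 1) M - twist4 (j + 2) M = pairing C (dir_cells j M)"
proof -
  have "pairing (dir_cells j M) C = pairing (dir_cells j M) (dir_cells (j + 1) M) + pairing
      (dir_cells j M) (dir_cells (j + 2) M)"
    using pairing_lattice_tiling[OF assms, of _ j] by simp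
  moreover have "twist4 (j + 1) M = pairing (dir_cells (j + 2) M) (dir_cells j M)"
    by (simp only: twist4_def rot_3)
  moreover have "twist4 (j + 2) M = pairing (dir_cells j M) (dir_cells (j + 1) M)"
    by (simp only: twist4_def rot_3)
  ultimately show ?thesis
    using pairing_swap[of C "dir_cells j M"] pairing_swap[of "dir_cells (j + 2) M" "dir_cells j
        M"] by linarith
qed

section \<open>Closed weights on cylinders\<close>

text \<open>The first cohomology of the grid complex on \<open>D\<close>, with integer coefficients,
  vanishes: \<open>h\<close> and \<open>v\<close> are weights on horizontal and vertical unit steps,
  and only blocks of four squares inside \<open>D\<close> impose closedness. In this shape simple
  connectedness of the base reaches the tilings.\<close>

definition planar_exact :: "(int \<times> int) set \<Rightarrow> bool" where
  "planar_exact D \<longleftrightarrow> (\<forall>h v :: int \<Rightarrow> int \<Rightarrow> int.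
     (\<forall>x y. (x, y) \<in> D \<and> (x + 1, y) \<in> D \<and> (x, y + 1) \<in> D \<and> (x + 1, y + 1) \<in> D \<longrightarrow>
        h x y + v (x + 1) y = v x y + h x (y + 1)) \<longrightarrow>
     (\<exists>f. (\<forall>x y. (x, y) \<in> D \<and> (x + 1, y) \<in> D \<longrightarrow> h x y = f (x + 1) y - f x y) \<and>
          (\<forall>x y. (x, y) \<in> D \<and> (x, y + 1) \<in> D \<longrightarrow> v x y = f x (y + 1) - f x y)))"

definition cyl_cells :: "3 \<Rightarrow> int \<Rightarrow> (int \<times> int) set \<Rightarrow> nat \<Rightarrow> (int ^ 3) set" where
  "cyl_cells i k D N = {p. (p $ (i + 1), p $ (i + 2)) \<in> D \<and> k \<le> p $ i \<and> p $ i < k + int N}"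

definition mk_pt :: "3 \<Rightarrow> int \<Rightarrow> int \<Rightarrow> int \<Rightarrow> int ^ 3" where
  "mk_pt i m u v = (\<chi> j. if j = i then m else if j = i + 1 then u else v)"

lemma mk_pt_nth [simp]:
  "mk_pt i m u v $ i = m" "mk_pt i m u v $ (i + 1) = u" "mk_pt i m u v $ (i + 2) = v"
  by (simp_all add: mk_pt_def)

lemma vec_3_eqI:
  fixes p q :: "'a ^ 3"
  assumes "p $ i = q $ i" "p $ (i + 1) = q $ (i + 1)" "p $ (i + 2) = q $ (i + 2)"
  shows "p = q"
  unfolding vec_eq_iff
proof
  fix j show "p $ j = q $ j"
    using assms exhaust_3_rot[of j i] by auto
qed

lemma mk_pt_self [simp]: "mk_pt i (p $ i) (p $ (i + 1)) (p $ (i + 2)) = p"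
  by (rule vec_3_eqI[of _ i]) simp_all

lemma mk_pt_eq_iff: "mk_pt i m u v = mk_pt i m' u' v' \<longleftrightarrow> m = m' \<and> u = u' \<and> v = v'"
  by (metis mk_pt_nth)

lemma mk_pt_add:
  "mk_pt i m u v + ax i = mk_pt i (m + 1) u v"
  "mk_pt i m u v + ax (i + 1) = mk_pt i m (u + 1) v"
  "mk_pt i m u v + ax (i + 2) = mk_pt i m u (v + 1)"
  by (rule vec_3_eqI[of _ i], simp_all add: ax_nth)+

lemma mk_pt_mem_cyl_cells:
  "mk_pt i m u v \<in> cyl_cells i k D N \<longleftrightarrow> (u, v) \<in> D \<and> k \<le> m \<and> m < k + int N"
  by (simp add: cyl_cells_def)

lemma cyl_cells_sum:
  "(\<Sum>p\<in>cyl_cells i k D N. F p) = (\<Sum>(u, v)\<in>D. \<Sum>n<N. F (mk_pt i (k + int n) u v))"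
proof -
  define g where "g = (\<lambda>((u, v), n). mk_pt i (k + int n) u v)"
  have "bij_betw g (D \<times> {..<N}) (cyl_cells i k D N)"
    unfolding bij_betw_def
  proof
    show "inj_on g (D \<times> {..<N})"
      using mk_pt_eq_iff by (auto simp: inj_on_def g_def)
    show "g ` (D \<times> {..<N}) = cyl_cells i k D N"
    proof
      show "g ` (D \<times> {..<N}) \<subseteq> cyl_cells i k D N"
        by (auto simp: g_def mk_pt_mem_cyl_cells)
      show "cyl_cells i k D N \<subseteq> g ` (D \<times> {..<N})"
      proof
        fix p assume p: "p \<in> cyl_cells i k D N"
        then have "p = g ((p $ (i + 1), p $ (i + 2)), nat (p $ i - k))"
          by (simp add: g_def cyl_cells_def)
        then show "p \<in> g ` (D \<times> {..<N})"
          using p by (force simp: cyl_cells_def)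
      qed
    qed
  qed
  then have "(\<Sum>p\<in>cyl_cells i k D N. F p) = (\<Sum>x\<in>D \<times> {..<N}. F (g x))"
    by (simp add: sum.reindex_bij_betw)
  also have "\<dots> = (\<Sum>d\<in>D. \<Sum>n<N. F (g (d, n)))"
    by (simp add: sum.cartesian_product)
  finally show ?thesis
    by (simp add: g_def case_prod_beta)
qed

lemma finite_cyl_cells: 
  assumes "finite D"
  shows "finite (cyl_cells i k D N)"
proof (rule finite_subset)
  show "cyl_cells i k D N \<subseteq> (\<lambda>(m, u, v). mk_pt i m u v) ` ({k..<k + int N} \<times> D)"
  proof
    fix p assume p: "p \<in> cyl_cells i k D N"
    have "p = (\<lambda>(m, u, v). mk_pt i m u v) (p $ i, p $ (i + 1), p $ (i + 2))" by simp
    then show "p \<in> (\<lambda>(m, u, v). mk_pt i m u v) ` ({k..<k + int N} \<times> D)"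
      using p by (force simp: cyl_cells_def)
  qed
qed (use assms in simp)

text \<open>The vertical squares make the horizontal weights of a layer differ from those of the
  bottom layer by the gradient of the vertical sums \<open>Z\<close>. A potential of the bottom
  layer plus \<open>Z\<close> therefore serves for the whole cylinder.\<close>

lemma closed_imp_exact:
  fixes lam :: "3 \<Rightarrow> int ^ 3 \<Rightarrow> int"
  assumes D: "planar_exact D" and C: "C = cyl_cells i k D N"
    and closed: "\<And>j l c. j \<noteq> l \<Longrightarrow> square c j l \<subseteq> C \<Longrightarrow>
      lam j c + lam l (c + ax j) = lam l c + lam j (c + ax l)"
  shows "\<exists>f. \<forall>j c. c \<in> C \<longrightarrow> c + ax j \<in> C \<longrightarrow> lam j c = f (c + ax j) - f c"
proof -
  define z where "z = (\<lambda>m u v. lam i (mk_pt i m u v))"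
  define h where "h = (\<lambda>m u v. lam (i + 1) (mk_pt i m u v))"
  define w where "w = (\<lambda>m u v. lam (i + 2) (mk_pt i m u v))"
  have C_iff: "mk_pt i m u v \<in> C \<longleftrightarrow> (u, v) \<in> D \<and> k \<le> m \<and> m < k + int N" for m u v
    by (simp add: C mk_pt_mem_cyl_cells)
  have hw: "h m u v + w m (u + 1) v = w m u v + h m u (v + 1)"
    if "(u, v) \<in> D" "(u + 1, v) \<in> D" "(u, v + 1) \<in> D" "(u + 1, v + 1) \<in> D"
      "k \<le> m" "m < k + int N" for m u v
    using closed[of "i + 1" "i + 2" "mk_pt i m u v"] that
    by (simp add: square_def mk_pt_add C_iff h_def w_def)
  have zh: "h (m + 1) u v = h m u v + (z m (u + 1) v - z m u v)"
    if "(u, v) \<in> D" "(u + 1, v) \<in> D" "k \<le> m" "m + 1 < k + int N" for m u v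
    using closed[of "i" "i + 1" "mk_pt i m u v"] that
    by (simp add: square_def mk_pt_add C_iff h_def z_def)
  have zw: "w (m + 1) u v = w m u v + (z m u (v + 1) - z m u v)"
    if "(u, v) \<in> D" "(u, v + 1) \<in> D" "k \<le> m" "m + 1 < k + int N" for m u v
    using closed[of "i" "i + 2" "mk_pt i m u v"] that
    by (simp add: square_def mk_pt_add C_iff w_def z_def)
  define Z where "Z = (\<lambda>n u v. \<Sum>m<n. z (k + int m) u v)"
  have h_Z: "h (k + int n) u v = h k u v + (Z n (u + 1) v - Z n u v)"
    if "(u, v) \<in> D" "(u + 1, v) \<in> D" "n < N" for n u v
    using that(3)
  proof (induction n)
    case (Suc n)
    have "k + int (Suc n) = (k + int n) + 1" by simp
    then show ?case
      using Suc zh[OF that(1,2), of "k + int n"] by (simp add: Z_def add_ac)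
  qed (simp add: Z_def)
  have w_Z: "w (k + int n) u v = w k u v + (Z n u (v + 1) - Z n u v)"
    if "(u, v) \<in> D" "(u, v + 1) \<in> D" "n < N" for n u v
    using that(3)
  proof (induction n)
    case (Suc n)
    have "k + int (Suc n) = (k + int n) + 1" by simp
    then show ?case
      using Suc zw[OF that(1,2), of "k + int n"] by (simp add: Z_def add_ac)
  qed (simp add: Z_def)
  obtain f where f: "N > 0 \<Longrightarrow> (u, v) \<in> D \<Longrightarrow> (u + 1, v) \<in> D \<Longrightarrow> h k u v = f (u + 1) v - f u v"
    "N > 0 \<Longrightarrow> (u, v) \<in> D \<Longrightarrow> (u, v + 1) \<in> D \<Longrightarrow> w k u v = f u (v + 1) - f u v" for u v
  proof (cases "N > 0")
    case True
    have "\<forall>x y. (x, y) \<in> D \<and> (x + 1, y) \<in> D \<and> (x, y + 1) \<in> D \<and> (x + 1, y + 1) \<in> D \<longrightarrow>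
        h k x y + w k (x + 1) y = w k x y + h k x (y + 1)"
      using hw[of _ _ k] True by auto
    with D have "\<exists>f. (\<forall>x y. (x, y) \<in> D \<and> (x + 1, y) \<in> D \<longrightarrow> h k x y = f (x + 1) y - f x y) \<and>
          (\<forall>x y. (x, y) \<in> D \<and> (x, y + 1) \<in> D \<longrightarrow> w k x y = f x (y + 1) - f x y)"
      unfolding planar_exact_def by blast
    then show ?thesis using that by blast
  qed auto
  define g where "g = (\<lambda>c. f (c $ (i + 1)) (c $ (i + 2)) + Z (nat (c $ i - k)) (c $ (i + 1)) (c $
      (i + 2)))"
  show ?thesis
  proof (intro exI[of _ g] allI impI)
    fix j c assume c: "c \<in> C" "c + ax j \<in> C"
    define m u v where "m = c $ i" and "u = c $ (i + 1)" and "v = c $ (i + 2)"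
    have c_eq: "c = mk_pt i m u v"
      by (simp add: m_def u_def v_def)
    define n where "n = nat (m - k)"
    have mn: "m = k + int n" "n < N" and uv: "(u, v) \<in> D"
      using c(1) by (auto simp: c_eq C_iff n_def)
    consider "j = i" | "j = i + 1" | "j = i + 2"
      using exhaust_3_rot by blast
    then show "lam j c = g (c + ax j) - g c"
    proof cases
      case 1
      have "nat (k + int n + 1 - k) = Suc n" by simp
      then show ?thesis
        using 1 by (simp add: c_eq mn mk_pt_add g_def Z_def z_def)
    next
      case 2
      then show ?thesis
        using c(2) h_Z[of u v n] f(1)[of u v] uv mn
        by (simp add: c_eq mk_pt_add g_def C_iff h_def)
    next
      case 3
      then show ?thesis
        using c(2) w_Z[of u v n] f(2)[of u v] uv mn
        by (simp add: c_eq mk_pt_add g_def C_iff w_def)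
    qed
  qed
qed

text \<open>By exactness the weight of a domino is a difference of potentials at its two cubes, with
  signs given by their colours, so the total weight of a tiling depends on the region only.\<close>

lemma closed_weight_tiling_indep:
  fixes G :: "3 \<Rightarrow> int ^ 3 \<Rightarrow> int"
  assumes D: "planar_exact D" "finite D" and C: "C = cyl_cells i k D N"
    and closed: "\<And>j l c. j \<noteq> l \<Longrightarrow> square c j l \<subseteq> C \<Longrightarrow>
      G j c + G j (c + ax l) = G l c + G l (c + ax j)"
    and "lattice_tiling C M" "lattice_tiling C M'"
  shows "(\<Sum>m\<in>M. G (snd m) (fst m)) = (\<Sum>m\<in>M'. G (snd m) (fst m))"
proof -
  \<comment> \<open>\<open>closed\<close> compares the two ways to cover a square by parallel
    dominoes and has only plus signs. The colour alternates along every step and turns it into the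
    cocycle condition of \<open>closed_imp_exact\<close>.\<close>
  have closed': "colour c * G j c + colour (c + ax j) * G l (c + ax j) = colour c * G l c + colour
      (c + ax l) * G j (c + ax l)"
    if "j \<noteq> l" "square c j l \<subseteq> C" for j l c
    using arg_cong[OF closed[OF that], of "\<lambda>x. colour c * x"] by (simp add: algebra_simps)
  obtain f where f: "\<And>j c. c \<in> C \<Longrightarrow> c + ax j \<in> C \<Longrightarrow> colour c * G j c = f (c + ax j) - f c"
    using closed_imp_exact[OF D(1) C closed'] by blast
  have "(\<Sum>m\<in>M. G (snd m) (fst m)) = - (\<Sum>p\<in>C. colour p * f p)" if "lattice_tiling C M" for M
  proof -
    have "G (snd m) (fst m) = - (\<Sum>p\<in>edge m. colour p * f p)" if "m \<in> M" for m
    proof -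
      have "fst m \<in> C" "fst m + ax (snd m) \<in> C"
        using that \<open>lattice_tiling C M\<close> by (auto simp: lattice_tiling_def edge_def)
      from arg_cong[OF f[OF this], of "\<lambda>x. colour (fst m) * x"] show ?thesis
        by (cases m) (simp add: edge_sum algebra_simps flip: mult.assoc)
    qed
    then have "(\<Sum>m\<in>M. G (snd m) (fst m)) = (\<Sum>m\<in>M. - (\<Sum>p\<in>edge m. colour p * f p))"
      by (intro sum.cong refl)
    also have "\<dots> = - (\<Sum>p\<in>C. colour p * f p)"
      using lattice_tiling_sum[OF that, of "\<lambda>p. colour p * f p"] finite_cyl_cells[OF D(2)] by
          (simp add: C sum_negf)
    finally show ?thesis .
  qed
  then show ?thesis using assms by simp
qed

section \<open>Pairing a cylinder with squares and with direction classes\<close>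

lemma sum_alternating_pairs:
  fixes g :: "int ^ 3 \<Rightarrow> int"
  assumes "finite A" "\<And>p. p \<in> A \<Longrightarrow> p $ j = b" "\<And>p. p \<in> A \<Longrightarrow> g (p + ax j) = - g p"
  shows "(\<Sum>p\<in>A \<union> (\<lambda>p. p + ax j) ` A. g p) = 0"
proof -
  have "p + ax j \<notin> A" if "p \<in> A" for p
  proof
    assume "p + ax j \<in> A"
    then show False
      using assms(2)[of p] assms(2)[of "p + ax j"] that by (simp add: ax_nth)
  qed
  then have "A \<inter> (\<lambda>p. p + ax j) ` A = {}"
    by blast
  then have "(\<Sum>p\<in>A \<union> (\<lambda>p. p + ax j) ` A. g p) = (\<Sum>p\<in>A. g p) + (\<Sum>p\<in>(\<lambda>p. p + ax j) ` A. g p)"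
    using assms(1) by (simp add: sum.union_disjoint)
  also have "(\<Sum>p\<in>(\<lambda>p. p + ax j) ` A. g p) = (\<Sum>p\<in>A. g (p + ax j))"
    by (subst sum.reindex) (auto simp: inj_on_def)
  also have "\<dots> = - (\<Sum>p\<in>A. g p)"
    using assms(3) by (simp add: sum_negf)
  finally show ?thesis by simp
qed

lemma exists_third_index: "\<exists>r :: 3. l \<noteq> r \<and> j \<noteq> r"
proof -
  have "(1 :: 3) \<noteq> 2" "(1 :: 3) \<noteq> 3" "(2 :: 3) \<noteq> 3" by simp_all
  then show ?thesis by metis
qed

lemma square_commute: "square c j l = square c l j"
  by (auto simp: square_def add_ac)

text \<open>Summing over the square restricts the other cube \<open>p\<close> to the two layers that
  the square meets in each of its directions, and leaves the colour of \<open>p\<close> times a sign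
  along the third direction. Exchanging the two layers along \<open>j\<close> maps the remaining set
  of cubes to itself and flips the colour, so the terms cancel in pairs.\<close>

lemma pairing_square_cylinder:
  assumes D: "finite D" and C: "C = cyl_cells i k D N" and jl: "j \<noteq> l" "square c j l \<subseteq> C"
  shows "pairing (square c j l) C = 0"
proof -
  have main: "pairing (square c j l) C = 0" if jl: "j \<noteq> l" "square c j l \<subseteq> C" and il: "i \<noteq> l" for
      j l
  proof -
    obtain r where r: "l \<noteq> r" "j \<noteq> r"
      using exists_third_index by blast
    define f where "f = (\<lambda>n :: int. sgn n - sgn (n - 1))"
    have f: "f n = (if n = 0 \<or> n = 1 then 1 else 0)" for n
      by (auto simp: f_def sgn_if)
    have finC: "finite C"
      using D C finite_cyl_cells by blast
    define P where "P = {p \<in> C. (p $ j = c $ j \<or> p $ j = c $ j + 1) \<and> (p $ l = c $ l \<or> p $ l = c $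
        l + 1)}"
    define g where "g = (\<lambda>p :: int ^ 3. colour p * sgn (p $ r - c $ r))"
    have expand: "e * d * (A0 * B0 * s) + (- (e * d * (A1 * B0 * s)) + (- (e * d * (A0 * B1 * s))
        + e * d * (A1 * B1 * s)))
      = e * ((A0 - A1) * (B0 - B1) * (d * s))" for e d A0 A1 B0 B1 s :: int
      by (simp add: algebra_simps)
    have summand: "(\<Sum>q\<in>square c j l. colour q * colour p * sgn3 (p - q)) =
      colour c * (f (p $ j - c $ j) * f (p $ l - c $ l) * g p)" for p
    proof -
      have "(\<Sum>q\<in>square c j l. colour q * colour p * sgn3 (p - q)) =
         colour c * colour p * sgn3 (p - c) + (- (colour c * colour p * sgn3 (p - (c + ax j)))
         + (- (colour c * colour p * sgn3 (p - (c + ax l))) + colour c * colour p * sgn3 (p - (c +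
             ax j + ax l))))"
        by (simp add: square_sum[OF jl(1)])
      then show ?thesis
        unfolding f_def g_def expand[symmetric] sgn3_distinct[OF jl(1) r]
        using jl(1) r by (simp add: ax_nth diff_diff_eq)
    qed
    have "pairing (square c j l) C = (\<Sum>p\<in>C. colour c * (f (p $ j - c $ j) * f (p $ l - c $ l) * g
        p))"
      unfolding pairing_def by (subst sum.swap) (simp add: summand)
    also have "\<dots> = colour c * (\<Sum>p\<in>C. if p \<in> P then g p else 0)"
      unfolding sum_distrib_left
      by (intro sum.cong refl) (auto simp: f P_def)
    also have "(\<Sum>p\<in>C. if p \<in> P then g p else 0) = (\<Sum>p\<in>P. g p)"
      by (subst sum.inter_restrict[OF finC, symmetric]) (auto simp: P_def Int_def conj_commute
          intro: sum.cong)
    also have "(\<Sum>p\<in>P. g p) = 0"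
    proof -
      have P_split: "P = {p \<in> P. p $ j = c $ j} \<union> (\<lambda>p. p + ax j) ` {p \<in> P. p $ j = c $ j}"
      proof -
        \<comment> \<open>If \<open>j\<close> is the axis, the square itself shows that both layers
          lie within the depth. Otherwise the axis is \<open>r\<close>, and the column of
          \<open>q\<close> is a column of the square.\<close>
        have move: "q \<in> C"
          if p: "p \<in> P" and q: "q $ j = c $ j \<or> q $ j = c $ j + 1" "\<And>s. s \<noteq> j \<Longrightarrow> q $ s = p $ s" for
              p q
        proof (cases "i = j")
          case True
          have "c \<in> C" "c + ax j \<in> C"
            using jl(2) by (auto simp: square_def)
          then have "k \<le> c $ j" "c $ j + 1 < k + int N"
            using True by (auto simp: C cyl_cells_def ax_nth)
          moreover have "p \<in> C" using p by (simp add: P_def)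
          ultimately show ?thesis
            using q True by (auto simp: C cyl_cells_def)
        next
          case False
          then have ir: "i = r"
            using exhaust_3_distinct[OF jl(1) r(1,2), of i] il by simp
          have pl: "q $ l = c $ l \<or> q $ l = c $ l + 1"
            using p q(2)[of l] jl(1) by (auto simp: P_def)
          define x where "x = c + (if q $ j = c $ j then 0 else ax j) + (if q $ l = c $ l then 0
              else ax l)"
          have "x \<in> square c j l"
            by (auto simp: x_def square_def)
          then have "x \<in> C" using jl(2) by blast
          moreover have "x $ s = q $ s" if "s \<noteq> i" for s
          proof -
            have "s = j \<or> s = l"
              using exhaust_3_distinct[OF jl(1) r(1,2), of s] that ir by simp
            then show ?thesis
              using q(1) pl jl(1) by (auto simp: x_def ax_nth)
          qed
          moreover have "p \<in> C" "q $ i = p $ i"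
            using p q(2)[of i] False by (auto simp: P_def)
          ultimately show ?thesis
            by (simp add: C cyl_cells_def)
        qed
        have shift: "p + ax j \<in> C" if "p \<in> P" "p $ j = c $ j" for p
          using that by (intro move[of p]) (auto simp: ax_nth)
        have shift': "p - ax j \<in> C" if "p \<in> P" "p $ j = c $ j + 1" for p
          using that by (intro move[of p]) (auto simp: ax_nth)
        show ?thesis
        proof (intro equalityI subsetI)
          fix p assume p: "p \<in> P"
          show "p \<in> {p \<in> P. p $ j = c $ j} \<union> (\<lambda>p. p + ax j) ` {p \<in> P. p $ j = c $ j}"
          proof (cases "p $ j = c $ j")
            case False
            then have pj: "p $ j = c $ j + 1" using p by (auto simp: P_def)
            have "p - ax j \<in> {p \<in> P. p $ j = c $ j}"
              using shift'[OF p pj] p pj jl(1) by (auto simp: P_def ax_nth)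
            moreover have "p = (p - ax j) + ax j" by simp
            ultimately show ?thesis by blast
          qed (use p in auto)
        next
          fix p assume "p \<in> {p \<in> P. p $ j = c $ j} \<union> (\<lambda>p. p + ax j) ` {p \<in> P. p $ j = c $ j}"
          then show "p \<in> P"
          proof
            assume "p \<in> (\<lambda>p. p + ax j) ` {p \<in> P. p $ j = c $ j}"
            then obtain q where q: "q \<in> P" "q $ j = c $ j" "p = q + ax j" by auto
            then show ?thesis
              using shift[OF q(1,2)] jl(1) by (auto simp: P_def ax_nth)
          qed simp
        qed
      qed
      show ?thesis
        by (subst P_split, rule sum_alternating_pairs[of _ _ "c $ j"])
          (use finC r in \<open>auto simp: P_def g_def ax_nth\<close>)
    qed
    finally show ?thesis by simp
  qed
  show ?thesis
  \<comment> \<open>At most one direction of the square is the axis, so after exchanging the two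
    directions if necessary the second one is transverse.\<close>
  proof (cases "i = l")
    case True
    then show ?thesis
      using main[of l j] jl by (simp add: square_commute)
  qed (rule main[OF jl])
qed

lemma colour_mk_pt: "colour (mk_pt i (m + int n) u v) = (- 1) ^ n * colour (mk_pt i m u v)"
proof (induction n)
  case (Suc n)
  have "mk_pt i (m + int (Suc n)) u v = mk_pt i (m + int n) u v + ax i"
    unfolding mk_pt_add by (simp add: add_ac)
  then show ?case using Suc by simp
qed simp

lemma sum_alternating: "(\<Sum>n<N. (- 1) ^ n) = (if odd N then 1 else 0 :: int)"
  by (induction N) auto

text \<open>Evaluates the pairing of one cube with a full column. The value does not depend on the
  height \<open>a\<close> of the cube, only on the parity of the depth.\<close>

lemma sum_alternating_sgn:
  assumes "a < N"
  shows "(\<Sum>n<N. (- 1) ^ n * sgn (int n - int a)) = (if odd N then 0 else - 1 :: int)"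
  using assms
proof (induction N)
  case (Suc N)
  show ?case
  proof (cases "a < N")
    case True
    then show ?thesis using Suc.IH by auto
  next
    case False
    then have a: "a = N" using Suc.prems by simp
    have "(\<Sum>n<N. (- 1) ^ n * sgn (int n - int a)) = - (\<Sum>n<N. (- 1) ^ n :: int)"
      unfolding sum_negf[symmetric] a by (intro sum.cong) auto
    then show ?thesis by (simp add: a sum_alternating)
  qed
qed simp

text \<open>Along every column the colour times the axial sign sums to 0, so already a single cube
  pairs to 0 with the cylinder. This replaces the comparison with \<open>axial_tiling\<close>, which
  requires even depth.\<close>

lemma pairing_cylinder_odd:
  assumes C: "C = cyl_cells i k D N" and "odd N" "P \<subseteq> C"
  shows "pairing P C = 0"
proof -
  have "pairing {q} C = 0" if q: "q \<in> C" for q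
  proof -
    define a where "a = nat (q $ i - k)"
    have a: "q $ i = k + int a" "a < N"
      using q by (auto simp: a_def C cyl_cells_def)
    have "(\<Sum>n<N. colour q * colour (mk_pt i (k + int n) u v) * sgn3 (mk_pt i (k + int n) u v - q))
        = 0" for u v
    proof -
      have "(\<Sum>n<N. colour q * colour (mk_pt i (k + int n) u v) * sgn3 (mk_pt i (k + int n) u v -
          q)) =
        (\<Sum>n<N. colour q * colour (mk_pt i k u v) * sgn (u - q $ (i + 1)) * sgn (v - q $ (i + 2)) *
          ((- 1) ^ n * sgn (int n - int a)))"
        by (intro sum.cong refl)
          (simp add: colour_mk_pt sgn3_distinct[of i "i + 1" "i + 2"] a(1))
      also have "\<dots> = 0"
        using sum_alternating_sgn[OF a(2)] \<open>odd N\<close> by (simp flip: sum_distrib_left)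
      finally show ?thesis .
    qed
    then show ?thesis
      by (simp add: pairing_def C cyl_cells_sum)
  qed
  then show ?thesis
    using assms(3) by (subst pairing_left_sum) (auto intro: sum.neutral)
qed

lemma axial_tiling:
  assumes C: "C = cyl_cells i k D N" and "even N"
  shows "\<exists>M. lattice_tiling C M \<and> (\<forall>m\<in>M. snd m = i)"
proof -
  define M where "M = (\<lambda>p. (p, i)) ` {p \<in> C. even (p $ i - k)}"
  have up: "p + ax i \<in> C" if "p \<in> C" "even (p $ i - k)" for p
  proof -
    have "p $ i < k + int N" using that(1) by (simp add: C cyl_cells_def)
    moreover have "p $ i + 1 \<noteq> k + int N"
    proof
      assume "p $ i + 1 = k + int N"
      then have "p $ i - k = int N - 1" by simp
      then show False using that(2) \<open>even N\<close> by simp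
    qed
    ultimately show ?thesis
      using that(1) by (simp add: C cyl_cells_def ax_nth)
  qed
  have down: "p - ax i \<in> C" if "p \<in> C" "odd (p $ i - k)" for p
  proof -
    have "p $ i \<noteq> k" using that(2) by auto
    then show ?thesis
      using that(1) by (simp add: C cyl_cells_def ax_nth)
  qed
  have "lattice_tiling C M"
    unfolding lattice_tiling_def
  proof
    have "False" if "p \<in> C" "even (p $ i - k)" "even (q $ i - k)" "p = q + ax i" for p q
      using that by (auto simp: ax_nth)
    then show "disjoint_family_on edge M"
      by (fastforce simp: disjoint_family_on_def M_def edge_def)
    show "\<Union> (edge ` M) = C"
    proof (intro equalityI subsetI)
      fix p assume p: "p \<in> C"
      show "p \<in> \<Union> (edge ` M)"
      proof (cases "even (p $ i - k)")
        case True
        then show ?thesis using p by (force simp: M_def edge_def)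
      next
        case False
        then have "p - ax i \<in> C" "even ((p - ax i) $ i - k)"
          using down[OF p] by (auto simp: ax_nth)
        then have "(p - ax i, i) \<in> M" by (auto simp: M_def)
        moreover have "p \<in> edge (p - ax i, i)" by (simp add: edge_def)
        ultimately show ?thesis by blast
      qed
    next
      fix p assume "p \<in> \<Union> (edge ` M)"
      then show "p \<in> C" using up by (auto simp: M_def edge_def)
    qed
  qed
  moreover have "snd m = i" if "m \<in> M" for m
    using that by (auto simp: M_def)
  ultimately show ?thesis by blast
qed

lemma pairing_square_split:
  assumes "j \<noteq> l"
  shows "pairing P (square c j l) = pairing P (edge (c, j)) + pairing P (edge (c + ax l, j))"
proof -
  have "square c j l = edge (c, j) \<union> edge (c + ax l, j)"
    by (auto simp: square_def edge_def add_ac)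
  moreover have "c \<noteq> c + ax l" "c \<noteq> c + ax l + ax j" "c + ax j \<noteq> c + ax l" "c + ax j \<noteq> c + ax l +
      ax j"
    using assms by (simp_all add: add.assoc add.left_commute[of "ax l"])
  then have "edge (c, j) \<inter> edge (c + ax l, j) = {}"
    by (auto simp: edge_def)
  ultimately show ?thesis
    by (simp add: pairing_Un_right)
qed

text \<open>For even depth the weight \<open>pairing C (edge m)\<close> on the dominoes of direction
  \<open>j\<close> is closed, because squares pair to 0 with \<open>C\<close>. Its total can be
  computed on the axial tiling, whose transverse classes are empty; the axial class then follows
  from \<open>pairing C C = 0\<close>.\<close>

lemma pairing_cylinder_dir_cells:
  assumes D: "planar_exact D" "finite D" and C: "C = cyl_cells i k D N" and M: "lattice_tiling C M"
  shows "pairing C (dir_cells j M) = 0"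
proof (cases "even N")
  case False
  then show ?thesis
    using pairing_cylinder_odd[OF C, of "dir_cells j M"] dir_cells_subset[OF M] pairing_swap[of C
        "dir_cells j M"] by simp
next
  case True
  then obtain V where V: "lattice_tiling C V" "\<And>m. m \<in> V \<Longrightarrow> snd m = i"
    using axial_tiling[OF C] by blast
  have finC: "finite C"
    using finite_cyl_cells[OF D(2)] by (simp add: C)
  have indep: "pairing C (dir_cells j M) = pairing C (dir_cells j V)" for j
  proof -
    define G where "G = (\<lambda>l c. if l = j then pairing C (edge (c, l)) else 0)"
    have G_closed: "G a c + G a (c + ax b) = G b c + G b (c + ax a)" if ab: "a \<noteq> b" "square c a b
        \<subseteq> C" for a b c
    proof -
      have sq: "pairing C (square c a b) = 0" 
        using pairing_square_cylinder[OF D(2) C ab] pairing_swap[of C "square c a b"] by simp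
      show ?thesis
        using pairing_square_split[OF ab(1), of C c] pairing_square_split[OF ab(1)[symmetric], of
            C c] sq
        by (auto simp: G_def square_commute[of c b a])
    qed
    have "pairing C (dir_cells j M) = (\<Sum>m\<in>M. G (snd m) (fst m))" if M: "lattice_tiling C M" for M
    proof -
      have "(\<Sum>m\<in>M. G (snd m) (fst m)) = (\<Sum>m\<in>M. if snd m = j then pairing C (edge m) else 0)"
        by (intro sum.cong) (auto simp: G_def)
      then show ?thesis
        using lattice_tiling_finite[OF M finC] by (simp add: pairing_dir_cells_right[OF M finC]
            sum.If_cases Int_def)
    qed
    then show ?thesis
      using closed_weight_tiling_indep[OF D C G_closed M V(1)] M V(1) by simp
  qed
  have neq: "pairing C (dir_cells l M) = 0" if "l \<noteq> i" for l
  proof -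
    have "dir_cells l V = {}" using V(2) that by (auto simp: dir_cells_def)
    then show ?thesis by (simp add: indep)
  qed
  show ?thesis
  proof (cases "j = i")
    case True
    have "pairing C C = 0" by simp
    then show ?thesis
      using True neq[of "i + 1"] neq[of "i + 2"] pairing_lattice_tiling[OF M finC, of C i] by simp
  qed (rule neq)
qed

lemma twist4_cylinder_eq:
  assumes D: "planar_exact D" "finite D" and C: "C = cyl_cells i k D N" and M: "lattice_tiling C M"
  shows "twist4 j M = twist4 l M"
proof -
  have finC: "finite C"
    using finite_cyl_cells[OF D(2)] by (simp add: C)
  have step: "twist4 (j + 1) M = twist4 (j + 2) M" for j
    using twist4_diff[OF M finC, of j] pairing_cylinder_dir_cells[OF assms, of j] by simp
  have "twist4 l M = twist4 (l + 1) M" "twist4 (l + 1) M = twist4 (l + 2) M" for l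
    using step[of "l + 2"] step[of l] by (simp_all only: rot_3)
  then show ?thesis
    using exhaust_3_rot[of j l] by metis
qed

section \<open>Mixed terms in the twist of a union\<close>

lemma dir_cells_Un: "dir_cells i (M \<union> M') = dir_cells i M \<union> dir_cells i M'"
  by (auto simp: dir_cells_def)

lemma twist4_Un:
  assumes M: "lattice_tiling C M" and M': "lattice_tiling C' M'" and CC': "C \<inter> C' = {}" and fin:
      "finite C" "finite C'"
  shows "twist4 k (M \<union> M') = twist4 k M + twist4 k M' +
    (pairing (dir_cells (k + 1) M) (dir_cells (k + 2) M') - pairing (dir_cells (k + 2) M)
        (dir_cells (k + 1) M'))"
proof -
  have f: "finite (dir_cells i M)" "finite (dir_cells i M')" for i
    using finite_subset[OF dir_cells_subset[OF M] fin(1)] finite_subset[OF dir_cells_subset[OF M']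
        fin(2)] by auto
  have d: "dir_cells i M \<inter> dir_cells i M' = {}" for i
    using dir_cells_subset[OF M, of i] dir_cells_subset[OF M', of i] CC' by blast
  show ?thesis
    using pairing_swap[of "dir_cells (k + 1) M'" "dir_cells (k + 2) M"]
    by (simp add: twist4_def dir_cells_Un pairing_Un_left pairing_Un_right f d)
qed

text \<open>The mixed terms of the twist of a union are closed as a weight on the dominoes of one
  part: this uses the vanishing of \<^term>\<open>pairing (square c j l) C\<close> for the whole region and for that
  part.\<close>

lemma twist4_Un_swap:
  assumes D: "finite D" and C: "C = cyl_cells i k D N"
    and D': "planar_exact D'" "finite D'" and C': "C' = cyl_cells i' k' D' N'"
    and sub: "C' \<subseteq> C" and M: "lattice_tiling (C - C') M" and M1: "lattice_tiling C' M1" and M2: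
        "lattice_tiling C' M2"
  shows "twist4 a (M \<union> M1) - twist4 a M1 = twist4 a (M \<union> M2) - twist4 a M2"
proof -
  have fin: "finite C" "finite C'" "finite (C - C')"
    using finite_cyl_cells D D'(2) by (auto simp: C C')
  have disj: "(C - C') \<inter> C' = {}" by blast
  define X Y Z where "X = dir_cells (a + 1) M" and "Y = dir_cells (a + 2) M" and "Z = dir_cells a M"
  \<comment> \<open>\<open>G\<close> records how a domino of the part pairs with the classes of the
    outer tiling \<open>M\<close>; its total over a tiling of \<open>C'\<close> is the mixed term of
    \<open>twist4_Un\<close>.\<close>
  define G where "G = (\<lambda>l c. if l = a + 2 then pairing X (edge (c, l))
    else if l = a + 1 then - pairing Y (edge (c, l)) else 0)"
  have out: "square c p q \<inter> dir_cells r M = {}" if "square c p q \<subseteq> C'" for c p q r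
    using dir_cells_subset[OF M, of r] that by blast
  have zero: "pairing (dir_cells r M) (square c p q) = 0"
    if "p \<noteq> q" "q \<noteq> r" "p \<noteq> r" "square c p q \<subseteq> C'" for c p q r
    using pairing_square_dir_cells[OF M fin(3) that(1-3) out[OF that(4)]]
      pairing_swap[of "dir_cells r M" "square c p q"] by simp
  \<comment> \<open>These are the only squares that mix the two weighted directions. Such a square
    pairs to 0 with \<open>C\<close> and with \<open>C'\<close>, hence with the outer region, and to
    0 with the class \<open>Z\<close> orthogonal to it, so the other two classes cancel.\<close>
  have YX: "pairing X (square c p q) = - pairing Y (square c p q)"
    if "{p, q} = {a + 1, a + 2}" "square c p q \<subseteq> C'" for c p q
  proof -
    have pq: "p \<noteq> q" "q \<noteq> a" "p \<noteq> a"
      using that(1) by (auto simp: doubleton_eq_iff)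
    have "pairing (square c p q) (C - C') = 0"
      using pairing_square_cylinder[OF D C pq(1)] pairing_square_cylinder[OF D'(2) C' pq(1)
          that(2)] that(2) sub
      by (subst pairing_Diff_right[OF fin(1) sub]) auto
    then have "pairing (square c p q) Z + pairing (square c p q) X + pairing (square c p q) Y = 0"
      using pairing_lattice_tiling[OF M fin(3), of "square c p q" a] by (simp add: X_def Y_def
          Z_def)
    then show ?thesis
      using zero[OF pq that(2)] pairing_swap[of X "square c p q"] pairing_swap[of Y "square c p q"]
        pairing_swap[of Z "square c p q"] by (simp add: Z_def)
  qed
  have split: "pairing P (edge (c, p)) + pairing P (edge (c + ax q, p)) = pairing P (square c p q)"
    "pairing P (edge (c, q)) + pairing P (edge (c + ax p, q)) = pairing P (square c p q)" if "p \<noteq>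
        q" for P c p q
    using pairing_square_split[OF that, of P c] pairing_square_split[OF that[symmetric], of P c]
    by (simp_all add: square_commute[of c q p])
  have G_closed: "G p c + G p (c + ax q) = G q c + G q (c + ax p)"
    if pq: "p \<noteq> q" "square c p q \<subseteq> C'" for p q c
  proof -
    have G_sum: "G p c + G p (c + ax q) = (if p = a + 2 then pairing X (square c p q)
      else if p = a + 1 then - pairing Y (square c p q) else 0)"
     "G q c + G q (c + ax p) = (if q = a + 2 then pairing X (square c p q)
      else if q = a + 1 then - pairing Y (square c p q) else 0)"
      using split[OF pq(1), of X c] split[OF pq(1), of Y c] by (auto simp: G_def)
    have X0: "pairing X (square c p q) = 0" if "p \<noteq> a + 1" "q \<noteq> a + 1"
      using zero[of p q "a + 1" c] that pq by (simp add: X_def)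
    have Y0: "pairing Y (square c p q) = 0" if "p \<noteq> a + 2" "q \<noteq> a + 2"
      using zero[of p q "a + 2" c] that pq by (simp add: Y_def)
    have XY: "pairing X (square c p q) = - pairing Y (square c p q)"
      if "p = a + 1 \<and> q = a + 2 \<or> p = a + 2 \<and> q = a + 1"
      using YX[of p q c] that pq(2) by auto
    show ?thesis
      unfolding G_sum using X0 Y0 XY pq(1) exhaust_3_rot[of p a] exhaust_3_rot[of q a] by auto
  qed
  have "twist4 a (M \<union> M1) - twist4 a M1 = twist4 a M + (\<Sum>m\<in>M1. G (snd m) (fst m))" if M1:
      "lattice_tiling C' M1" for M1
  proof -
    have "(\<Sum>m\<in>M1. G (snd m) (fst m)) = (\<Sum>m\<in>M1. if snd m = a + 2 then pairing X (edge m) else 0)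
       + (\<Sum>m\<in>M1. if snd m = a + 1 then - pairing Y (edge m) else 0)"
      unfolding sum.distrib[symmetric] by (intro sum.cong) (auto simp: G_def)
    also have "\<dots> = pairing X (dir_cells (a + 2) M1) - pairing Y (dir_cells (a + 1) M1)"
      using lattice_tiling_finite[OF M1 fin(2)]
      by (simp add: pairing_dir_cells_right[OF M1 fin(2)] sum.If_cases Int_def sum_negf)
    finally show ?thesis
      using twist4_Un[OF M M1 disj fin(3,2), of a] by (simp add: X_def Y_def)
  qed
  then show ?thesis
    using closed_weight_tiling_indep[OF D' C' G_closed M1 M2] M1 M2 by simp
qed

section \<open>Lattice walks and winding numbers\<close>

definition adj2 :: "int \<times> int \<Rightarrow> int \<times> int \<Rightarrow> bool" where
  "adj2 a b \<longleftrightarrow> (fst a = fst b \<and> \<bar>snd a - snd b\<bar> = 1) \<or> (snd a = snd b \<and> \<bar>fst a - fst b\<bar> = 1)"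

fun path_sum :: "('a \<Rightarrow> 'a \<Rightarrow> 'b :: comm_monoid_add) \<Rightarrow> 'a list \<Rightarrow> 'b" where
  "path_sum w (a # b # ys) = w a b + path_sum w (b # ys)"
| "path_sum w ys = 0"

text \<open>These are the jumps of the principal branch of the logarithm about \<open>p\<close>, whose cut is the
  ray from \<open>p\<close> to the left; on the cut the argument is \<open>\<pi>\<close>, so the jumps occur just below it.\<close>

definition jump :: "int \<times> int \<Rightarrow> int \<times> int \<Rightarrow> int \<times> int \<Rightarrow> int" where
  "jump p a b = (if fst a < fst p \<and> fst b < fst p
     then of_bool (snd b < snd p) - of_bool (snd a < snd p) else 0)"

lemma jewel_center_simps [simp]:
  "Re (jewel_center a) = of_int (fst a) + 1 / 2" "Im (jewel_center a) = of_int (snd a) + 1 / 2"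
  by (simp_all add: jewel_center_def)

lemma jewel_center_eq_iff [simp]: "jewel_center a = jewel_center b \<longleftrightarrow> a = b"
  by (simp add: jewel_center_def prod_eq_iff)

lemma Ln_shift:
  assumes "Re z < 0"
  shows "Ln (- z) = Ln z + \<i> * pi * (if Im z < 0 then 1 else - 1)"
proof -
  have "z \<noteq> 0" using assms by auto
  then show ?thesis
    using assms Ln_minus[of z] by (cases "Im z < 0") auto
qed

text \<open>A unit step that misses \<open>p\<close> either stays strictly left of \<open>p\<close>,
  where \<open>Ln (P - w)\<close> is a primitive and \<open>Ln_shift\<close> relates it to the
  principal branch, or it avoids the cut, where \<open>Ln (w - P)\<close> is a primitive and the
  jump is 0.\<close>

lemma edge_integral:
  assumes ab: "adj2 a b" and p: "p \<noteq> a" "p \<noteq> b"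
  shows "((\<lambda>w. 1 / (w - jewel_center p)) has_contour_integral
      (Ln (jewel_center b - jewel_center p) - Ln (jewel_center a - jewel_center p)
        + 2 * pi * \<i> * of_int (jump p a b))) (linepath (jewel_center a) (jewel_center b))"
    and "jewel_center p \<notin> closed_segment (jewel_center a) (jewel_center b)"
proof -
  define P where "P = jewel_center p"
  let ?A = "jewel_center a" and ?B = "jewel_center b"
  let ?g = "linepath ?A ?B"
  have "((\<lambda>w. 1 / (w - P)) has_contour_integral
      (Ln (?B - P) - Ln (?A - P) + 2 * pi * \<i> * of_int (jump p a b))) ?g \<and> P \<notin> closed_segment ?A ?B"
  proof (cases "fst a < fst p \<and> fst b < fst p")
    case True
    define S where "S = {w. Re w < Re P}"
    have S: "closed_segment ?A ?B \<subseteq> S"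
      using True by (intro closed_segment_subset) (auto simp: S_def P_def convex_halfspace_Re_lt)
    have "((\<lambda>w. Ln (P - w)) has_field_derivative 1 / (w - P)) (at w within S)" if "w \<in> S" for w
    proof -
      have "P - w \<notin> \<real>\<^sub>\<le>\<^sub>0" "w \<noteq> P"
        using that by (auto simp: S_def complex_nonpos_Reals_iff)
      then show ?thesis
        by (auto intro!: derivative_eq_intros simp: field_simps)
    qed
    from contour_integral_primitive[OF this, of ?g]
    have "((\<lambda>w. 1 / (w - P)) has_contour_integral (Ln (P - ?B) - Ln (P - ?A))) ?g"
      using S by simp
    moreover have "Ln (P - ?B) - Ln (P - ?A) = Ln (?B - P) - Ln (?A - P) + 2 * pi * \<i> * of_int
        (jump p a b)"
      using Ln_shift[of "?B - P"] Ln_shift[of "?A - P"] True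
      by (auto simp: P_def jump_def algebra_simps)
    moreover have "P \<notin> S" by (simp add: S_def)
    ultimately show ?thesis using S by auto
  next
    case False
    define S where "S = {w. w - P \<notin> \<real>\<^sub>\<le>\<^sub>0}"
    have sides: "(snd a > snd p \<and> snd b > snd p) \<or> (snd a < snd p \<and> snd b < snd p)
        \<or> (fst a > fst p \<and> fst b > fst p)"
      using ab p False by (cases a; cases b; cases p) (auto simp: adj2_def)
    have S: "closed_segment ?A ?B \<subseteq> S"
      using sides
    proof (elim disjE)
      assume "snd a > snd p \<and> snd b > snd p"
      then have "closed_segment ?A ?B \<subseteq> {w. Im w > Im P}"
        by (intro closed_segment_subset) (auto simp: P_def convex_halfspace_Im_gt)
      also have "\<dots> \<subseteq> S" by (auto simp: S_def complex_nonpos_Reals_iff)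
      finally show ?thesis .
    next
      assume "snd a < snd p \<and> snd b < snd p"
      then have "closed_segment ?A ?B \<subseteq> {w. Im w < Im P}"
        by (intro closed_segment_subset) (auto simp: P_def convex_halfspace_Im_lt)
      also have "\<dots> \<subseteq> S" by (auto simp: S_def complex_nonpos_Reals_iff)
      finally show ?thesis .
    next
      assume "fst a > fst p \<and> fst b > fst p"
      then have "closed_segment ?A ?B \<subseteq> {w. Re w > Re P}"
        by (intro closed_segment_subset) (auto simp: P_def convex_halfspace_Re_gt)
      also have "\<dots> \<subseteq> S" by (auto simp: S_def complex_nonpos_Reals_iff)
      finally show ?thesis .
    qed
    have "((\<lambda>w. Ln (w - P)) has_field_derivative 1 / (w - P)) (at w within S)" if "w \<in> S" for w
    proof -
      have "w - P \<notin> \<real>\<^sub>\<le>\<^sub>0" "w \<noteq> P"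
        using that by (auto simp: S_def)
      then show ?thesis
        by (auto intro!: derivative_eq_intros simp: field_simps)
    qed
    from contour_integral_primitive[OF this, of ?g]
    have "((\<lambda>w. 1 / (w - P)) has_contour_integral (Ln (?B - P) - Ln (?A - P))) ?g"
      using S by simp
    moreover have "jump p a b = 0" using False by (auto simp: jump_def)
    moreover have "P \<notin> S" by (simp add: S_def)
    ultimately show ?thesis using S by auto
  qed
  then show "((\<lambda>w. 1 / (w - jewel_center p)) has_contour_integral
      (Ln (jewel_center b - jewel_center p) - Ln (jewel_center a - jewel_center p)
        + 2 * pi * \<i> * of_int (jump p a b))) (linepath (jewel_center a) (jewel_center b))"
    "jewel_center p \<notin> closed_segment (jewel_center a) (jewel_center b)"
    by (simp_all add: P_def)
qed

text \<open>Point reflection in \<open>p\<close> carries the left cut to the right one. The same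
  contour integral is thereby also counted by jumps to the right of \<open>p\<close>, which is the
  second count that \<open>closed_walk_up_steps\<close> needs.\<close>

definition reflect :: "int \<times> int \<Rightarrow> int \<times> int \<Rightarrow> int \<times> int" where
  "reflect p a = (2 * fst p - fst a, 2 * snd p - snd a)"

lemma jewel_center_reflect: "jewel_center (reflect p a) = 2 * jewel_center p - jewel_center a"
  by (simp add: reflect_def jewel_center_def complex_eq_iff)

text \<open>The form \<open>dw / (w - P)\<close> is invariant under
  \<open>w \<mapsto> 2 * P - w\<close>, so the integral over a step equals the one over its mirror
  image.\<close>

lemma edge_integral_reflect:
  assumes "adj2 a b" "p \<noteq> a" "p \<noteq> b"
  shows "((\<lambda>w. 1 / (w - jewel_center p)) has_contour_integral
      (Ln (jewel_center p - jewel_center b) - Ln (jewel_center p - jewel_center a)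
        + 2 * pi * \<i> * of_int (jump p (reflect p a) (reflect p b)))) (linepath (jewel_center a)
            (jewel_center b))"
proof -
  define P A B where "P = jewel_center p" and "A = jewel_center a" and "B = jewel_center b"
  have "adj2 (reflect p a) (reflect p b)" "p \<noteq> reflect p a" "p \<noteq> reflect p b"
    using assms by (auto simp: adj2_def reflect_def prod_eq_iff)
  from edge_integral(1)[OF this]
  have "((\<lambda>w. 1 / (w - P)) has_contour_integral
      (Ln (P - B) - Ln (P - A) + 2 * pi * \<i> * of_int (jump p (reflect p a) (reflect p b))))
      (linepath (2 * P - A) (2 * P - B))"
    by (simp add: jewel_center_reflect P_def A_def B_def)
  moreover have "1 / (linepath (2 * P - A) (2 * P - B) x - P) * (2 * P - B - (2 * P - A))
      = 1 / (linepath A B x - P) * (B - A)" for x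
  proof -
    have shift: "linepath (2 * P - A) (2 * P - B) x - P = - (linepath A B x - P)"
      by (simp add: linepath_def scaleR_conv_of_real algebra_simps)
    have diff: "2 * P - B - (2 * P - A) = - (B - A)" by simp
    have "1 / (- u) * (- d) = 1 / u * d" for u d :: complex by simp
    then show ?thesis unfolding shift diff .
  qed
  ultimately show ?thesis
    by (simp add: has_contour_integral_linepath flip: P_def A_def B_def)
qed

lemma polyline_Cons:
  "zs \<noteq> [] \<Longrightarrow> polyline (x # y # zs) = linepath x y +++ polyline (y # zs)"
  by (cases zs) auto

lemma polyline_walk:
  assumes "ys \<noteq> []"
  shows "valid_path (polyline ys) \<and> pathstart (polyline ys) = hd ys \<and> pathfinish (polyline ys) =
      last ys"
  using assms
proof (induction ys rule: polyline.induct)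
  case (4 x y z zs)
  then show ?case by (auto intro!: valid_path_join)
qed auto

lemma polyline_image:
  assumes "ys \<noteq> []" "successively R ys" "\<And>a. a \<in> set ys \<Longrightarrow> f a \<in> S"
    and "\<And>a b. a \<in> set ys \<Longrightarrow> b \<in> set ys \<Longrightarrow> R a b \<Longrightarrow> closed_segment (f a) (f b) \<subseteq> S"
  shows "path_image (polyline (map f ys)) \<subseteq> S"
  using assms
proof (induction ys rule: induct_list012)
  case (3 a b ys)
  show ?case
  proof (cases "ys = []")
    case False
    then have "polyline (map f (a # b # ys)) = linepath (f a) (f b) +++ polyline (map f (b # ys))"
      by (simp add: polyline_Cons)
    moreover have "path_image (polyline (map f (b # ys))) \<subseteq> S"
      using 3 by simp
    moreover have "closed_segment (f a) (f b) \<subseteq> S"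
      using 3(4,6) by simp
    moreover have "pathstart (polyline (map f (b # ys))) = f b"
      using polyline_walk[of "map f (b # ys)"] by simp
    ultimately show ?thesis
      by (simp add: path_image_join)
  qed (use 3(4,6) in simp)
qed auto

text \<open>The values of \<open>L\<close> telescope and the jumps add up. Primitive and jumps are
  left arbitrary in order to cover both the principal branch and the reflected one.\<close>

lemma polyline_integral:
  assumes edges: "\<And>a b. adj2 a b \<Longrightarrow> p \<noteq> a \<Longrightarrow> p \<noteq> b \<Longrightarrow>
      (g has_contour_integral (L b - L a + c * of_int (J a b))) (linepath (f a) (f b))"
    and "ys \<noteq> []" "successively adj2 ys" "p \<notin> set ys"
  shows "(g has_contour_integral (L (last ys) - L (hd ys) + c * of_int (path_sum J ys)))
    (polyline (map f ys))"
  using assms(2-4)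
proof (induction ys rule: induct_list012)
  case (3 a b ys)
  have ab: "(g has_contour_integral (L b - L a + c * of_int (J a b))) (linepath (f a) (f b))"
    using 3(4,5) by (intro edges) auto
  show ?case
  proof (cases "ys = []")
    case False
    then have "polyline (map f (a # b # ys)) = linepath (f a) (f b) +++ polyline (map f (b # ys))"
      by (simp add: polyline_Cons)
    moreover have "valid_path (polyline (map f (b # ys)))"
      using polyline_walk[of "map f (b # ys)"] by simp
    moreover have "(g has_contour_integral (L (last (b # ys)) - L b + c * of_int (path_sum J (b #
        ys))))
        (polyline (map f (b # ys)))"
      using 3 by simp
    moreover have "L (last (a # b # ys)) - L a + c * of_int (path_sum J (a # b # ys)) =
        (L b - L a + c * of_int (J a b)) + (L (last (b # ys)) - L b + c * of_int (path_sum J (b #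
            ys)))"
      by (simp add: algebra_simps)
    ultimately show ?thesis
      using has_contour_integral_join[OF ab] by (simp only: list.sel(1) valid_path_linepath)
  qed (use ab in simp)
qed (auto simp: has_contour_integral_trivial)

lemma closed_walk_winding:
  assumes ys: "ys \<noteq> []" "successively adj2 ys" "hd ys = last ys" and p: "p \<notin> set ys"
  shows "winding_number (polyline (map jewel_center ys)) (jewel_center p) = of_int (path_sum (jump
      p) ys)"
    and "path_sum (\<lambda>a b. jump p (reflect p a) (reflect p b)) ys = path_sum (jump p) ys"
proof -
  let ?g = "polyline (map jewel_center ys)"
  have "path_image ?g \<subseteq> - {jewel_center p}"
  proof (rule polyline_image[OF ys(1,2)])
    fix a assume "a \<in> set ys"
    then show "jewel_center a \<in> - {jewel_center p}"
      using p by auto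
  next
    fix a b assume "a \<in> set ys" "b \<in> set ys" "adj2 a b"
    then show "closed_segment (jewel_center a) (jewel_center b) \<subseteq> - {jewel_center p}"
      using edge_integral(2)[of a b p] p by auto
  qed
  then have "winding_number ?g (jewel_center p) =
      1 / (2 * pi * \<i>) * contour_integral ?g (\<lambda>w. 1 / (w - jewel_center p))"
    using polyline_walk[of "map jewel_center ys"] ys(1) by (intro winding_number_valid_path) auto
  moreover have "contour_integral ?g (\<lambda>w. 1 / (w - jewel_center p)) = 2 * pi * \<i> * of_int
      (path_sum (jump p) ys)"
    using contour_integral_unique[OF polyline_integral[OF edge_integral(1) ys(1,2) p]] ys(3) by simp
  moreover have "contour_integral ?g (\<lambda>w. 1 / (w - jewel_center p)) =
      2 * pi * \<i> * of_int (path_sum (\<lambda>a b. jump p (reflect p a) (reflect p b)) ys)"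
    using contour_integral_unique[OF polyline_integral[OF edge_integral_reflect ys(1,2) p]] ys(3)
        by simp
  ultimately show "winding_number ?g (jewel_center p) = of_int (path_sum (jump p) ys)"
    "path_sum (\<lambda>a b. jump p (reflect p a) (reflect p b)) ys = path_sum (jump p) ys"
    by simp_all
qed

text \<open>For a unit step this is the signed crossing of the line between heights \<open>c\<close>
  and \<open>c + 1\<close>, restricted to the columns in \<open>R\<close>; horizontal steps count 0
  in any case.\<close>

definition up_step :: "int \<Rightarrow> (int \<Rightarrow> bool) \<Rightarrow> int \<times> int \<Rightarrow> int \<times> int \<Rightarrow> int" where
  "up_step c R a b = (if R (fst a) \<and> R (fst b)
     then of_bool (snd b > c) - of_bool (snd a > c) else 0)"

lemma path_sum_cong:
  assumes "successively Q ys" "\<And>a b. a \<in> set ys \<Longrightarrow> b \<in> set ys \<Longrightarrow> Q a b \<Longrightarrow> v a b = w a b"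
  shows "path_sum v ys = path_sum w ys"
  using assms by (induction ys rule: induct_list012) auto

lemma path_sum_add: "path_sum (\<lambda>a b. v a b + w a b) ys = path_sum v ys + path_sum w ys"
  by (induction ys rule: induct_list012) (auto simp: algebra_simps)

lemma path_sum_uminus:
  fixes v :: "'a \<Rightarrow> 'a \<Rightarrow> 'b :: ab_group_add"
  shows "path_sum (\<lambda>a b. - v a b) ys = - path_sum v ys"
  by (induction ys rule: induct_list012) auto

lemma path_sum_diff:
  fixes f :: "'a \<Rightarrow> 'b :: ab_group_add"
  shows "ys \<noteq> [] \<Longrightarrow> path_sum (\<lambda>a b. f b - f a) ys = f (last ys) - f (hd ys)"
  by (induction ys rule: induct_list012) auto

lemma up_step_total:
  assumes "ys \<noteq> []" "hd ys = last ys"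
  shows "path_sum (up_step c (\<lambda>_. True)) ys = 0"
proof -
  have "up_step c (\<lambda>_. True) = (\<lambda>a b. of_bool (snd b > c) - of_bool (snd a > c))"
    by (simp add: fun_eq_iff up_step_def)
  then show ?thesis
    using path_sum_diff[OF assms(1), of "\<lambda>a. of_bool (snd a > c) :: int"] assms(2) by simp
qed

text \<open>The jumps of the two branches give the lower left and the upper right half-row. A closed
  walk crosses a row 0 times in total, and a crossing next to \<open>p\<close> in the column of
  \<open>p\<close> would visit \<open>p\<close>. So left and right counts are opposite, which yields
  the other two half-rows.\<close>

lemma closed_walk_up_steps:
  assumes ys: "ys \<noteq> []" "successively adj2 ys" "hd ys = last ys" and p: "p \<notin> set ys"
    and W: "winding_number (polyline (map jewel_center ys)) (jewel_center p) = of_int W"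
  shows "path_sum (up_step (snd p) (\<lambda>x. x > fst p)) ys = W"
    and "path_sum (up_step (snd p) (\<lambda>x. x < fst p)) ys = - W"
    and "path_sum (up_step (snd p - 1) (\<lambda>x. x > fst p)) ys = W"
    and "path_sum (up_step (snd p - 1) (\<lambda>x. x < fst p)) ys = - W"
proof -
  have W1: "path_sum (jump p) ys = W" and W2: "path_sum (\<lambda>a b. jump p (reflect p a) (reflect p b))
      ys = W"
    using closed_walk_winding[OF ys p] W by auto
  have total: "path_sum (up_step c (\<lambda>x. x > fst p)) ys + path_sum (up_step c (\<lambda>x. x < fst p)) ys =
      0"
    if c: "c = snd p \<or> c = snd p - 1" for c
  proof -
    have "path_sum (\<lambda>a b. up_step c (\<lambda>x. x > fst p) a b + up_step c (\<lambda>x. x < fst p) a b) ys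
      = path_sum (up_step c (\<lambda>_. True)) ys"
    proof (rule path_sum_cong[OF ys(2)])
      fix a b assume "a \<in> set ys" "b \<in> set ys" "adj2 a b"
      then have "a \<noteq> p" "b \<noteq> p" "adj2 a b" using p by auto
      then show "up_step c (\<lambda>x. x > fst p) a b + up_step c (\<lambda>x. x < fst p) a b = up_step c (\<lambda>_.
          True) a b"
        using c by (cases a; cases b; cases p) (auto simp: up_step_def adj2_def of_bool_def split:
            if_splits)
    qed
    then show ?thesis
      using up_step_total[OF ys(1,3), of c] by (simp add: path_sum_add)
  qed
  have "path_sum (up_step (snd p - 1) (\<lambda>x. x < fst p)) ys = path_sum (\<lambda>a b. - jump p a b) ys"
    by (rule path_sum_cong[OF ys(2)]) (auto simp: up_step_def jump_def of_bool_def)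
  moreover have "path_sum (up_step (snd p) (\<lambda>x. x > fst p)) ys = path_sum (\<lambda>a b. jump p (reflect p
      a) (reflect p b)) ys"
    by (rule path_sum_cong[OF ys(2)]) (auto simp: up_step_def jump_def reflect_def of_bool_def)
  ultimately show "path_sum (up_step (snd p) (\<lambda>x. x > fst p)) ys = W"
    "path_sum (up_step (snd p) (\<lambda>x. x < fst p)) ys = - W"
    "path_sum (up_step (snd p - 1) (\<lambda>x. x > fst p)) ys = W"
    "path_sum (up_step (snd p - 1) (\<lambda>x. x < fst p)) ys = - W"
    using total[of "snd p"] total[of "snd p - 1"] W1 W2 by (auto simp: path_sum_uminus)
qed

lemma path_sum_append:
  "xs \<noteq> [] \<Longrightarrow> ys \<noteq> [] \<Longrightarrow> path_sum w (xs @ ys) = path_sum w xs + w (last xs) (hd ys) + path_sum w ys"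
  for w :: "'a \<Rightarrow> 'a \<Rightarrow> 'b :: ab_group_add"
proof (induction xs rule: induct_list012)
  case (2 x)
  then show ?case by (cases ys) auto
qed (auto simp: algebra_simps)

lemma path_sum_rev:
  fixes w :: "'a \<Rightarrow> 'a \<Rightarrow> 'b :: ab_group_add"
  assumes "\<And>a b. w b a = - w a b"
  shows "path_sum w (rev ys) = - path_sum w ys"
proof (induction ys rule: induct_list012)
  case (3 x y zs)
  have "path_sum w (rev (x # y # zs)) = path_sum w (rev (y # zs)) + w y x"
    using path_sum_append[of "rev (y # zs)" "[x]" w] by simp
  then show ?case using 3 assms[of x y] by simp
qed auto

lemma path_sum_sum:
  "path_sum (\<lambda>a b. \<Sum>i\<in>I. w i a b) ys = (\<Sum>i\<in>I. path_sum (w i) ys)"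
  by (induction ys rule: induct_list012) (auto simp: sum.distrib)

lemma path_sum_scale:
  fixes w :: "'a \<Rightarrow> 'a \<Rightarrow> 'b :: comm_ring"
  shows "path_sum (\<lambda>a b. c * w a b) ys = c * path_sum w ys"
  by (induction ys rule: induct_list012) (auto simp: algebra_simps)

section \<open>From vanishing winding numbers to exactness\<close>

definition winds_around_none :: "(int \<times> int) set \<Rightarrow> bool" where
  "winds_around_none D \<longleftrightarrow> (\<forall>ys p. ys \<noteq> [] \<longrightarrow> successively adj2 ys \<longrightarrow> hd ys = last ys \<longrightarrow>
     set ys \<subseteq> D \<longrightarrow> p \<notin> D \<longrightarrow>
     winding_number (polyline (map jewel_center ys)) (jewel_center p) = 0)"

text \<open>The half-row right of column \<open>x\<close> between heights \<open>y\<close> and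
  \<open>y + 1\<close> is adjacent to all four squares of the block: to the left ones directly, to
  the right ones as the complement of a left half-row. One missing square, about which the walk does
  not wind, makes the count vanish.\<close>

lemma closed_walk_up_steps_eq_0:
  assumes D: "winds_around_none D"
    and ys: "ys \<noteq> []" "successively adj2 ys" "hd ys = last ys" "set ys \<subseteq> D"
    and miss: "(x, y) \<notin> D \<or> (x + 1, y) \<notin> D \<or> (x, y + 1) \<notin> D \<or> (x + 1, y + 1) \<notin> D"
  shows "path_sum (up_step y (\<lambda>x'. x' > x)) ys = 0"
proof -
  have zero: "path_sum (up_step (snd p) (\<lambda>x. x > fst p)) ys = 0"
    "path_sum (up_step (snd p) (\<lambda>x. x < fst p)) ys = 0"
    "path_sum (up_step (snd p - 1) (\<lambda>x. x > fst p)) ys = 0"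
    "path_sum (up_step (snd p - 1) (\<lambda>x. x < fst p)) ys = 0" if "p \<notin> D" for p
    using closed_walk_up_steps[OF ys(1-3), of p 0] D ys that unfolding winds_around_none_def by auto
  have "path_sum (\<lambda>a b. up_step y (\<lambda>x'. x' > x) a b + up_step y (\<lambda>x'. x' < x + 1) a b) ys
      = path_sum (up_step y (\<lambda>_. True)) ys"
    by (rule path_sum_cong[OF ys(2)]) (auto simp: up_step_def adj2_def)
  then have "path_sum (up_step y (\<lambda>x'. x' > x)) ys = - path_sum (up_step y (\<lambda>x'. x' < x + 1)) ys"
    using up_step_total[OF ys(1,3), of y] by (simp add: path_sum_add)
  then show ?thesis
    using miss zero[of "(x, y)"] zero[of "(x + 1, y)"] zero[of "(x, y + 1)"] zero[of "(x + 1, y +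
        1)"]
    by auto
qed

definition walk_weight :: "(int \<Rightarrow> int \<Rightarrow> int) \<Rightarrow> (int \<Rightarrow> int \<Rightarrow> int) \<Rightarrow> int \<times> int \<Rightarrow> int \<times> int \<Rightarrow> int"
    where
  "walk_weight h v a b =
     (if b = (fst a + 1, snd a) then h (fst a) (snd a)
      else if a = (fst b + 1, snd b) then - h (fst b) (snd b)
      else if b = (fst a, snd a + 1) then v (fst a) (snd a)
      else if a = (fst b, snd b + 1) then - v (fst b) (snd b) else 0)"

lemma walk_weight_swap: "walk_weight h v b a = - walk_weight h v a b"
  by (cases a; cases b) (auto simp: walk_weight_def)

text \<open>A discrete Green theorem: subtracting the gradient of the primitive \<open>\<phi>\<close> of the horizontal
  weights leaves vertical weights that are row sums of the curl \<open>K\<close>, so the sum over a closed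
  walk is the sum of the curls weighted by winding numbers.\<close>

lemma closed_walk_weight:
  assumes D: "winds_around_none D" "finite D"
    and closed: "\<And>x y. (x, y) \<in> D \<Longrightarrow> (x + 1, y) \<in> D \<Longrightarrow> (x, y + 1) \<in> D \<Longrightarrow> (x + 1, y + 1) \<in> D \<Longrightarrow>
        h x y + v (x + 1) y = v x y + h x (y + 1)"
    and ys: "ys \<noteq> []" "successively adj2 ys" "hd ys = last ys" "set ys \<subseteq> D"
  shows "path_sum (walk_weight h v) ys = 0"
proof -
  \<comment> \<open>Extended by 0 outside \<open>D\<close>, the weights lose closedness only on
    blocks not contained in \<open>D\<close>, and there \<open>closed_walk_up_steps_eq_0\<close>
    makes the crossing number 0.\<close>
  define h0 where "h0 = (\<lambda>x y. if (x, y) \<in> D \<and> (x + 1, y) \<in> D then h x y else 0)"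
  define v0 where "v0 = (\<lambda>x y. if (x, y) \<in> D \<and> (x, y + 1) \<in> D then v x y else 0)"
  \<comment> \<open>The bounds are strict so that the weights vanish on the border column
    \<open>m\<close>, where the row sums start.\<close>
  obtain m where m: "\<And>x y. (x, y) \<in> D \<Longrightarrow> m < x \<and> x < - m \<and> m < y \<and> y < - m"
  proof -
    have "finite ((\<lambda>d. max \<bar>fst d\<bar> \<bar>snd d\<bar>) ` D)" using D(2) by simp
    from bdd_above_finite[OF this] obtain B where B: "\<And>d. d \<in> D \<Longrightarrow> max \<bar>fst d\<bar> \<bar>snd d\<bar> \<le> B"
      unfolding bdd_above_def by auto
    have "- B - 1 < x \<and> x < - (- B - 1) \<and> - B - 1 < y \<and> y < - (- B - 1)" if "(x, y) \<in> D" for x y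
      using B[OF that] by auto
    then show ?thesis by (rule that)
  qed
  define \<phi> where "\<phi> = (\<lambda>x y. \<Sum>x'\<in>{m..<x}. h0 x' y)"
  define M where "M = (\<lambda>x y. v0 x y - \<phi> x (y + 1) + \<phi> x y)"
  define K where "K = (\<lambda>x y. v0 (x + 1) y - v0 x y - h0 x (y + 1) + h0 x y)"
  have ivl: "{m..<x + 1} = insert x {m..<x}" if "m \<le> x" for x
    using that by auto
  have phi_step: "\<phi> (x + 1) y = \<phi> x y + h0 x y" if "m \<le> x" for x y
    using ivl[OF that] by (simp add: \<phi>_def)
  have M_sum: "M x y = (\<Sum>x'\<in>{m..<x}. K x' y)" if "m \<le> x" for x y
    using that
  proof (induction x rule: int_ge_induct)
    case base
    have "v0 m y = 0" using m by (force simp: v0_def)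
    then show ?case by (simp add: M_def \<phi>_def)
  next
    case (step x)
    then show ?case
      using ivl[OF step.hyps] phi_step[OF step.hyps] by (simp add: M_def K_def)
  qed
  have M_box: "M x y = (\<Sum>x'\<in>{m..<- m}. K x' y * of_bool (x' < x))" if "m < x" "x < - m" for x y
  proof -
    have "{m..<x} = {x' \<in> {m..<- m}. x' < x}" using that by auto
    then show ?thesis
      using that by (simp add: M_sum sum.If_cases Int_def flip: sum.inter_filter)
  qed
  \<comment> \<open>The part of the weight that remains when the gradient of \<open>\<phi>\<close>
    is removed, written as a combination of crossing counts with the curls as coefficients.\<close>
  define \<mu> where "\<mu> = (\<lambda>a b. \<Sum>y\<in>{m..<- m}. \<Sum>x\<in>{m..<- m}. K x y * up_step y (\<lambda>x'. x' > x) a b)"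
  have mu_up: "\<mu> (x, y) (x, y + 1) = M x y" "\<mu> (x, y + 1) (x, y) = - M x y"
    if "(x, y) \<in> D" for x y
  proof -
    have y: "y \<in> {m..<- m}" using m[OF that] by auto
    have "(\<Sum>x'\<in>{m..<- m}. K x' y' * up_step y' (\<lambda>x''. x'' > x') (x, y) (x, y + 1)) = (if y' = y
        then M x y else 0)"
      "(\<Sum>x'\<in>{m..<- m}. K x' y' * up_step y' (\<lambda>x''. x'' > x') (x, y + 1) (x, y)) = (if y' = y then
          - M x y else 0)" for y'
    proof -
      have "up_step y' (\<lambda>x''. x'' > x') (x, y) (x, y + 1) = (if y' = y then of_bool (x' < x) else
          0)"
        "up_step y' (\<lambda>x''. x'' > x') (x, y + 1) (x, y) = (if y' = y then - of_bool (x' < x) else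
            0)" for x'
        by (auto simp: up_step_def)
      then show "(\<Sum>x'\<in>{m..<- m}. K x' y' * up_step y' (\<lambda>x''. x'' > x') (x, y) (x, y + 1)) = (if y'
          = y then M x y else 0)"
        "(\<Sum>x'\<in>{m..<- m}. K x' y' * up_step y' (\<lambda>x''. x'' > x') (x, y + 1) (x, y)) = (if y' = y
            then - M x y else 0)"
        using M_box[of x y] m[OF that] by (cases "y' = y", simp_all add: sum_negf del:
            sum_of_bool_mult_eq sum_mult_of_bool_eq)
    qed
    then show "\<mu> (x, y) (x, y + 1) = M x y" "\<mu> (x, y + 1) (x, y) = - M x y"
      using y by (simp_all add: \<mu>_def)
  qed
  have mu_horizontal: "\<mu> a b = 0" if "snd a = snd b" for a b
    using that by (auto simp: \<mu>_def up_step_def intro!: sum.neutral)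
  have "path_sum (walk_weight h v) ys =
      path_sum (\<lambda>a b. (\<phi> (fst b) (snd b) - \<phi> (fst a) (snd a)) + \<mu> a b) ys"
  proof (rule path_sum_cong[OF ys(2)])
    fix a b assume "a \<in> set ys" "b \<in> set ys" and ab: "adj2 a b"
    then have "a \<in> D" "b \<in> D" using ys(4) by auto
    then have D_ab: "(fst a, snd a) \<in> D" "(fst b, snd b) \<in> D" by simp_all
    have m_ab: "m < fst a" "m < fst b" using m[OF D_ab(1)] m[OF D_ab(2)] by auto
    consider (right) "b = (fst a + 1, snd a)" | (left) "a = (fst b + 1, snd b)"
      | (up) "b = (fst a, snd a + 1)" | (down) "a = (fst b, snd b + 1)"
      using ab unfolding adj2_def prod_eq_iff by force
    then show "walk_weight h v a b = (\<phi> (fst b) (snd b) - \<phi> (fst a) (snd a)) + \<mu> a b"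
    proof cases
      case right
      then show ?thesis
        using phi_step[of "fst a" "snd a"] m_ab D_ab mu_horizontal[of a b]
        by (cases a) (simp add: walk_weight_def h0_def)
    next
      case left
      then show ?thesis
        using phi_step[of "fst b" "snd b"] m_ab D_ab mu_horizontal[of a b]
        by (cases b) (simp add: walk_weight_def h0_def)
    next
      case up
      then show ?thesis
        using mu_up(1)[of "fst a" "snd a"] D_ab
        by (cases a) (simp add: walk_weight_def M_def v0_def)
    next
      case down
      then show ?thesis
        using mu_up(2)[of "fst b" "snd b"] D_ab
        by (cases b) (simp add: walk_weight_def M_def v0_def)
    qed
  qed
  also have "\<dots> = path_sum \<mu> ys"
    using path_sum_diff[OF ys(1), of "\<lambda>a. \<phi> (fst a) (snd a)"] ys(3) by (simp add: path_sum_add)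
  also have "\<dots> = (\<Sum>y\<in>{m..<- m}. \<Sum>x\<in>{m..<- m}. K x y * path_sum (up_step y (\<lambda>x'. x' > x)) ys)"
    by (simp add: \<mu>_def path_sum_sum path_sum_scale)
  also have "\<dots> = 0"
  proof (intro sum.neutral ballI)
    fix x y
    show "K x y * path_sum (up_step y (\<lambda>x'. x' > x)) ys = 0"
    proof (cases "(x, y) \<in> D \<and> (x + 1, y) \<in> D \<and> (x, y + 1) \<in> D \<and> (x + 1, y + 1) \<in> D")
      case True
      then show ?thesis using closed[of x y] by (simp add: K_def h0_def v0_def)
    next
      case False
      then show ?thesis using closed_walk_up_steps_eq_0[OF D(1) ys, of x y] by auto
    qed
  qed
  finally show ?thesis .
qed

definition walk_in :: "(int \<times> int) set \<Rightarrow> int \<times> int \<Rightarrow> (int \<times> int) list \<Rightarrow> int \<times> int \<Rightarrow> bool" where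
  "walk_in D a ys b \<longleftrightarrow> ys \<noteq> [] \<and> successively adj2 ys \<and> set ys \<subseteq> D \<and> hd ys = a \<and> last ys = b"

lemma adj2_sym: "adj2 a b = adj2 b a"
  by (auto simp: adj2_def)

lemma walk_in_snoc:
  assumes "walk_in D a ys b" "adj2 b c" "c \<in> D"
  shows "walk_in D a (ys @ [c]) c"
  using assms by (auto simp: walk_in_def successively_append_iff)

text \<open>The potential of a square is the sum of the weights along a walk from a base point of
  its component. Walks to two neighbouring squares close up with the step between them, so every
  choice of walks gives the right difference.\<close>

lemma winds_around_none_imp_planar_exact:
  assumes D: "winds_around_none D" "finite D"
  shows "planar_exact D"
  unfolding planar_exact_def
proof (intro allI impI)
  fix h v :: "int \<Rightarrow> int \<Rightarrow> int"
  assume closed: "\<forall>x y. (x, y) \<in> D \<and> (x + 1, y) \<in> D \<and> (x, y + 1) \<in> D \<and> (x + 1, y + 1) \<in> D \<longrightarrow>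
    h x y + v (x + 1) y = v x y + h x (y + 1)"
  define w where "w = walk_weight h v"
  have indep: "path_sum w ys + w c d = path_sum w zs"
    if ys: "walk_in D a ys c" and zs: "walk_in D a zs d" and cd: "adj2 c d" for a c d ys zs
  proof -
    have "path_sum w (ys @ rev zs) = 0"
      unfolding w_def
    proof (rule closed_walk_weight[OF D])
      show "successively adj2 (ys @ rev zs)"
        using ys zs cd by (auto simp: walk_in_def successively_append_iff successively_rev
            adj2_sym hd_rev)
    qed (use ys zs closed in \<open>auto simp: walk_in_def last_rev\<close>)
    moreover have "path_sum w (rev zs) = - path_sum w zs"
      unfolding w_def by (rule path_sum_rev, rule walk_weight_swap)
    ultimately show ?thesis
      using path_sum_append[of ys "rev zs" w] ys zs by (simp add: walk_in_def hd_rev)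
  qed
  \<comment> \<open>\<open>D\<close> may have several components. Neighbouring squares are reachable
    from the same starting points, so the choice operator gives them the same base point.\<close>
  define rep where "rep = (\<lambda>c. SOME a. \<exists>ys. walk_in D a ys c)"
  define f where "f = (\<lambda>c. path_sum w (SOME ys. walk_in D (rep c) ys c))"
  have rep: "\<exists>ys. walk_in D (rep c) ys c" if "c \<in> D" for c
  proof -
    have "walk_in D c [c] c" using that by (simp add: walk_in_def)
    then have "\<exists>a ys. walk_in D a ys c" by blast
    then show ?thesis unfolding rep_def by (rule someI_ex)
  qed
  have key: "w c d = f d - f c" if cd: "c \<in> D" "d \<in> D" "adj2 c d" for c d
  proof -
    have "(\<exists>ys. walk_in D a ys c) \<longleftrightarrow> (\<exists>ys. walk_in D a ys d)" for a
    proof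
      assume "\<exists>ys. walk_in D a ys c"
      then show "\<exists>ys. walk_in D a ys d" using walk_in_snoc[OF _ cd(3,2)] by metis
    next
      assume "\<exists>ys. walk_in D a ys d"
      then show "\<exists>ys. walk_in D a ys c" using walk_in_snoc[OF _ cd(3)[unfolded adj2_sym[of c d]]
          cd(1)] by metis
    qed
    then have eq: "rep c = rep d" by (simp add: rep_def)
    have "walk_in D (rep c) (SOME ys. walk_in D (rep c) ys c) c"
      "walk_in D (rep d) (SOME ys. walk_in D (rep d) ys d) d"
      by (rule someI_ex[OF rep[OF cd(1)]], rule someI_ex[OF rep[OF cd(2)]])
    from indep[OF this(1) this(2)[folded eq] cd(3)] show ?thesis
      by (simp add: f_def eq)
  qed
  show "\<exists>f. (\<forall>x y. (x, y) \<in> D \<and> (x + 1, y) \<in> D \<longrightarrow> h x y = f (x + 1) y - f x y) \<and>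
          (\<forall>x y. (x, y) \<in> D \<and> (x, y + 1) \<in> D \<longrightarrow> v x y = f x (y + 1) - f x y)"
  proof (intro exI[of _ "\<lambda>x y. f (x, y)"] conjI allI impI)
    fix x y assume "(x, y) \<in> D \<and> (x + 1, y) \<in> D"
    then show "h x y = f (x + 1, y) - f (x, y)"
      using key[of "(x, y)" "(x + 1, y)"] by (simp add: adj2_def w_def walk_weight_def)
  next
    fix x y assume "(x, y) \<in> D \<and> (x, y + 1) \<in> D"
    then show "v x y = f (x, y + 1) - f (x, y)"
      using key[of "(x, y)" "(x, y + 1)"] by (simp add: adj2_def w_def walk_weight_def)
  qed
qed

section \<open>Winding numbers in a simply connected union of squares\<close>

definition unit_square :: "int \<times> int \<Rightarrow> complex set" where
  "unit_square d = cbox (Complex (of_int (fst d)) (of_int (snd d)))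
     (Complex (of_int (fst d) + 1) (of_int (snd d) + 1))"

lemma mem_unit_square:
  "z \<in> unit_square d \<longleftrightarrow> of_int (fst d) \<le> Re z \<and> Re z \<le> of_int (fst d) + 1
     \<and> of_int (snd d) \<le> Im z \<and> Im z \<le> of_int (snd d) + 1"
  by (auto simp: unit_square_def in_cbox_complex_iff)

lemma jewel_center_mem_unit_square: "jewel_center a \<in> unit_square d \<longleftrightarrow> a = d"
proof
  assume "jewel_center a \<in> unit_square d"
  then have "of_int (fst d) \<le> (of_int (fst a) + 1 / 2 :: real)" "of_int (fst a) + 1 / 2 \<le> (of_int
      (fst d) + 1 :: real)"
    "of_int (snd d) \<le> (of_int (snd a) + 1 / 2 :: real)" "of_int (snd a) + 1 / 2 \<le> (of_int (snd d)
        + 1 :: real)"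
    by (simp_all add: mem_unit_square)
  then have "fst d = fst a" "snd d = snd a" by linarith+
  then show "a = d" by (simp add: prod_eq_iff)
qed (simp add: mem_unit_square)

lemma segment_in_unit_squares:
  assumes "adj2 a b"
  shows "closed_segment (jewel_center a) (jewel_center b) \<subseteq> unit_square a \<union> unit_square b"
proof
  fix z assume "z \<in> closed_segment (jewel_center a) (jewel_center b)"
  then obtain t where t: "0 \<le> t" "t \<le> 1" and z: "z = (1 - t) *\<^sub>R jewel_center a + t *\<^sub>R
      jewel_center b"
    by (auto simp: in_segment)
  define u v where "u = real_of_int (fst b - fst a)" and "v = real_of_int (snd b - snd a)"
  have "\<bar>fst b - fst a\<bar> \<le> 1" "\<bar>snd b - snd a\<bar> \<le> 1"
    using assms by (auto simp: adj2_def)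
  then have uv: "\<bar>u\<bar> \<le> 1" "\<bar>v\<bar> \<le> 1"
    unfolding u_def v_def by linarith+
  have small: "\<bar>s * x\<bar> \<le> 1 / 2" if "0 \<le> s" "s \<le> 1 / 2" "\<bar>x\<bar> \<le> 1" for s x :: real
    using mult_mono[of s "1 / 2" "\<bar>x\<bar>" 1] that by (simp add: abs_mult)
  show "z \<in> unit_square a \<union> unit_square b"
  proof (cases "t \<le> 1 / 2")
    case True
    have "Re z = of_int (fst a) + 1 / 2 + t * u" "Im z = of_int (snd a) + 1 / 2 + t * v"
      by (simp_all add: z u_def v_def algebra_simps)
    then have "z \<in> unit_square a"
      using small[OF t(1) True uv(1)] small[OF t(1) True uv(2)]
      unfolding mem_unit_square abs_le_iff by linarith
    then show ?thesis by simp
  next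
    case False
    have "Re z = of_int (fst b) + 1 / 2 - (1 - t) * u" "Im z = of_int (snd b) + 1 / 2 - (1 - t) * v"
      by (simp_all add: z u_def v_def algebra_simps)
    then have "z \<in> unit_square b"
      using small[of "1 - t" u] small[of "1 - t" v] uv t False
      unfolding mem_unit_square abs_le_iff by linarith
    then show ?thesis by simp
  qed
qed

lemma simply_connected_imp_winds_around_none:
  assumes "simply_connected (\<Union>d\<in>D. unit_square d)"
  shows "winds_around_none D"
  unfolding winds_around_none_def
proof (intro allI impI)
  fix ys p
  assume ys: "ys \<noteq> []" "successively adj2 ys" "hd ys = last ys" "set ys \<subseteq> D" and p: "p \<notin> D"
  let ?g = "polyline (map jewel_center ys)"
  have "path_image ?g \<subseteq> (\<Union>d\<in>D. unit_square d)"
  proof (rule polyline_image[OF ys(1,2)])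
    fix a assume "a \<in> set ys"
    then show "jewel_center a \<in> (\<Union>d\<in>D. unit_square d)"
      using ys(4) by (auto simp: jewel_center_mem_unit_square)
  next
    fix a b assume ab: "a \<in> set ys" "b \<in> set ys" "adj2 a b"
    have "unit_square a \<union> unit_square b \<subseteq> (\<Union>d\<in>D. unit_square d)"
      using ab(1,2) ys(4) by auto
    then show "closed_segment (jewel_center a) (jewel_center b) \<subseteq> (\<Union>d\<in>D. unit_square d)"
      using segment_in_unit_squares[OF ab(3)] by (rule subset_trans[rotated])
  qed
  moreover have "jewel_center p \<notin> (\<Union>d\<in>D. unit_square d)"
    using p by (auto simp: jewel_center_mem_unit_square)
  moreover have "path ?g" "pathfinish ?g = pathstart ?g"
    using polyline_walk[of "map jewel_center ys"] ys by (auto simp: valid_path_imp_path hd_map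
        last_map)
  ultimately show "winding_number ?g (jewel_center p) = 0"
    by (intro simply_connected_imp_winding_number_zero[OF assms])
qed

section \<open>Integrality\<close>

locale tiled_cylinder =
  fixes i :: 3 and k :: int and D :: "(int \<times> int) set" and N :: nat and M :: "((int ^ 3) \<times> 3) set"
    and C :: "(int ^ 3) set"
  assumes fin_D: "finite D" and C_def: "C = cyl_cells i k D N" and tiling: "lattice_tiling C M"
begin

definition fwd :: "3 \<Rightarrow> int ^ 3 \<Rightarrow> int" where
  "fwd j p = of_bool ((p, j) \<in> M)"

definition bwd :: "3 \<Rightarrow> int ^ 3 \<Rightarrow> int" where
  "bwd j p = of_bool ((p - ax j, j) \<in> M)"

definition same_col :: "int ^ 3 \<Rightarrow> int ^ 3 \<Rightarrow> bool" where
  "same_col p q \<longleftrightarrow> p $ (i + 1) = q $ (i + 1) \<and> p $ (i + 2) = q $ (i + 2)"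

text \<open>What is left of the kernel of \<open>pairing\<close> once both transverse sign functions
  have become indicators: cubes interact only within a column.\<close>

definition col :: "int ^ 3 \<Rightarrow> int ^ 3 \<Rightarrow> int" where
  "col p q = of_bool (same_col p q) * (colour p * colour q * sgn (q $ i - p $ i))"

definition form :: "(int ^ 3 \<Rightarrow> int) \<Rightarrow> (int ^ 3 \<Rightarrow> int) \<Rightarrow> int" where
  "form A B = (\<Sum>p\<in>C. A p * (\<Sum>q\<in>C. col p q * B q))"

lemma fin_C: "finite C"
  by (simp add: C_def finite_cyl_cells fin_D)

lemma fin_M: "finite M"
  using lattice_tiling_finite[OF tiling fin_C] .

lemma mem_C: "m \<in> M \<Longrightarrow> fst m \<in> C \<and> fst m + ax (snd m) \<in> C"
  using tiling by (auto simp: lattice_tiling_def edge_def)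

lemma sum_fwd: "(\<Sum>p\<in>C. fwd j p * f p) = (\<Sum>m\<in>{m\<in>M. snd m = j}. f (fst m))"
proof -
  have "(\<Sum>p\<in>C. fwd j p * f p) = (\<Sum>p\<in>{p\<in>C. (p, j) \<in> M}. f p)"
    unfolding sum.inter_filter[OF fin_C] by (intro sum.cong) (auto simp: fwd_def)
  also have "\<dots> = (\<Sum>m\<in>{m\<in>M. snd m = j}. f (fst m))"
    by (rule sum.reindex_bij_witness[of _ fst "\<lambda>p. (p, j)"]) (auto dest: mem_C)
  finally show ?thesis .
qed

lemma sum_bwd: "(\<Sum>p\<in>C. bwd j p * f p) = (\<Sum>m\<in>{m\<in>M. snd m = j}. f (fst m + ax j))"
proof -
  have "(\<Sum>p\<in>C. bwd j p * f p) = (\<Sum>p\<in>{p\<in>C. (p - ax j, j) \<in> M}. f p)"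
    unfolding sum.inter_filter[OF fin_C] by (intro sum.cong) (auto simp: bwd_def)
  also have "\<dots> = (\<Sum>m\<in>{m\<in>M. snd m = j}. f (fst m + ax j))"
    by (rule sum.reindex_bij_witness[of _ "\<lambda>m. fst m + ax j" "\<lambda>p. (p - ax j, j)"]) (auto dest:
        mem_C)
  finally show ?thesis .
qed

lemma cover_unique:
  assumes "p \<in> C"
  shows "fwd (i + 1) p + bwd (i + 1) p + fwd (i + 2) p + bwd (i + 2) p + (fwd i p + bwd i p) = 1"
proof -
  have at_most: "m = m'" if "m \<in> M" "m' \<in> M" "p \<in> edge m" "p \<in> edge m'" for m m'
    using lattice_tiling_eqI[OF tiling that] .
  have ef: "p \<in> edge (p, j)" "p \<in> edge (p - ax j, j)" for j
    by (simp_all add: edge_def)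
  obtain m where m: "m \<in> M" "p \<in> edge m"
    using assms tiling by (auto simp: lattice_tiling_def)
  define j where "j = snd m"
  have f: "(p, l) \<in> M \<longleftrightarrow> m = (p, l)" for l
    using at_most[OF _ m(1) ef(1) m(2), of l] m(1) by auto
  have b: "(p - ax l, l) \<in> M \<longleftrightarrow> m = (p - ax l, l)" for l
    using at_most[OF _ m(1) ef(2) m(2), of l] m(1) by auto
  have "m = (p, j) \<and> m \<noteq> (p - ax j, j) \<or> m = (p - ax j, j) \<and> m \<noteq> (p, j)"
    using m(2) by (cases m) (auto simp: j_def edge_def)
  moreover have "m \<noteq> (p, l)" "m \<noteq> (p - ax l, l)" if "l \<noteq> j" for l
    using that by (auto simp: j_def)
  moreover consider "j = i" | "j = i + 1" | "j = i + 2"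
    using exhaust_3_rot by blast
  ultimately show ?thesis
    unfolding fwd_def bwd_def f b by cases auto
qed

lemma form_add_right: "form A (\<lambda>p. B p + B' p) = form A B + form A B'"
  by (simp add: form_def distrib_left sum.distrib)

lemma form_diff_left: "form (\<lambda>p. A p - A' p) B = form A B - form A' B"
  by (simp add: form_def left_diff_distrib sum_subtractf)

lemma form_diff_right: "form A (\<lambda>p. B p - B' p) = form A B - form A B'"
  by (simp add: form_def right_diff_distrib sum_subtractf)

lemma col_swap: "col p q = - col q p"
proof -
  have "sgn (q $ i - p $ i) = - sgn (p $ i - q $ i)" by (simp add: sgn_if)
  then show ?thesis by (auto simp: col_def same_col_def)
qed

lemma form_swap: "form A B = - form B A"
proof -
  have "form A B = (\<Sum>p\<in>C. \<Sum>q\<in>C. A p * (col p q * B q))"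
    by (simp add: form_def sum_distrib_left)
  also have "\<dots> = (\<Sum>q\<in>C. \<Sum>p\<in>C. A p * (col p q * B q))"
    by (rule sum.swap)
  also have "\<dots> = (\<Sum>q\<in>C. \<Sum>p\<in>C. - (B q * (col q p * A p)))"
  proof (intro sum.cong refl)
    fix p q show "A p * (col p q * B q) = - (B q * (col q p * A p))"
      using col_swap[of p q] by simp
  qed
  also have "\<dots> = - form B A"
    by (simp add: form_def sum_distrib_left sum_negf)
  finally show ?thesis .
qed

lemma form_self: "form A A = 0"
  using form_swap[of A A] by simp

text \<open>The two cubes of an axial domino have opposite colours and lie on the same side of any
  other cube of their column. Their contributions cancel except at the cubes of the domino itself,
  which \<open>A\<close> avoids.\<close>

lemma form_axial:
  assumes "\<And>p. p \<in> C \<Longrightarrow> A p * (fwd i p + bwd i p) = 0"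
  shows "form A (\<lambda>p. fwd i p + bwd i p) = 0"
proof -
  have "A p * (\<Sum>q\<in>C. col p q * (fwd i q + bwd i q)) = 0" if p: "p \<in> C" for p
  proof (cases "A p = 0")
    case False
    then have "fwd i p + bwd i p = 0"
      using assms[OF p] by simp
    then have p0: "fwd i p = 0" "bwd i p = 0"
      by (auto simp: fwd_def bwd_def of_bool_def split: if_splits)
    have "(\<Sum>q\<in>C. col p q * (fwd i q + bwd i q)) =
        (\<Sum>q\<in>C. fwd i q * col p q) + (\<Sum>q\<in>C. bwd i q * col p q)"
      by (simp add: sum.distrib algebra_simps)
    also have "\<dots> = (\<Sum>m\<in>{m\<in>M. snd m = i}. col p (fst m) + col p (fst m + ax i))"
      unfolding sum_fwd sum_bwd by (simp add: sum.distrib)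
    also have "\<dots> = 0"
    proof (intro sum.neutral ballI)
      fix m assume m: "m \<in> {m \<in> M. snd m = i}"
      then have m_eq: "m = (fst m, i)" by auto
      show "col p (fst m) + col p (fst m + ax i) = 0"
      proof (cases "same_col p (fst m)")
        case True
        have "p \<noteq> fst m" using p0 m m_eq by (auto simp: fwd_def)
        then have n1: "p $ i \<noteq> fst m $ i"
          using True vec_3_eqI[of p i "fst m"] by (auto simp: same_col_def)
        have "p \<noteq> fst m + ax i" using p0 m m_eq by (auto simp: bwd_def)
        then have n2: "p $ i \<noteq> fst m $ i + 1"
          using True vec_3_eqI[of p i "fst m + ax i"] by (auto simp: same_col_def ax_nth)
        have "sgn (fst m $ i - p $ i) = sgn (fst m $ i + 1 - p $ i)"
          using n1 n2 by (auto simp: sgn_if)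
        then show ?thesis by (simp add: col_def same_col_def ax_nth)
      qed (simp add: col_def same_col_def ax_nth)
    qed
    finally show ?thesis by simp
  qed simp
  then show ?thesis unfolding form_def by (intro sum.neutral ballI)
qed

text \<open>Transverse dominoes of different directions project to base dominoes that meet in at
  most one square. The transverse signs single out this common column, and the four terms tell which
  cube of each domino lies there. The minus sign at \<open>bwd\<close> compensates the opposite
  colour of the upper cube.\<close>

lemma twist4_form:
  "- twist4 i M = form (\<lambda>p. fwd (i + 1) p - bwd (i + 1) p) (\<lambda>p. fwd (i + 2) p - bwd (i + 2) p)"
proof -
  let ?X = "{m\<in>M. snd m = i + 1}" and ?Y = "{m\<in>M. snd m = i + 2}"
  have summand: "- pairing (edge m) (edge m') =
      col (fst m) (fst m') - col (fst m) (fst m' + ax (i + 2)) -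
      (col (fst m + ax (i + 1)) (fst m') - col (fst m + ax (i + 1)) (fst m' + ax (i + 2)))"
    if mm: "m \<in> ?X" "m' \<in> ?Y" for m m'
  proof -
    define a b where "a = fst m" and "b = fst m'"
    have ab: "m = (a, i + 1)" "m' = (b, i + 2)"
      using mm by (simp_all add: a_def b_def prod_eq_iff)
    define x y z where "x = b $ (i + 1) - a $ (i + 1)" and "y = b $ (i + 2) - a $ (i + 2)"
      and "z = b $ i - a $ i"
    define e where "e = colour a * colour b * sgn z"
    have c: "pairing (edge m) (edge m') =
      e * (sgn x * sgn y - sgn x * sgn (y + 1) - sgn (x - 1) * sgn y + sgn (x - 1) * sgn (y + 1))"
      by (simp add: ab pairing_def edge_sum sgn3_distinct[of i "i + 1" "i + 2"] ax_nth x_def y_def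
          z_def e_def algebra_simps)
    have S: "- (sgn x * sgn y - sgn x * sgn (y + 1) - sgn (x - 1) * sgn y + sgn (x - 1) * sgn (y +
        1)) =
       of_bool (x = 0 \<and> y = 0) + of_bool (x = 0 \<and> y = - 1) + of_bool (x = 1 \<and> y = 0) + of_bool (x
           = 1 \<and> y = - 1)"
      by (auto simp: sgn_if)
    have cols: "col a b = of_bool (x = 0 \<and> y = 0) * e"
      "col a (b + ax (i + 2)) = - of_bool (x = 0 \<and> y = - 1) * e"
      "col (a + ax (i + 1)) b = - of_bool (x = 1 \<and> y = 0) * e"
      "col (a + ax (i + 1)) (b + ax (i + 2)) = of_bool (x = 1 \<and> y = - 1) * e"
      by (auto simp: col_def same_col_def ax_nth x_def y_def z_def e_def)
    have "- (e * s) = o1 * e - - o2 * e - (- o3 * e - o4 * e)" if "- s = o1 + o2 + o3 + o4"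
      for s o1 o2 o3 o4 :: int
      using arg_cong[OF that, of "\<lambda>t. e * t"] by (simp add: algebra_simps)
    from this[OF S] show ?thesis
      unfolding a_def[symmetric] b_def[symmetric] c cols .
  qed
  have inner: "(\<Sum>q\<in>C. col p q * (fwd (i + 2) q - bwd (i + 2) q)) =
      (\<Sum>m'\<in>?Y. col p (fst m') - col p (fst m' + ax (i + 2)))" for p
    using sum_fwd[of "i + 2" "col p"] sum_bwd[of "i + 2" "col p"]
    by (simp add: right_diff_distrib sum_subtractf mult.commute)
  have "form (\<lambda>p. fwd (i + 1) p - bwd (i + 1) p) (\<lambda>p. fwd (i + 2) p - bwd (i + 2) p) =
     (\<Sum>p\<in>C. (fwd (i + 1) p - bwd (i + 1) p) * (\<Sum>m'\<in>?Y. col p (fst m') - col p (fst m' + ax (i +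
         2))))"
    unfolding form_def inner ..
  also have "\<dots> = (\<Sum>m\<in>?X. (\<Sum>m'\<in>?Y. col (fst m) (fst m') - col (fst m) (fst m' + ax (i + 2))) -
      (\<Sum>m'\<in>?Y. col (fst m + ax (i + 1)) (fst m') - col (fst m + ax (i + 1)) (fst m' + ax (i + 2))))"
    unfolding left_diff_distrib sum_subtractf sum_fwd sum_bwd ..
  also have "\<dots> = (\<Sum>m\<in>?X. \<Sum>m'\<in>?Y. - pairing (edge m) (edge m'))"
    unfolding sum_subtractf[symmetric] using summand by (intro sum.cong refl) simp
  also have "\<dots> = - twist4 i M"
    unfolding twist4_def pairing_dir_cells_right[OF tiling fin_C] pairing_dir_cells_left[OF tiling
        fin_C]
    by (subst sum.swap) (simp add: sum_negf)
  finally show ?thesis by simp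
qed


definition par :: "int ^ 3 \<Rightarrow> int" where
  "par p = (- 1) ^ nat (p $ i - k)"

lemma sum_col:
  assumes "p \<in> C"
  shows "(\<Sum>q\<in>C. col p q) = (if odd N then 0 else - par p)"
proof -
  define m where "m = nat (p $ i - k)"
  have m: "p $ i = k + int m" "m < N" and pD: "(p $ (i + 1), p $ (i + 2)) \<in> D"
    using assms by (auto simp: m_def C_def cyl_cells_def)
  define b where "b = colour (mk_pt i k (p $ (i + 1)) (p $ (i + 2)))"
  have "p = mk_pt i (k + int m) (p $ (i + 1)) (p $ (i + 2))"
    unfolding m(1)[symmetric] by simp
  from arg_cong[OF this, of colour] have p: "colour p = (- 1) ^ m * b"
    by (simp add: colour_mk_pt b_def)
  have "(\<Sum>q\<in>C. col p q) = (\<Sum>d\<in>D. if d = (p $ (i + 1), p $ (i + 2))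
      then colour p * b * (\<Sum>n<N. (- 1) ^ n * sgn (int n - int m)) else 0)"
    unfolding C_def cyl_cells_sum
  proof (intro sum.cong refl)
    fix d
    have "col p (mk_pt i (k + int n) (fst d) (snd d)) = (if d = (p $ (i + 1), p $ (i + 2))
        then colour p * b * ((- 1) ^ n * sgn (int n - int m)) else 0)" for n
      by (cases d) (auto simp: col_def same_col_def m(1) colour_mk_pt b_def)
    then show "(case d of (u, v) \<Rightarrow> \<Sum>n<N. col p (mk_pt i (k + int n) u v)) =
        (if d = (p $ (i + 1), p $ (i + 2)) then colour p * b * (\<Sum>n<N. (- 1) ^ n * sgn (int n - int
            m)) else 0)"
      by (simp add: case_prod_beta sum_distrib_left)
  qed
  also have "\<dots> = colour p * b * (\<Sum>n<N. (- 1) ^ n * sgn (int n - int m))"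
    using fin_D pD by simp
  also have "\<dots> = (- 1) ^ m * (\<Sum>n<N. (- 1) ^ n * sgn (int n - int m))"
    by (simp add: p b_def)
  finally show ?thesis
    unfolding sum_alternating_sgn[OF m(2)] par_def m_def[symmetric] by simp
qed

lemma form_one: "form A (\<lambda>_. 1) = (if odd N then 0 else - (\<Sum>p\<in>C. A p * par p))"
  by (simp add: form_def sum_col sum_negf)

text \<open>Modulo 2, colours and signs are 1 for distinct cubes of a column, and equal cubes drop
  out by the assumption. With \<open>column_sum\<close> only the column counts of \<open>A\<close>
  and \<open>B\<close> matter.\<close>

lemma form_parity:
  assumes "\<And>p. p \<in> C \<Longrightarrow> A p * B p = 0"
  shows "even (form A B - (\<Sum>p\<in>C. \<Sum>q\<in>C. of_bool (same_col p q) * (A p * B q)))"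
proof -
  have "form A B - (\<Sum>p\<in>C. \<Sum>q\<in>C. of_bool (same_col p q) * (A p * B q)) =
    (\<Sum>p\<in>C. \<Sum>q\<in>C. A p * (col p q * B q) - of_bool (same_col p q) * (A p * B q))"
    by (simp add: form_def sum_distrib_left sum_subtractf)
  moreover have "even (A p * (col p q * B q) - of_bool (same_col p q) * (A p * B q))"
    if "p \<in> C" "q \<in> C" for p q
  proof (cases "same_col p q \<and> p $ i \<noteq> q $ i")
    case True
    then have "col p q = 1 \<or> col p q = - 1"
      using colour_cases[of p] colour_cases[of q] by (auto simp: col_def sgn_if)
    then show ?thesis using True by auto
  next
    case False
    show ?thesis
    proof (cases "same_col p q")
      case True
      then have pq: "p = q"
        using False vec_3_eqI[of p i q] by (auto simp: same_col_def)
      show ?thesis using assms[OF that(1)] unfolding pq by (auto simp: col_def)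
    qed (simp add: col_def)
  qed
  ultimately show ?thesis by (simp add: dvd_sum)
qed

lemma column_sum:
  fixes A B :: "int ^ 3 \<Rightarrow> int"
  shows "(\<Sum>p\<in>C. \<Sum>q\<in>C. of_bool (same_col p q) * (A p * B q)) =
   (\<Sum>(u, v)\<in>D. (\<Sum>n<N. A (mk_pt i (k + int n) u v)) * (\<Sum>n<N. B (mk_pt i (k + int n) u v)))"
proof -
  have "(\<Sum>q\<in>C. of_bool (same_col p q) * (A p * B q)) =
     A p * (\<Sum>n<N. B (mk_pt i (k + int n) (p $ (i + 1)) (p $ (i + 2))))" if "p \<in> C" for p
  proof -
    have pD: "(p $ (i + 1), p $ (i + 2)) \<in> D"
      using that by (simp add: C_def cyl_cells_def)
    have "(\<Sum>q\<in>C. of_bool (same_col p q) * (A p * B q)) =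
      (\<Sum>d\<in>D. if d = (p $ (i + 1), p $ (i + 2)) then
         A p * (\<Sum>n<N. B (mk_pt i (k + int n) (p $ (i + 1)) (p $ (i + 2)))) else 0)"
      unfolding C_def cyl_cells_sum
    proof (intro sum.cong refl)
      fix d
      have "of_bool (same_col p (mk_pt i (k + int n) (fst d) (snd d))) * (A p * B (mk_pt i (k +
          int n) (fst d) (snd d)))
        = (if d = (p $ (i + 1), p $ (i + 2)) then
            A p * B (mk_pt i (k + int n) (p $ (i + 1)) (p $ (i + 2))) else 0)" for n
        by (cases d) (auto simp: same_col_def)
      then show "(case d of (u, v) \<Rightarrow> \<Sum>n<N. of_bool (same_col p (mk_pt i (k + int n) u v)) *
          (A p * B (mk_pt i (k + int n) u v))) = (if d = (p $ (i + 1), p $ (i + 2)) then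
         A p * (\<Sum>n<N. B (mk_pt i (k + int n) (p $ (i + 1)) (p $ (i + 2)))) else 0)"
        by (simp add: case_prod_beta sum_distrib_left del: sum_of_bool_mult_eq sum_mult_of_bool_eq)
    qed
    then show ?thesis using fin_D pD by simp
  qed
  then have "(\<Sum>p\<in>C. \<Sum>q\<in>C. of_bool (same_col p q) * (A p * B q)) =
    (\<Sum>p\<in>C. A p * (\<Sum>n<N. B (mk_pt i (k + int n) (p $ (i + 1)) (p $ (i + 2)))))"
    by simp
  also have "\<dots> = (\<Sum>(u, v)\<in>D. (\<Sum>n<N. A (mk_pt i (k + int n) u v)) * (\<Sum>n<N. B (mk_pt i (k + int n) u
      v)))"
    unfolding C_def cyl_cells_sum sum_distrib_right by (intro sum.cong refl) (simp add:
        case_prod_beta)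
  finally show ?thesis .
qed

text \<open>Eliminating the backward cubes by \<open>fwd + bwd + \<dots> = 1\<close> makes the coefficient of \<^term>\<open>form (fwd
  (i + 1)) (fwd (i + 2))\<close> equal to 4; the other terms only matter modulo 2.\<close>

lemma twist4_expand:
  "- twist4 i M = 4 * form (fwd (i + 1)) (fwd (i + 2)) + 2 * form (fwd (i + 1)) (bwd (i + 1))
    - 2 * form (fwd (i + 2)) (bwd (i + 2)) - form (fwd (i + 1)) (\<lambda>_. 1) + form (bwd (i + 1)) (\<lambda>_. 1)
    + 2 * form (fwd (i + 2)) (\<lambda>_. 1)"
proof -
  let ?E = "fwd (i + 1)" and ?W = "bwd (i + 1)" and ?N = "fwd (i + 2)" and ?S = "bwd (i + 2)"
    and ?Z = "\<lambda>p. fwd i p + bwd i p"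
  have nonneg: "0 \<le> fwd j p" "0 \<le> bwd j p" for j p by (simp_all add: fwd_def bwd_def)
  have prods: "?E p * ?Z p = 0 \<and> ?W p * ?Z p = 0 \<and> ?N p * ?Z p = 0" if "p \<in> C" for p
    using cover_unique[OF that] by (auto simp: fwd_def bwd_def of_bool_def split: if_splits)
  have Z: "form ?E ?Z = 0" "form ?W ?Z = 0" "form ?N ?Z = 0"
    using prods by (auto intro: form_axial)
  \<comment> \<open>The markings sum to 1 on \<open>C\<close>. Applied to \<open>?E\<close> and
    \<open>?W\<close> this eliminates the forms with \<open>?S\<close>; applied to \<open>?N\<close>
    it eliminates \<open>form ?N ?W\<close>, and the term \<open>form ?E ?N\<close> appears four
    times.\<close>
  have one: "form A (\<lambda>_. 1) = form A ?E + form A ?W + form A ?N + form A ?S + form A ?Z" for A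
  proof -
    have "form A (\<lambda>_. 1) = form A (\<lambda>p. ?E p + ?W p + ?N p + ?S p + ?Z p)"
      unfolding form_def by (intro sum.cong refl arg_cong2[where f = times]) (use cover_unique in
          simp)
    then show ?thesis by (simp add: form_add_right)
  qed
  have "form ?W ?N = - form ?N ?W" "form ?W ?E = - form ?E ?W" "form ?N ?E = - form ?E ?N"
    by (rule form_swap)+
  then show ?thesis
    using one[of ?E] one[of ?W] one[of ?N] Z twist4_form form_self[of ?E] form_self[of ?W]
        form_self[of ?N]
    by (simp add: form_diff_left form_diff_right)
qed


section \<open>Column counts modulo 4\<close>

definition cnt :: "(int ^ 3 \<Rightarrow> int) \<Rightarrow> int \<times> int \<Rightarrow> int" where
  "cnt A d = (\<Sum>n<N. A (mk_pt i (k + int n) (fst d) (snd d)))"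

lemma sum_cnt: "(\<Sum>d\<in>D. g d * cnt A d) = (\<Sum>p\<in>C. g (p $ (i + 1), p $ (i + 2)) * A p)"
  unfolding C_def cyl_cells_sum by (simp add: cnt_def case_prod_beta sum_distrib_left)

text \<open>A shift by one square along \<open>j\<close> carries the lower cubes of the
  \<open>j\<close>-dominoes over a column to their upper cubes; columns that the shift would move
  out of \<open>D\<close> have count 0.\<close>

lemma sum_cnt_sq:
  assumes "j \<noteq> i"
  shows "(\<Sum>d\<in>D. (cnt (fwd j) d)\<^sup>2) = (\<Sum>d\<in>D. (cnt (bwd j) d)\<^sup>2)"
proof -
  define s where "s = (\<lambda>d. (fst d + ax j $ (i + 1), snd d + ax j $ (i + 2)))"
  have mk: "mk_pt i m u v + ax j = mk_pt i m (fst (s (u, v))) (snd (s (u, v)))" for m u v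
    by (rule vec_3_eqI[of _ i]) (use assms(1) in \<open>simp_all add: s_def ax_nth\<close>)
  have cnt_s: "cnt (bwd j) (s d) = cnt (fwd j) d" for d
    using mk[of _ "fst d" "snd d", symmetric] by (simp add: cnt_def bwd_def fwd_def)
  have inj: "inj_on s X" for X by (auto simp: inj_on_def s_def prod_eq_iff)
  have in_D: "s d \<in> D" if nz: "cnt (fwd j) d \<noteq> 0" for d
  proof -
    obtain n where "fwd j (mk_pt i (k + int n) (fst d) (snd d)) \<noteq> 0"
      using nz unfolding cnt_def by (rule sum.not_neutral_contains_not_neutral)
    then have "(mk_pt i (k + int n) (fst d) (snd d), j) \<in> M"
      by (simp add: fwd_def)
    from mem_C[OF this] show ?thesis by (simp add: mk mk_pt_mem_cyl_cells C_def)
  qed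
  have in_D': "\<exists>d'\<in>D. s d' = d" if nz: "cnt (bwd j) d \<noteq> 0" for d
  proof -
    define d' where "d' = (fst d - ax j $ (i + 1), snd d - ax j $ (i + 2))"
    have s_d': "s d' = d" by (simp add: s_def d'_def)
    obtain n where "bwd j (mk_pt i (k + int n) (fst d) (snd d)) \<noteq> 0"
      using nz unfolding cnt_def by (rule sum.not_neutral_contains_not_neutral)
    moreover have "mk_pt i (k + int n) (fst d) (snd d) = mk_pt i (k + int n) (fst d') (snd d') +
        ax j"
      by (simp add: mk s_d')
    ultimately have "(mk_pt i (k + int n) (fst d') (snd d'), j) \<in> M"
      by (simp add: bwd_def)
    from mem_C[OF this] have "d' \<in> D" by (simp add: mk_pt_mem_cyl_cells C_def)
    then show ?thesis using s_d' by blast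
  qed
  have "s ` {d\<in>D. cnt (fwd j) d \<noteq> 0} = {d\<in>D. cnt (bwd j) d \<noteq> 0}"
  proof (intro equalityI subsetI)
    fix d assume d: "d \<in> {d\<in>D. cnt (bwd j) d \<noteq> 0}"
    then obtain d' where d': "d' \<in> D" "s d' = d" using in_D'[of d] by blast
    moreover have "cnt (fwd j) d' \<noteq> 0" using d d'(2) cnt_s[of d'] by simp
    ultimately show "d \<in> s ` {d\<in>D. cnt (fwd j) d \<noteq> 0}" by auto
  qed (use in_D cnt_s in auto)
  then have bij: "bij_betw s {d\<in>D. cnt (fwd j) d \<noteq> 0} {d\<in>D. cnt (bwd j) d \<noteq> 0}"
    by (simp add: bij_betw_def inj)
  have "(\<Sum>d\<in>D. (cnt (fwd j) d)\<^sup>2) = (\<Sum>d\<in>{d\<in>D. cnt (fwd j) d \<noteq> 0}. (cnt (bwd j) (s d))\<^sup>2)"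
    unfolding cnt_s using fin_D by (intro sum.mono_neutral_right) auto
  also have "\<dots> = (\<Sum>d\<in>{d\<in>D. cnt (bwd j) d \<noteq> 0}. (cnt (bwd j) d)\<^sup>2)"
    by (rule sum.reindex_bij_betw[OF bij])
  also have "\<dots> = (\<Sum>d\<in>D. (cnt (bwd j) d)\<^sup>2)"
    using fin_D by (intro sum.mono_neutral_left) auto
  finally show ?thesis .
qed

lemma cnt_axial:
  assumes "d \<in> D"
  shows "cnt (fwd i) d = cnt (bwd i) d"
proof (cases "N = 0")
  case False
  then obtain N' where Suc: "N = Suc N'" using not0_implies_Suc by blast
  let ?p = "\<lambda>n. mk_pt i (k + int n) (fst d) (snd d)"
  have "fwd i (?p N') = 0"
  proof -
    have "(?p N', i) \<notin> M"
      using mem_C[of "(?p N', i)"] Suc by (auto simp: C_def mk_pt_add mk_pt_mem_cyl_cells)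
    then show ?thesis by (simp add: fwd_def)
  qed
  moreover have "bwd i (?p 0) = 0"
  proof -
    have "(?p 0 - ax i, i) \<notin> M"
      using mem_C[of "(?p 0 - ax i, i)"] by (auto simp: C_def cyl_cells_def ax_nth)
    then show ?thesis by (simp add: bwd_def)
  qed
  moreover have "bwd i (?p (Suc n)) = fwd i (?p n)" for n
  proof -
    have "?p (Suc n) = ?p n + ax i" unfolding mk_pt_add by (simp add: add_ac)
    then show ?thesis by (simp add: bwd_def fwd_def)
  qed
  moreover have "(\<Sum>n<Suc N'. bwd i (?p n)) = bwd i (?p 0) + (\<Sum>n<N'. bwd i (?p (Suc n)))"
    by (rule sum.lessThan_Suc_shift)
  ultimately have "(\<Sum>n<Suc N'. fwd i (?p n)) = (\<Sum>n<Suc N'. bwd i (?p n))"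
    by simp
  then show ?thesis unfolding cnt_def unfolding Suc .
next
  case True
  then show ?thesis unfolding cnt_def by simp
qed

text \<open>A domino contributes to the first moment of the colours along \<open>j\<close> only if
  it points in that direction. Hence the coloured count of these dominoes depends on the region
  alone.\<close>

lemma sum_colour_tiling: "(\<Sum>p\<in>C. colour p * p $ j) = - (\<Sum>m\<in>{m\<in>M. snd m = j}. colour (fst m))"
proof -
  have "(\<Sum>p\<in>edge m. colour p * p $ j) = - (if snd m = j then colour (fst m) else 0)" for m
    by (cases m) (simp add: edge_sum ax_nth algebra_simps)
  then have "(\<Sum>p\<in>C. colour p * p $ j) = (\<Sum>m\<in>M. - (if snd m = j then colour (fst m) else 0))"
    by (simp add: lattice_tiling_sum[OF tiling fin_C])
  also have "\<dots> = - (\<Sum>m\<in>{m\<in>M. snd m = j}. colour (fst m))"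
    unfolding sum_negf sum.inter_filter[OF fin_M] by simp
  finally show ?thesis .
qed

lemma sum_colour: "(\<Sum>p\<in>C. colour p) = 0"
proof -
  have "(\<Sum>p\<in>edge m. colour p) = 0" for m
    by (cases m) (simp add: edge_sum)
  then show ?thesis by (simp add: lattice_tiling_sum[OF tiling fin_C])
qed

text \<open>In columns of even depth the colours cancel, so the transverse first moment is 0, and it
  has the parity of the number of dominoes in that direction.\<close>

lemma even_transverse:
  assumes "even N"
  shows "even (\<Sum>p\<in>C. fwd (i + 2) p)"
proof -
  have "(\<Sum>p\<in>C. colour p * p $ (i + 2)) =
      (\<Sum>(u, v)\<in>D. colour (mk_pt i k u v) * v * (\<Sum>n<N. (- 1) ^ n))"
    unfolding C_def cyl_cells_sum
    by (simp add: colour_mk_pt sum_distrib_left sum_distrib_right mult_ac)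
  then have "(\<Sum>m\<in>{m\<in>M. snd m = i + 2}. colour (fst m)) = 0"
    using sum_colour_tiling[of "i + 2"] assms by (simp add: sum_alternating)
  moreover have "even ((\<Sum>m\<in>{m\<in>M. snd m = i + 2}. 1) - (\<Sum>m\<in>{m\<in>M. snd m = i + 2}. colour (fst m)))"
    unfolding sum_subtractf[symmetric] by (intro dvd_sum) (auto simp: colour_def)
  ultimately show ?thesis
    using sum_fwd[of "i + 2" "\<lambda>_. 1"] by simp
qed

text \<open>Project the transverse dominoes to a multigraph on \<open>D\<close>: \<open>a\<close>,
  \<open>b\<close>, \<open>c\<close>, \<open>e\<close> count the edges at a vertex in the four
  directions, and the degree has the parity of \<open>N\<close>. Expanding the squared degrees gives
  \<open>S1 = 2 * P + 2 * S2 + 2 * S3\<close>, so the parity of \<open>P\<close> can be read off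
  from the other terms modulo 4.\<close>

lemma even_column_products:
  "even (\<Sum>d\<in>D. cnt (fwd (i + 1)) d * cnt (bwd (i + 1)) d + cnt (fwd (i + 2)) d * cnt (bwd (i + 2))
      d)"
proof -
  define a b c e where "a = cnt (fwd (i + 1))" and "b = cnt (bwd (i + 1))"
    and "c = cnt (fwd (i + 2))" and "e = cnt (bwd (i + 2))"
  define g where "g = (\<lambda>d :: int \<times> int. of_bool (even (fst d + snd d)) :: int)"
  define P where "P = (\<Sum>d\<in>D. a d * b d + c d * e d)"
  define S1 where "S1 = (\<Sum>d\<in>D. (a d + b d + c d + e d)\<^sup>2)"
  define S2 where "S2 = (\<Sum>d\<in>D. (a d + b d) * (c d + e d))"
  define S3 where "S3 = (\<Sum>d\<in>D. (a d)\<^sup>2 + (c d)\<^sup>2)"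
  define H where "H = (\<Sum>d\<in>D. a d + c d)"
  have deg: "even (a d + b d + c d + e d - int N)" if "d \<in> D" for d
  proof -
    have "a d + b d + c d + e d + (cnt (fwd i) d + cnt (bwd i) d) = (\<Sum>n<N. 1)"
      unfolding a_def b_def c_def e_def cnt_def sum.distrib[symmetric]
    proof (intro sum.cong refl)
      fix n assume "n \<in> {..<N}"
      then have "mk_pt i (k + int n) (fst d) (snd d) \<in> C"
        using that by (simp add: C_def mk_pt_mem_cyl_cells)
      from cover_unique[OF this]
      show "fwd (i + 1) (mk_pt i (k + int n) (fst d) (snd d)) + bwd (i + 1) (mk_pt i (k + int n)
          (fst d) (snd d)) +
        fwd (i + 2) (mk_pt i (k + int n) (fst d) (snd d)) + bwd (i + 2) (mk_pt i (k + int n) (fst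
            d) (snd d)) +
        (fwd i (mk_pt i (k + int n) (fst d) (snd d)) + bwd i (mk_pt i (k + int n) (fst d) (snd
            d))) = (1 :: int)" .
    qed
    then have "a d + b d + c d + e d - int N = - (2 * cnt (fwd i) d)"
      using cnt_axial[OF that] by simp
    then show ?thesis by simp
  qed
  have "(\<Sum>d\<in>D. (b d)\<^sup>2) = (\<Sum>d\<in>D. (a d)\<^sup>2)" "(\<Sum>d\<in>D. (e d)\<^sup>2) = (\<Sum>d\<in>D. (c d)\<^sup>2)"
    using sum_cnt_sq[of "i + 1"] sum_cnt_sq[of "i + 2"] by (simp_all add: a_def b_def c_def e_def)
  moreover have "S1 = 2 * P + 2 * S2 + ((\<Sum>d\<in>D. (a d)\<^sup>2) + (\<Sum>d\<in>D. (b d)\<^sup>2) + (\<Sum>d\<in>D. (c d)\<^sup>2) +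
      (\<Sum>d\<in>D. (e d)\<^sup>2))"
    unfolding S1_def P_def S2_def sum_distrib_left sum.distrib[symmetric]
    by (intro sum.cong refl) (simp add: power2_eq_square algebra_simps)
  ultimately have eq: "S1 = 2 * P + 2 * S2 + 2 * S3"
    by (simp add: S3_def sum.distrib)
  have S3_H: "even (S3 - H)"
    unfolding S3_def H_def sum_subtractf[symmetric] by (intro dvd_sum) auto
  \<comment> \<open>Every edge has exactly one end on a square with even coordinate sum, so the
    degrees of these squares count the edges.\<close>
  have edge_white: "(\<Sum>d\<in>D. g d * (cnt (fwd j) d + cnt (bwd j) d)) = (\<Sum>d\<in>D. cnt (fwd j) d)"
    if "j \<noteq> i" for j
  proof -
    have j: "j = i + 1 \<or> j = i + 2" using that exhaust_3_rot by blast
    have "(\<Sum>d\<in>D. g d * (cnt (fwd j) d + cnt (bwd j) d)) =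
      (\<Sum>p\<in>C. fwd j p * g (p $ (i + 1), p $ (i + 2))) + (\<Sum>p\<in>C. bwd j p * g (p $ (i + 1), p $ (i +
          2)))"
      by (simp add: distrib_left sum.distrib sum_cnt mult.commute)
    also have "\<dots> = (\<Sum>m\<in>{m\<in>M. snd m = j}. 1)"
      unfolding sum_fwd sum_bwd sum.distrib[symmetric]
      by (intro sum.cong refl) (use j in \<open>auto simp: g_def ax_nth\<close>)
    also have "\<dots> = (\<Sum>d\<in>D. cnt (fwd j) d)"
      using sum_cnt[of "\<lambda>_. 1"] sum_fwd[of j "\<lambda>_. 1"] by simp
    finally show ?thesis .
  qed
  have H_eq: "H = (\<Sum>d\<in>D. g d * (a d + b d + c d + e d))"
    using edge_white[of "i + 1"] edge_white[of "i + 2"]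
    by (simp add: H_def a_def b_def c_def e_def distrib_left sum.distrib)
  show ?thesis
  proof (cases "even N")
    case True
    have "even (S2 - (\<Sum>d\<in>D. a d + b d))"
      unfolding S2_def sum_subtractf[symmetric]
    proof (intro dvd_sum)
      fix d assume "d \<in> D"
      then show "even ((a d + b d) * (c d + e d) - (a d + b d))"
        using deg[of d] True by auto
    qed
    moreover have "(\<Sum>d\<in>D. a d + b d) = 2 * (\<Sum>p\<in>C. fwd (i + 1) p)"
      using sum_cnt[of "\<lambda>_. 1"] sum_fwd[of "i + 1" "\<lambda>_. 1"] sum_bwd[of "i + 1" "\<lambda>_. 1"]
      by (simp add: a_def b_def sum.distrib)
    ultimately have "even S2" by simp
    moreover have "even H"
      unfolding H_eq
    proof (intro dvd_sum)
      fix d assume "d \<in> D"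
      then show "even (g d * (a d + b d + c d + e d))"
        using deg[of d] True by auto
    qed
    moreover have "4 dvd S1"
      unfolding S1_def
    proof (intro dvd_sum)
      fix d assume "d \<in> D"
      then have "even (a d + b d + c d + e d)" using deg[of d] True by simp
      then obtain t where "a d + b d + c d + e d = 2 * t" by (rule evenE)
      then show "4 dvd (a d + b d + c d + e d)\<^sup>2" by (simp add: power2_eq_square)
    qed
    ultimately have "even P" using eq S3_H by presburger
    then show ?thesis by (simp add: P_def a_def b_def c_def e_def)
  next
    case False
    \<comment> \<open>An odd degree splits into \<open>a d + b d\<close> and
      \<open>c d + e d\<close> of different parity, so their product is even.\<close>
    have "even S2"
      unfolding S2_def
    proof (intro dvd_sum)
      fix d assume "d \<in> D"
      then show "even ((a d + b d) * (c d + e d))"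
        using deg[of d] False by auto
    qed
    moreover have "even (H - (\<Sum>d\<in>D. g d))"
      unfolding H_eq sum_subtractf[symmetric]
    proof (intro dvd_sum)
      fix d assume "d \<in> D"
      then show "even (g d * (a d + b d + c d + e d) - g d)"
        using deg[of d] False by (auto simp: g_def)
    qed
    moreover have "4 dvd (S1 - int (card D))"
    proof -
      have "S1 - int (card D) = (\<Sum>d\<in>D. (a d + b d + c d + e d)\<^sup>2 - 1)"
        by (simp add: S1_def sum_subtractf)
      moreover have "4 dvd (a d + b d + c d + e d)\<^sup>2 - 1" if d: "d \<in> D" for d
      proof -
        have "odd (a d + b d + c d + e d)" using deg[OF d] False by simp
        then obtain t where "a d + b d + c d + e d = 2 * t + 1" by (rule oddE)
        then show ?thesis by (simp add: power2_eq_square algebra_simps)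
      qed
      ultimately show ?thesis by (simp add: dvd_sum)
    qed
    \<comment> \<open>A column of odd depth has one uncancelled colour, that of its bottom cube. The
      colours of a tiled region cancel, so \<open>D\<close> has equally many squares of both
      kinds.\<close>
    moreover have "int (card D) = 2 * (\<Sum>d\<in>D. g d)"
    proof -
      have "(\<Sum>p\<in>C. colour p) = (\<Sum>d\<in>D. colour (mk_pt i k (fst d) (snd d)) * (\<Sum>n<N. (- 1) ^ n))"
        unfolding C_def cyl_cells_sum by (simp add: colour_mk_pt sum_distrib_left
            sum_distrib_right mult_ac case_prod_beta)
      moreover have "colour (mk_pt i k u v) = (if even k then 1 else - 1) * (2 * g (u, v) - 1)"
          for u v
      proof -
        have "white p \<longleftrightarrow> even (p $ i + p $ (i + 1) + p $ (i + 2))" for p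
        proof -
          have *: "(4 :: 3) = 1" "(5 :: 3) = 2" by simp_all
          show ?thesis using exhaust_3[of i] by (auto simp: white_def *)
        qed
        then show ?thesis by (auto simp: colour_def g_def)
      qed
      ultimately have "(\<Sum>d\<in>D. (if even k then 1 else - 1) * (2 * g d - 1)) = 0"
        using sum_colour False by (simp add: sum_alternating)
      then have "(\<Sum>d\<in>D. 2 * g d - 1) = 0"
        by (simp flip: sum_distrib_left split: if_splits)
      then show ?thesis by (simp add: sum_subtractf sum_distrib_left)
    qed
    ultimately have "even P" using eq S3_H by presburger
    then show ?thesis by (simp add: P_def a_def b_def c_def e_def)
  qed
qed

lemma four_dvd_twist4: "4 dvd twist4 i M"
proof -
  let ?E = "fwd (i + 1)" and ?W = "bwd (i + 1)" and ?N = "fwd (i + 2)" and ?S = "bwd (i + 2)"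
  have "?E p * ?W p = 0" "?N p * ?S p = 0" if "p \<in> C" for p
    using cover_unique[OF that] by (auto simp: fwd_def bwd_def of_bool_def split: if_splits)
  from form_parity[of ?E ?W, OF this(1)] form_parity[of ?N ?S, OF this(2)]
  have "even (form ?E ?W + form ?N ?S -
      (\<Sum>d\<in>D. cnt ?E d * cnt ?W d + cnt ?N d * cnt ?S d))"
    unfolding column_sum by (simp add: cnt_def case_prod_beta sum.distrib)
  then have "even (form ?E ?W + form ?N ?S)"
    using even_column_products by simp
  then have main: "4 dvd (4 * form ?E ?N + 2 * form ?E ?W - 2 * form ?N ?S)"
    by presburger
  \<comment> \<open>Both cubes of a transverse domino have the same height, hence the same
    \<open>par\<close>, so two of the linear terms in \<open>twist4_expand\<close> cancel.\<close>
  have "(\<Sum>p\<in>C. ?E p * par p) = (\<Sum>p\<in>C. ?W p * par p)"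
    unfolding sum_fwd sum_bwd by (simp add: par_def ax_nth)
  then have "form ?E (\<lambda>_. 1) = form ?W (\<lambda>_. 1)"
    by (simp add: form_one)
  moreover have "even (form ?N (\<lambda>_. 1))"
  proof (cases "even N")
    case True
    have "even ((\<Sum>p\<in>C. ?N p * par p) - (\<Sum>p\<in>C. ?N p))"
      unfolding sum_subtractf[symmetric] by (intro dvd_sum) (simp add: par_def)
    then show ?thesis
      using even_transverse[OF True] True by (simp add: form_one)
  qed (simp add: form_one)
  ultimately have "4 dvd - twist4 i M"
    using main unfolding twist4_expand by presburger
  then show ?thesis by simp
qed

end

section \<open>From dominoes to lattice tilings\<close>

lemma mem_basic_cube: "x \<in> basic_cube p \<longleftrightarrow> (\<forall>i. of_int (p $ i) \<le> x $ i \<and> x $ i \<le> of_int (p $ i) + 1)"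
  by (auto simp: basic_cube_def mem_box_cart lattice_pt_def)

definition open_cube :: "int ^ 3 \<Rightarrow> (real ^ 3) set" where
  "open_cube p = box (lattice_pt p) (lattice_pt (p + 1))"

lemma mem_open_cube: "x \<in> open_cube p \<longleftrightarrow> (\<forall>i. of_int (p $ i) < x $ i \<and> x $ i < of_int (p $ i) + 1)"
  by (auto simp: open_cube_def mem_box_cart lattice_pt_def)

lemma open_open_cube: "open (open_cube p)"
  by (simp add: open_cube_def open_box)

lemma open_cube_subset: "open_cube p \<subseteq> basic_cube p"
  by (auto simp: mem_open_cube mem_basic_cube less_imp_le)

lemma cube_center_open_cube: "cube_center p \<in> open_cube p"
  by (simp add: mem_open_cube cube_center_def)

lemma closure_open_cube: "closure (open_cube p) = basic_cube p"
  unfolding open_cube_def basic_cube_def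
  by (rule closure_box) (use cube_center_open_cube[of p] in \<open>auto simp: open_cube_def\<close>)

lemma open_cube_basic_cube:
  assumes "x \<in> open_cube p" "x \<in> basic_cube q"
  shows "p = q"
  unfolding vec_eq_iff
proof
  fix i
  have "of_int (p $ i) < x $ i" "x $ i < of_int (p $ i) + 1" "of_int (q $ i) \<le> x $ i" "x $ i \<le>
      of_int (q $ i) + 1"
    using assms by (auto simp: mem_open_cube mem_basic_cube)
  then show "p $ i = q $ i" by linarith
qed

lemma cube_center_basic_cube: "cube_center p \<in> basic_cube q \<longleftrightarrow> p = q"
  using open_cube_basic_cube[OF cube_center_open_cube] open_cube_subset cube_center_open_cube by
      blast

definition cubes :: "(int ^ 3) set \<Rightarrow> (real ^ 3) set" where
  "cubes P = (\<Union>p\<in>P. basic_cube p)"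

lemma cube_center_cubes: "cube_center p \<in> cubes P \<longleftrightarrow> p \<in> P"
  by (auto simp: cubes_def cube_center_basic_cube)

lemma basic_cube_subset_cubes: "basic_cube p \<subseteq> cubes P \<longleftrightarrow> p \<in> P"
proof
  assume "basic_cube p \<subseteq> cubes P"
  then have "cube_center p \<in> cubes P"
    using cube_center_basic_cube[of p p] by blast
  then show "p \<in> P" by (simp add: cube_center_cubes)
qed (auto simp: cubes_def)

lemma cubes_subset_iff: "cubes P \<subseteq> cubes Q \<longleftrightarrow> P \<subseteq> Q"
proof
  assume "cubes P \<subseteq> cubes Q"
  then show "P \<subseteq> Q" using cube_center_cubes by blast
qed (auto simp: cubes_def)

lemma cubes_inj: "cubes P = cubes Q \<Longrightarrow> P = Q"
  using cubes_subset_iff by (metis subset_antisym subset_refl)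

lemma interior_cubes_disjoint:
  assumes "interior (cubes P) \<inter> interior (cubes Q) = {}"
  shows "P \<inter> Q = {}"
proof -
  have "cube_center p \<in> interior (cubes P)" if "p \<in> P" for p P
  proof -
    have "open_cube p \<subseteq> cubes P"
      using open_cube_subset[of p] that by (auto simp: cubes_def)
    then show ?thesis
      using interior_maximal[OF _ open_open_cube] cube_center_open_cube by blast
  qed
  then show ?thesis using assms by blast
qed

definition domino_of :: "(int ^ 3) \<times> 3 \<Rightarrow> (real ^ 3) set" where
  "domino_of m = cubes (edge m)"

lemma domino_of_pair: "domino_of (a, i) = basic_cube a \<union> basic_cube (a + ax i)"
  by (auto simp: domino_of_def cubes_def edge_def)

lemma domino_iff: "domino d \<longleftrightarrow> (\<exists>m. d = domino_of m)"
proof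
  assume "domino d"
  then obtain p q i where "d = basic_cube p \<union> basic_cube q" "q = p + ax i \<or> p = q + ax i"
    by (auto simp: domino_def share_face_def)
  then have "d = domino_of (p, i) \<or> d = domino_of (q, i)"
    by (auto simp: domino_of_pair)
  then show "\<exists>m. d = domino_of m" by blast
next
  assume "\<exists>m. d = domino_of m"
  then obtain a i where "d = domino_of (a, i)" by (metis surj_pair)
  then show "domino d"
    unfolding domino_def share_face_def domino_of_pair by blast
qed

lemma edge_inj: 
  assumes "edge m = edge m'"
  shows "m = m'"
proof -
  obtain a i b j where m: "m = (a, i)" "m' = (b, j)" by (metis surj_pair)
  have "a = b \<and> a + ax i = b + ax j \<or> a = b + ax j \<and> a + ax i = b"
    using assms by (simp add: m edge_def doubleton_eq_iff)
  then show ?thesis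
  proof
    assume "a = b + ax j \<and> a + ax i = b"
    then have "ax j + ax i = 0" by (metis add.assoc add_cancel_right_right)
    then show ?thesis by simp
  qed (auto simp: m)
qed

lemma inj_domino_of: "inj domino_of"
  by (rule injI) (auto simp: domino_of_def dest: cubes_inj edge_inj)

lemma white_add_ax: "white (a + ax i) \<longleftrightarrow> \<not> white a"
  using colour_add_ax[of a i] by (auto simp: colour_def split: if_splits)

lemma white_cube_domino_of: "white_cube (domino_of (a, i)) = (if white a then a else a + ax i)"
  unfolding white_cube_def domino_of_def basic_cube_subset_cubes
  by (rule the_equality) (auto simp: edge_def white_add_ax split: if_splits)

lemma black_cube_domino_of: "black_cube (domino_of (a, i)) = (if white a then a + ax i else a)"
  unfolding black_cube_def domino_of_def basic_cube_subset_cubes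
  by (rule the_equality) (auto simp: edge_def white_add_ax split: if_splits)

lemma domino_dir_domino_of: "domino_dir (domino_of (a, i)) = of_int (colour a) *\<^sub>R axis i 1"
  by (simp add: domino_dir_def white_cube_domino_of black_cube_domino_of cube_center_def
      colour_def vec_eq_iff axis_def)

definition codes :: "(real ^ 3) set set \<Rightarrow> ((int ^ 3) \<times> 3) set" where
  "codes t = {m. domino_of m \<in> t}"

text \<open>Disjoint interiors force disjoint sets of cubes, since each cube of a union has its
  centre in the interior; the centres also recover the set of cubes from its union.\<close>

lemma tiling_codes:
  assumes "tiling (cubes P) t"
  shows "lattice_tiling P (codes t)" and "t = domino_of ` codes t"
proof -
  have dominoes: "\<forall>d\<in>t. domino d" and disj: "pairwise (\<lambda>d d'. interior d \<inter> interior d' = {}) t"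
    and union: "\<Union> t = cubes P"
    using assms by (auto simp: tiling_def)
  show t: "t = domino_of ` codes t"
    using dominoes by (auto simp: codes_def domino_iff)
  have "edge m \<inter> edge m' = {}" if "m \<in> codes t" "m' \<in> codes t" "m \<noteq> m'" for m m'
  proof -
    have "domino_of m \<noteq> domino_of m'" using inj_domino_of that(3) by (auto dest: injD)
    then have "interior (domino_of m) \<inter> interior (domino_of m') = {}"
      using that disj by (auto simp: codes_def pairwise_def)
    then show ?thesis unfolding domino_of_def by (rule interior_cubes_disjoint)
  qed
  moreover have "cubes (\<Union>m\<in>codes t. edge m) = cubes P"
  proof -
    have "cubes (\<Union>m\<in>codes t. edge m) = (\<Union>m\<in>codes t. domino_of m)"
      by (auto simp: cubes_def domino_of_def)
    also have "\<dots> = cubes P" unfolding union[symmetric] by (subst (2) t) simp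
    finally show ?thesis .
  qed
  ultimately show "lattice_tiling P (codes t)"
    using cubes_inj by (auto simp: lattice_tiling_def disjoint_family_on_def)
qed

section \<open>Shades, effects and pretwists in lattice terms\<close>

definition above :: "3 \<Rightarrow> int ^ 3 \<Rightarrow> int ^ 3 \<Rightarrow> bool" where
  "above k p q \<longleftrightarrow> p $ k < q $ k \<and> (\<forall>j. j \<noteq> k \<longrightarrow> p $ j = q $ j)"

text \<open>The shade is open, so it meets a closed cube only if it meets its interior, and an
  interior point determines its cube. Conversely the whole open cube above \<open>p\<close> lies in
  the shade, as it is disjoint from the cubes of \<open>P\<close>.\<close>

lemma shade_cubes:
  assumes "P \<inter> Q = {}"
  shows "cubes Q \<inter> shade (axis k 1) (cubes P) \<noteq> {} \<longleftrightarrow> (\<exists>p\<in>P. \<exists>q\<in>Q. above k p q)"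
proof -
  define u :: "real ^ 3" where "u = axis k 1"
  define S where "S = {x + s *\<^sub>R u | x s. x \<in> cubes P \<and> s \<ge> 0} - cubes P"
  have shade: "shade u (cubes P) = interior S"
    by (simp add: shade_def S_def)
  have u_nth: "u $ j = (if j = k then 1 else 0)" for j
    by (simp add: u_def axis_def)
  show ?thesis
    unfolding u_def[symmetric]
  proof
    assume "cubes Q \<inter> shade u (cubes P) \<noteq> {}"
    then obtain x q where q: "q \<in> Q" "x \<in> basic_cube q" "x \<in> shade u (cubes P)"
      by (auto simp: cubes_def)
    then have "shade u (cubes P) \<inter> closure (open_cube q) \<noteq> {}"
      by (auto simp: closure_open_cube)
    then have "shade u (cubes P) \<inter> open_cube q \<noteq> {}"
      using open_Int_closure_eq_empty[of "shade u (cubes P)" "open_cube q"] by (simp add: shade)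
    then obtain y where y: "y \<in> open_cube q" "y \<in> S"
      using interior_subset[of S] by (auto simp: shade)
    then obtain z s p where z: "y = z + s *\<^sub>R u" "p \<in> P" "z \<in> basic_cube p" "s \<ge> 0" and yP: "y \<notin>
        cubes P"
      by (auto simp: S_def cubes_def)
    have coord: "p $ j = q $ j" if "j \<noteq> k" for j
    proof -
      have "y $ j = z $ j" using that by (simp add: z u_nth)
      then have "of_int (q $ j) < z $ j" "z $ j < of_int (q $ j) + 1"
        "of_int (p $ j) \<le> z $ j" "z $ j \<le> of_int (p $ j) + 1"
        using y(1) z(3) by (auto simp: mem_open_cube mem_basic_cube) metis+
      then show ?thesis by linarith
    qed
    have "y $ k = z $ k + s" by (simp add: z u_nth)
    moreover have "y $ k < of_int (q $ k) + 1" "of_int (p $ k) \<le> z $ k"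
      using y(1) z(3) by (auto simp: mem_open_cube mem_basic_cube)
    ultimately have "p $ k \<le> q $ k" using z(4) by linarith
    moreover have "p $ k \<noteq> q $ k"
    proof
      assume "p $ k = q $ k"
      then have "p = q" unfolding vec_eq_iff using coord by metis
      then have "y \<in> cubes P" using y(1) z(2) open_cube_subset by (auto simp: cubes_def)
      then show False using yP by simp
    qed
    ultimately have "above k p q" using coord by (simp add: above_def)
    then show "\<exists>p\<in>P. \<exists>q\<in>Q. above k p q"
      using z(2) q(1) by blast
  next
    assume "\<exists>p\<in>P. \<exists>q\<in>Q. above k p q"
    then obtain p q where pq: "p \<in> P" "q \<in> Q" "above k p q" by blast
    have "open_cube q \<subseteq> S"
    proof
      fix y assume y: "y \<in> open_cube q"
      define z where "z = y - of_int (q $ k - p $ k) *\<^sub>R u"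
      have "z \<in> basic_cube p"
        unfolding mem_basic_cube
      proof
        fix j
        have "of_int (q $ j) < y $ j" "y $ j < of_int (q $ j) + 1"
          using y by (auto simp: mem_open_cube)
        then show "of_int (p $ j) \<le> z $ j \<and> z $ j \<le> of_int (p $ j) + 1"
          using pq(3) by (cases "j = k") (auto simp: z_def u_nth above_def)
      qed
      then have "z \<in> cubes P" using pq(1) by (auto simp: cubes_def)
      moreover have "y = z + of_int (q $ k - p $ k) *\<^sub>R u" by (simp add: z_def)
      moreover have "of_int (q $ k - p $ k) \<ge> (0 :: real)" using pq(3) by (simp add: above_def)
      moreover have "y \<notin> cubes P"
      proof
        assume "y \<in> cubes P"
        then obtain p' where "p' \<in> P" "y \<in> basic_cube p'" by (auto simp: cubes_def)
        then show False using open_cube_basic_cube[OF y] assms pq(2) by auto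
      qed
      ultimately show "y \<in> S" unfolding S_def by blast
    qed
    then have "cube_center q \<in> interior S"
      using interior_maximal[OF _ open_open_cube] cube_center_open_cube by blast
    then show "cubes Q \<inter> shade u (cubes P) \<noteq> {}"
      using cube_center_cubes[of q Q] pq(2) by (auto simp: shade)
  qed
qed

lemma det3_axis: "det3 x y (axis k 1) = x $ (k + 1) * y $ (k + 2) - x $ (k + 2) * y $ (k + 1)"
proof -
  have *: "(4 :: 3) = 1" "(5 :: 3) = 2" by simp_all
  show ?thesis
    using exhaust_3[of k] by (auto simp: det3_def det_3 axis_def *)
qed

lemma effect_domino_of:
  assumes "edge (a, i) \<inter> edge (b, j) = {}"
  shows "effect (axis k 1) (domino_of (a, i)) (domino_of (b, j)) =
    (if \<exists>p\<in>edge (a, i). \<exists>q\<in>edge (b, j). above k p q then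
       (if j = k + 1 \<and> i = k + 2 then of_int (colour a * colour b) / 4
        else if j = k + 2 \<and> i = k + 1 then - of_int (colour a * colour b) / 4 else 0) else 0)"
  unfolding effect_def
  unfolding domino_of_def shade_cubes[OF assms]
  unfolding domino_of_def[symmetric] domino_dir_domino_of det3_axis
  by (auto simp: axis_def)

text \<open>At most one of the two orders has a nonzero effect, and the sign of the height
  difference \<open>z\<close> decides which: this supplies the third sign of the kernel. The
  transverse signs amount to minus the indicator that the projections overlap.\<close>

lemma effect_pair:
  assumes disj: "edge m \<inter> edge m' = {}" and dir: "snd m = k + 1" "snd m' = k + 2"
  shows "effect (axis k 1) (domino_of m) (domino_of m') + effect (axis k 1) (domino_of m')
      (domino_of m) =
    of_int (pairing (edge m) (edge m')) / 4"
proof -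
  define a b where "a = fst m" and "b = fst m'"
  have m: "m = (a, k + 1)" "m' = (b, k + 2)"
    using dir by (simp_all add: a_def b_def prod_eq_iff)
  define x y z where "x = b $ (k + 1) - a $ (k + 1)" and "y = b $ (k + 2) - a $ (k + 2)"
    and "z = b $ k - a $ k"
  have cr: "pairing (edge m) (edge m') =
      colour a * colour b * sgn z * (sgn x * sgn y - sgn x * sgn (y + 1) - sgn (x - 1) * sgn y +
          sgn (x - 1) * sgn (y + 1))"
    by (simp add: m pairing_def edge_sum sgn3_distinct[of k "k + 1" "k + 2"] ax_nth x_def y_def
        z_def algebra_simps)
  have S: "sgn x * sgn y - sgn x * sgn (y + 1) - sgn (x - 1) * sgn y + sgn (x - 1) * sgn (y + 1) =
       (if (x = 0 \<or> x = 1) \<and> (y = 0 \<or> y = - 1) then - 1 else 0)"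
    by (auto simp: sgn_if)
  have above: "above k p q \<longleftrightarrow> p $ k < q $ k \<and> p $ (k + 1) = q $ (k + 1) \<and> p $ (k + 2) = q $ (k +
      2)" for p q
    unfolding above_def using exhaust_3_rot[of _ k] by (metis rot_3(5,6))
  have ab1: "(\<exists>p\<in>edge m. \<exists>q\<in>edge m'. above k p q) \<longleftrightarrow> (x = 0 \<or> x = 1) \<and> (y = 0 \<or> y = - 1) \<and> z > 0"
    unfolding above by (auto simp: m edge_def ax_nth x_def y_def z_def)
  have ab2: "(\<exists>p\<in>edge m'. \<exists>q\<in>edge m. above k p q) \<longleftrightarrow> (x = 0 \<or> x = 1) \<and> (y = 0 \<or> y = - 1) \<and> z < 0"
    unfolding above by (auto simp: m edge_def ax_nth x_def y_def z_def)
  have disj': "edge m' \<inter> edge m = {}" using disj by blast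
  show ?thesis
    unfolding m effect_domino_of[OF disj[unfolded m]] effect_domino_of[OF disj'[unfolded m]]
    unfolding m[symmetric] cr S ab1 ab2
    by (auto simp: sgn_if)
qed

lemma effect_zero:
  assumes "edge m \<inter> edge m' = {}"
    and "\<not> (snd m = k + 1 \<and> snd m' = k + 2)" "\<not> (snd m = k + 2 \<and> snd m' = k + 1)"
  shows "effect (axis k 1) (domino_of m) (domino_of m') = 0"
proof -
  obtain a i b j where m: "m = (a, i)" "m' = (b, j)" by (metis surj_pair)
  show ?thesis using assms unfolding m by (auto simp: effect_domino_of)
qed

lemma effect_self: "effect (axis k 1) (domino_of m) (domino_of m) = 0"
proof -
  obtain a i where m: "m = (a, i)" by (metis surj_pair)
  show ?thesis by (simp add: m effect_def domino_dir_domino_of det3_axis)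
qed

text \<open>The determinant vanishes unless the two directions are \<open>k + 1\<close> and
  \<open>k + 2\<close>, so the ordered pairs combine to the unordered ones of
  \<open>effect_pair\<close>.\<close>

lemma pretwist_codes:
  assumes M: "lattice_tiling P M" and P: "finite P"
  shows "pretwist (axis k 1) (domino_of ` M) = of_int (twist4 k M) / 4"
proof -
  let ?e = "\<lambda>m m'. effect (axis k 1) (domino_of m) (domino_of m')"
  let ?X = "{m\<in>M. snd m = k + 1}" and ?Y = "{m\<in>M. snd m = k + 2}"
  have finM: "finite M" using lattice_tiling_finite[OF M P] .
  have disj: "edge m \<inter> edge m' = {}" if "m \<in> M" "m' \<in> M" "m \<noteq> m'" for m m'
    using M that by (auto simp: lattice_tiling_def disjoint_family_on_def)
  have inj: "inj_on domino_of M" using inj_domino_of by (rule inj_on_subset) simp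
  have "pretwist (axis k 1) (domino_of ` M) = (\<Sum>m\<in>M. \<Sum>m'\<in>M. ?e m m')"
    unfolding pretwist_def sum.cartesian_product[symmetric] by (simp add: sum.reindex[OF inj])
  also have "\<dots> = (\<Sum>m\<in>M. \<Sum>m'\<in>M. (if snd m = k + 1 then if snd m' = k + 2 then ?e m m' else 0 else
      0) +
      (if snd m = k + 2 then if snd m' = k + 1 then ?e m m' else 0 else 0))"
  proof (intro sum.cong refl)
    fix m m' assume "m \<in> M" "m' \<in> M"
    then show "?e m m' = (if snd m = k + 1 then if snd m' = k + 2 then ?e m m' else 0 else 0) +
      (if snd m = k + 2 then if snd m' = k + 1 then ?e m m' else 0 else 0)"
      using effect_zero[OF disj, of m m' k] effect_self[of k m] by (cases "m = m'") auto
  qed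
  also have "\<dots> = (\<Sum>m\<in>?X. \<Sum>m'\<in>?Y. ?e m m') + (\<Sum>m\<in>?Y. \<Sum>m'\<in>?X. ?e m m')"
  proof -
    have pull: "(\<Sum>m'\<in>M. if c then g m' else 0) = (if c then \<Sum>m'\<in>M. g m' else 0)" for c and g :: "_
        \<Rightarrow> real"
      by simp
    show ?thesis unfolding sum.distrib pull sum.inter_filter[OF finM] ..
  qed
  also have "\<dots> = (\<Sum>m\<in>?X. \<Sum>m'\<in>?Y. ?e m m' + ?e m' m)"
    by (subst (2) sum.swap) (simp add: sum.distrib)
  also have "\<dots> = (\<Sum>m\<in>?X. \<Sum>m'\<in>?Y. of_int (pairing (edge m) (edge m')) / 4)"
  proof (intro sum.cong refl)
    fix m m' assume "m \<in> ?X" "m' \<in> ?Y"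
    then show "?e m m' + ?e m' m = of_int (pairing (edge m) (edge m')) / 4"
      by (intro effect_pair disj) auto
  qed
  also have "\<dots> = of_int (twist4 k M) / 4"
    unfolding twist4_def pairing_dir_cells_left[OF M P] pairing_dir_cells_right[OF M P]
    by (subst sum.swap) (simp add: sum_divide_distrib)
  finally show ?thesis .
qed

lemma twist_codes:
  assumes M: "lattice_tiling P M" and P: "finite P" and eq: "\<And>j. twist4 j M = T"
  shows "twist (domino_of ` M) = of_int T / 4"
  unfolding twist_def pretwist_codes[OF M P] eq by (rule the_equality) auto

section \<open>Cylinders as sets of lattice cubes\<close>

lemma cylinder_cells:
  assumes "planar_region i k D" "simply_connected D"
  obtains B where "finite B" "planar_exact B" "\<And>N. N > 0 \<Longrightarrow> extrude D N (axis i 1) = cubes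
      (cyl_cells i k B N)"
proof -
  obtain S where S: "finite S" "\<And>p. p \<in> S \<Longrightarrow> p $ i = k"
    and D: "D = (\<Union>p\<in>S. cbox (lattice_pt p) (lattice_pt (p + 1 - axis i 1)))"
    using assms(1) by (auto simp: planar_region_def)
  define B where "B = (\<lambda>p. (p $ (i + 1), p $ (i + 2))) ` S"
  define f where "f = (\<lambda>x :: real ^ 3. Complex (x $ (i + 1)) (x $ (i + 2)))"
  define g where "g = (\<lambda>z. (\<chi> j. if j = i then of_int k else if j = i + 1 then Re z else Im z) ::
      real ^ 3)"
  have all3: "(\<forall>j. Q j) \<longleftrightarrow> Q i \<and> Q (i + 1) \<and> Q (i + 2)" for Q :: "3 \<Rightarrow> bool"
    using exhaust_3_rot[of _ i] by metis
  have mem_D: "x \<in> D \<longleftrightarrow> x $ i = of_int k \<and> f x \<in> (\<Union>d\<in>B. unit_square d)" for x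
    using S(2) by (auto simp: D B_def f_def mem_box_cart lattice_pt_def all3 axis_def
        mem_unit_square)
  have gf: "g (f x) = x" if "x $ i = of_int k" for x
    by (rule vec_3_eqI[of _ i]) (use that in \<open>simp_all add: g_def f_def\<close>)
  have fg: "f (g z) = z" "g z $ i = of_int k" for z
    by (simp_all add: g_def f_def complex_eq_iff)
  \<comment> \<open>Forgetting the constant coordinate identifies the base with a union of unit
    squares in the complex plane, where winding numbers test simple connectedness.\<close>
  have "homeomorphism D (\<Union>d\<in>B. unit_square d) f g"
  proof (rule homeomorphismI)
    show "continuous_on D f"
      unfolding f_def Complex_eq by (intro continuous_intros)
    show "continuous_on (\<Union>d\<in>B. unit_square d) g"
      unfolding g_def
    proof (intro continuous_on_vec_lambda)
      fix j
      show "continuous_on (\<Union>d\<in>B. unit_square d) (\<lambda>z. if j = i then of_int k else if j = i + 1 then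
          Re z else Im z)"
        by (cases "j = i"; cases "j = i + 1") (simp_all add: continuous_intros)
    qed
  qed (use fg gf mem_D in auto)
  then have "simply_connected (\<Union>d\<in>B. unit_square d)"
    using homeomorphic_simply_connected assms(2) homeomorphic_def by blast
  moreover have finB: "finite B" using S(1) by (simp add: B_def)
  ultimately have "planar_exact B"
    using winds_around_none_imp_planar_exact simply_connected_imp_winds_around_none by blast
  moreover have "extrude D N (axis i 1) = cubes (cyl_cells i k B N)" if N: "N > 0" for N
  proof (intro equalityI subsetI)
    fix x assume "x \<in> extrude D N (axis i 1)"
    then obtain y s where y: "y \<in> D" "s \<in> {0..real N}" and x: "x = y + s *\<^sub>R axis i 1"
      by (auto simp: extrude_def)
    obtain d where d: "d \<in> B" "f y \<in> unit_square d"
      using y(1) mem_D by auto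
    \<comment> \<open>The layer that contains height \<open>s\<close>; the top face
      \<open>s = real N\<close> belongs to the last layer \<open>N - 1\<close>.\<close>
    define h where "h = (if s = real N then N - 1 else nat \<lfloor>s\<rfloor>)"
    have h: "h < N" "real h \<le> s" "s \<le> real h + 1"
    proof -
      show "h < N"
      proof (cases "s = real N")
        case False
        then have "\<lfloor>s\<rfloor> < int N" using y(2) by (auto simp: floor_less_iff)
        then show ?thesis using N False by (simp add: h_def)
      qed (use N in \<open>simp add: h_def\<close>)
      show "real h \<le> s" using y(2) N by (auto simp: h_def)
      show "s \<le> real h + 1"
      proof (cases "s = real N")
        case False
        have "s \<le> of_int \<lfloor>s\<rfloor> + 1" by linarith
        moreover have "0 \<le> \<lfloor>s\<rfloor>" using y(2) by simp
        ultimately show ?thesis using False by (simp add: h_def)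
      qed (use N in \<open>simp add: h_def of_nat_diff\<close>)
    qed
    have "x \<in> basic_cube (mk_pt i (k + int h) (fst d) (snd d))"
      using d(2) h y(1) mem_D[of y] by (simp add: mem_basic_cube all3 x axis_def f_def
          mem_unit_square)
    moreover have "mk_pt i (k + int h) (fst d) (snd d) \<in> cyl_cells i k B N"
      using d(1) h(1) by (simp add: mk_pt_mem_cyl_cells)
    ultimately show "x \<in> cubes (cyl_cells i k B N)" by (auto simp: cubes_def)
  next
    fix x assume "x \<in> cubes (cyl_cells i k B N)"
    then obtain q where q: "q \<in> cyl_cells i k B N" "x \<in> basic_cube q" by (auto simp: cubes_def)
    define s where "s = x $ i - of_int k"
    define y where "y = g (f x)"
    have "f x \<in> unit_square (q $ (i + 1), q $ (i + 2))"
      using q(2) by (simp add: mem_basic_cube all3 f_def mem_unit_square)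
    then have "y \<in> D" using q(1) unfolding mem_D by (auto simp: y_def fg cyl_cells_def)
    moreover have "s \<in> {0..real N}"
    proof -
      have "k \<le> q $ i" "q $ i + 1 \<le> k + int N" using q(1) by (auto simp: cyl_cells_def)
      then have "real_of_int k \<le> q $ i" "real_of_int (q $ i) + 1 \<le> k + real N" by linarith+
      then show ?thesis using q(2) by (simp add: s_def mem_basic_cube all3)
    qed
    moreover have "x = y + s *\<^sub>R axis i 1"
      by (rule vec_3_eqI[of _ i]) (simp_all add: y_def g_def f_def s_def axis_def)
    ultimately show "x \<in> extrude D N (axis i 1)" unfolding extrude_def by blast
  qed
  ultimately show ?thesis by (intro that[OF finB])
qed

section \<open>Flips and trits\<close>

lemma mem_square:
  assumes "i \<noteq> j"
  shows "c \<in> square p i j \<longleftrightarrow> (\<forall>l. p $ l \<le> c $ l \<and> c $ l \<le> p $ l + ax i $ l + ax j $ l)"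
proof
  assume "c \<in> square p i j"
  then show "\<forall>l. p $ l \<le> c $ l \<and> c $ l \<le> p $ l + ax i $ l + ax j $ l"
    using assms by (auto simp: square_def ax_nth)
next
  assume *: "\<forall>l. p $ l \<le> c $ l \<and> c $ l \<le> p $ l + ax i $ l + ax j $ l"
  have "c = p + (if c $ i = p $ i then 0 else ax i) + (if c $ j = p $ j then 0 else ax j)"
    unfolding vec_eq_iff
  proof
    fix l
    have "p $ l \<le> c $ l \<and> c $ l \<le> p $ l + ax i $ l + ax j $ l" using * by blast
    then show "c $ l = (p + (if c $ i = p $ i then 0 else ax i) + (if c $ j = p $ j then 0 else ax
        j)) $ l"
      using assms by (cases "l = i"; cases "l = j") (auto simp: ax_nth)
  qed
  then show "c \<in> square p i j"
    unfolding square_def by (auto split: if_splits)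
qed

lemma edge_subset_square:
  assumes ij: "i \<noteq> j" and sub: "edge (a, q) \<subseteq> square p i j"
  shows "q = i \<and> (a = p \<or> a = p + ax j) \<or> q = j \<and> (a = p \<or> a = p + ax i)"
proof -
  have a: "a \<in> square p i j" "a + ax q \<in> square p i j"
    using sub by (auto simp: edge_def)
  have "p $ q \<le> a $ q" "a $ q + 1 \<le> p $ q + ax i $ q + ax j $ q"
    using a unfolding mem_square[OF ij] by (auto simp: ax_nth dest: spec[of _ q])
  then have q: "q = i \<or> q = j" "a $ q = p $ q"
    using ij by (auto simp: ax_nth split: if_splits)
  show ?thesis
    using a(1) q ij by (auto simp: square_def ax_nth)
qed

text \<open>One domino along \<open>j\<close> covers \<open>p\<close> or \<open>p + ax i\<close> and
  so excludes the \<open>i\<close>-domino joining them. Both are then covered along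
  \<open>j\<close>, which fills the square.\<close>

lemma square_tiling_dir_cells:
  assumes ij: "i \<noteq> j" and n: "lattice_tiling (square p i j) n"
  shows "dir_cells j n = {} \<or> dir_cells j n = square p i j"
proof -
  have sub: "edge m \<subseteq> square p i j" if "m \<in> n" for m
    using n that by (auto simp: lattice_tiling_def)
  have cover: "\<exists>m\<in>n. c \<in> edge m" if "c \<in> square p i j" for c
    using n that by (auto simp: lattice_tiling_def)
  have step: "(p, j) \<in> n \<and> (p + ax i, j) \<in> n" if "(a, j) \<in> n" for a
  proof -
    have a: "a = p \<or> a = p + ax i"
      using edge_subset_square[OF ij sub[OF that]] ij by auto
    have no: "(p, i) \<notin> n"
    proof
      assume "(p, i) \<in> n"
      moreover have "a \<in> edge (a, j)" "a \<in> edge (p, i)" using a by (auto simp: edge_def)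
      ultimately have "(a, j) = (p, i)" using lattice_tiling_eqI[OF n that] by blast
      then show False using ij by simp
    qed
    have "(c, j) \<in> n" if c: "c = p \<or> c = p + ax i" for c
    proof -
      obtain b q where b: "(b, q) \<in> n" "c \<in> edge (b, q)"
        using cover[of c] c by (auto simp: square_def)
      have "q = i \<and> (b = p \<or> b = p + ax j) \<or> q = j \<and> (b = p \<or> b = p + ax i)"
        by (rule edge_subset_square[OF ij sub[OF b(1)]])
      moreover have "b $ j = p $ j"
      proof (rule ccontr)
        assume "b $ j \<noteq> p $ j"
        then have "q = i \<and> b = p + ax j" using calculation ij by (auto simp: ax_nth)
        then have "c $ j = p $ j + 1" using b(2) ij by (auto simp: edge_def ax_nth)
        then show False using c ij by (auto simp: ax_nth)
      qed
      ultimately have "q = j \<and> (b = p \<or> b = p + ax i)"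
        using no b(1) by (auto simp: ax_nth)
      moreover from this have "c \<noteq> b + ax j"
        using c ij by (auto simp: ax_nth dest: arg_cong[where f = "\<lambda>x. x $ j"])
      ultimately have "q = j" "b = c"
        using b(2) by (auto simp: edge_def)
      then show ?thesis using b(1) by simp
    qed
    then show ?thesis by blast
  qed
  show ?thesis
  proof (cases "\<exists>a. (a, j) \<in> n")
    case True
    then have "(p, j) \<in> n" "(p + ax i, j) \<in> n" using step by blast+
    then have "edge (p, j) \<union> edge (p + ax i, j) \<subseteq> dir_cells j n"
      unfolding dir_cells_def by auto
    then have "square p i j \<subseteq> dir_cells j n"
      by (auto simp: edge_def square_def)
    then show ?thesis using dir_cells_subset[OF n, of j] by blast
  qed (auto simp: dir_cells_def)
qed

lemma dir_cells_Diff: "lattice_tiling C M \<Longrightarrow> m \<subseteq> M \<Longrightarrow> dir_cells i (M - m) = dir_cells i M -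
    dir_cells i m"
  unfolding dir_cells_def by (fastforce dest: lattice_tiling_eqI)

text \<open>The pretwist along \<open>i\<close>, a direction of the square, involves its other
  direction \<open>j\<close> and the normal \<open>l\<close>. The flip leaves the class of
  \<open>l\<close> alone, and what it removes from or adds to the class of \<open>j\<close> is empty
  or the whole square, which pairs to 0 with the class of \<open>l\<close>. The other pretwists
  follow by \<open>twist4_cylinder_eq\<close>.\<close>

lemma twist4_flip:
  assumes D: "planar_exact D" "finite D" and C: "C = cyl_cells a k D N"
    and M0: "lattice_tiling C M0" and M1: "lattice_tiling C ((M0 - m) \<union> m')"
    and ij: "i \<noteq> j" and sub: "m \<subseteq> M0" and m: "lattice_tiling (square p i j) m" and m':
        "lattice_tiling (square p i j) m'"
  shows "twist4 r ((M0 - m) \<union> m') = twist4 r M0"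
proof -
  let ?M1 = "(M0 - m) \<union> m'" and ?Q = "square p i j"
  have finC: "finite C" using finite_cyl_cells[OF D(2)] by (simp add: C)
  have fin: "finite (dir_cells q M)" if "lattice_tiling C M" for q M
    by (rule finite_subset[OF dir_cells_subset[OF that] finC])
  obtain l where l: "j \<noteq> l" "i \<noteq> l" using exists_third_index by blast
  have cover: "\<exists>e\<in>m. c \<in> edge e" if "c \<in> ?Q" for c
    using m that unfolding lattice_tiling_def by blast
  have no_l: "dir_cells l n = {}" if n: "lattice_tiling ?Q n" for n
  proof -
    have "q \<noteq> l" if "(b, q) \<in> n" for b q
      using edge_subset_square[OF ij, of b q p] n that l by (auto simp: lattice_tiling_def)
    then show ?thesis by (auto simp: dir_cells_def)
  qed
  have covl: "dir_cells l ?M1 = dir_cells l M0"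
    using no_l[OF m] no_l[OF m'] by (simp add: dir_cells_Un dir_cells_Diff[OF M0 sub])
  have Q_l: "?Q \<inter> dir_cells l M0 = {}"
  proof -
    have "?Q \<inter> edge e = {}" if e: "e \<in> M0" "snd e = l" for e
    proof -
      have "e \<notin> m"
      proof
        assume "e \<in> m"
        then have "fst e \<in> dir_cells l m" using e(2) by (force simp: dir_cells_def edge_def)
        then show False using no_l[OF m] by simp
      qed
      moreover have "e \<in> m" if c: "c \<in> ?Q" "c \<in> edge e" for c
      proof -
        obtain e' where e': "e' \<in> m" "c \<in> edge e'" using cover[OF c(1)] by blast
        then have "e = e'" using lattice_tiling_eqI[OF M0 e(1) _ c(2)] sub by blast
        then show ?thesis using e'(1) by simp
      qed
      ultimately show ?thesis by blast
    qed
    then show ?thesis by (auto simp: dir_cells_def)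
  qed
  have cr0: "pairing (dir_cells j n) (dir_cells l M0) = 0" if "lattice_tiling ?Q n" for n
    using square_tiling_dir_cells[OF ij that] pairing_square_dir_cells[OF M0 finC ij l Q_l] by auto
  have "pairing (dir_cells j ?M1) (dir_cells l M0) = pairing (dir_cells j M0) (dir_cells l M0)"
  proof -
    have sub_j: "dir_cells j m \<subseteq> dir_cells j M0" using sub by (auto simp: dir_cells_def)
    have "(dir_cells j M0 - dir_cells j m) \<inter> dir_cells j m' = {}"
    proof -
      have "c \<notin> dir_cells j m'" if c: "c \<in> dir_cells j M0" "c \<notin> dir_cells j m" for c
      proof
        assume "c \<in> dir_cells j m'"
        then have "c \<in> ?Q" using dir_cells_subset[OF m'] by blast
        then obtain e where e: "e \<in> m" "c \<in> edge e" using cover by blast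
        obtain e' where e': "e' \<in> M0" "snd e' = j" "c \<in> edge e'" using c(1) by (auto simp:
            dir_cells_def)
        have "e = e'" using lattice_tiling_eqI[OF M0 _ e'(1) e(2) e'(3)] e(1) sub by blast
        then have "c \<in> dir_cells j m" unfolding dir_cells_def using e e'(2) by blast
        then show False using c(2) by simp
      qed
      then show ?thesis by blast
    qed
    moreover have "finite (dir_cells j m')"
      by (rule finite_subset[OF dir_cells_subset[OF m']]) simp
    ultimately show ?thesis
      using fin[OF M0] cr0[OF m] cr0[OF m'] sub_j
      by (simp add: dir_cells_Un dir_cells_Diff[OF M0 sub] pairing_Un_left pairing_Diff_left)
  qed
  then have eq: "pairing (dir_cells j ?M1) (dir_cells l ?M1) = pairing (dir_cells j M0) (dir_cells
      l M0)"
    by (simp add: covl)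
  have "twist4 i ?M1 = twist4 i M0"
  proof -
    have "j = i + 1 \<and> l = i + 2 \<or> j = i + 2 \<and> l = i + 1"
      using exhaust_3_rot[of j i] exhaust_3_rot[of l i] ij l by auto
    then show ?thesis
    proof
      assume "j = i + 2 \<and> l = i + 1"
      then show ?thesis
        using eq pairing_swap[of "dir_cells j ?M1" "dir_cells l ?M1"] pairing_swap[of "dir_cells j
            M0" "dir_cells l M0"]
        by (simp add: twist4_def)
    qed (use eq in \<open>simp add: twist4_def\<close>)
  qed
  then show ?thesis
    using twist4_cylinder_eq[OF D C M0, of r i] twist4_cylinder_eq[OF D C M1, of r i] by simp
qed

lemma cubes_square:
  assumes ij: "i \<noteq> j"
  shows "cbox (lattice_pt p) (lattice_pt (p + 1 + axis i 1 + axis j 1)) = cubes (square p i j)"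
proof (intro equalityI subsetI)
  fix x assume "x \<in> cbox (lattice_pt p) (lattice_pt (p + 1 + axis i 1 + axis j 1))"
  then have x: "of_int (p $ l) \<le> x $ l \<and> x $ l \<le> of_int (p $ l) + 1 + of_int (ax i $ l) + of_int
      (ax j $ l)" for l
    by (auto simp: mem_box_cart lattice_pt_def)
  define c where "c = (\<chi> l. if ax i $ l + ax j $ l = 1 \<and> x $ l \<ge> of_int (p $ l) + 1 then p $ l + 1
      else p $ l)"
  have "c \<in> square p i j"
    unfolding mem_square[OF ij] by (auto simp: c_def ax_nth)
  moreover have "x \<in> basic_cube c"
    unfolding mem_basic_cube
  proof
    fix l
    show "of_int (c $ l) \<le> x $ l \<and> x $ l \<le> of_int (c $ l) + 1"
      using x[of l] ij by (auto simp: c_def ax_nth split: if_splits)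
  qed
  ultimately show "x \<in> cubes (square p i j)" by (auto simp: cubes_def)
next
  fix x assume "x \<in> cubes (square p i j)"
  then obtain c where c: "c \<in> square p i j" "x \<in> basic_cube c" by (auto simp: cubes_def)
  have "of_int (p $ l) \<le> x $ l \<and> x $ l \<le> of_int (p $ l) + 1 + of_int (ax i $ l) + of_int (ax j $
      l)" for l
  proof -
    have "p $ l \<le> c $ l" "c $ l \<le> p $ l + ax i $ l + ax j $ l"
      using c(1) unfolding mem_square[OF ij] by auto
    then have "real_of_int (p $ l) \<le> c $ l" "real_of_int (c $ l) \<le> p $ l + ax i $ l + ax j $ l"
      by linarith+
    moreover have "of_int (c $ l) \<le> x $ l" "x $ l \<le> of_int (c $ l) + 1"
      using c(2) unfolding mem_basic_cube by auto
    ultimately show ?thesis by auto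
  qed
  then show "x \<in> cbox (lattice_pt p) (lattice_pt (p + 1 + axis i 1 + axis j 1))"
    by (simp add: mem_box_cart lattice_pt_def)
qed

section \<open>A box seen from a corner, and the hexagon of a trit\<close>

lemma colour_parity: "colour p = (if even (p $ k + p $ (k + 1) + p $ (k + 2)) then 1 else - 1)"
proof -
  have *: "(4 :: 3) = 1" "(5 :: 3) = 2" by simp_all
  show ?thesis using exhaust_3[of k] by (auto simp: colour_def white_def *)
qed

text \<open>Coordinates relative to a corner cube \<open>h\<close> of a \<open>2 \<times> 2 \<times> 2\<close> box; \<open>\<eta>\<close> points into the box.\<close>

locale corner =
  fixes h :: "int ^ 3" and k :: 3 and \<eta> :: "3 \<Rightarrow> int"
  assumes eta: "\<eta> j = 1 \<or> \<eta> j = - 1"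
begin

definition R :: "int \<Rightarrow> int \<Rightarrow> int \<Rightarrow> int ^ 3" where
  "R s t w = mk_pt k (h $ k + w * \<eta> k) (h $ (k + 1) + s * \<eta> (k + 1)) (h $ (k + 2) + t * \<eta> (k + 2))"

text \<open>The orientation of the frame at the corner; \<open>trit_sign_beta\<close> and
  \<open>trit_sign_alpha\<close> identify it with the sign of the trit.\<close>

definition sg :: int where
  "sg = \<eta> k * \<eta> (k + 1) * \<eta> (k + 2)"

lemma R_eq_iff [simp]: "R s t w = R s' t' w' \<longleftrightarrow> s = s' \<and> t = t' \<and> w = w'"
  using eta[of k] eta[of "k + 1"] eta[of "k + 2"] by (auto simp: R_def mk_pt_eq_iff)

lemma R_0 [simp]: "R 0 0 0 = h"
  by (simp add: R_def)

lemma R_eq_h [simp]: "R s t w = h \<longleftrightarrow> s = 0 \<and> t = 0 \<and> w = 0" "h = R s t w \<longleftrightarrow> s = 0 \<and> t = 0 \<and> w = 0"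
  using R_eq_iff[of s t w 0 0 0] R_eq_iff[of 0 0 0 s t w] by auto

lemma eta_sq [simp]: "\<eta> j * \<eta> j = 1"
  using eta[of j] by auto

lemma R_add:
  "R s t w + ax k = R s t (w + \<eta> k)"
  "R s t w + ax (k + 1) = R (s + \<eta> (k + 1)) t w"
  "R s t w + ax (k + 2) = R s (t + \<eta> (k + 2)) w"
  by (simp_all add: R_def mk_pt_add mk_pt_eq_iff distrib_right)

lemma colour_R: "colour (R s t w) = colour h * (if even (s + t + w) then 1 else - 1)"
proof -
  have "even (x * \<eta> j) \<longleftrightarrow> even x" for x j
    using eta[of j] by auto
  then show ?thesis
    unfolding colour_parity[of _ k] by (auto simp: R_def)
qed

lemma sgn3_R: "sgn3 (R s t w - R s' t' w') = sg * (sgn (s - s') * sgn (t - t') * sgn (w - w'))"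
proof -
  have "sgn (c + x * \<eta> j - (c + x' * \<eta> j)) = \<eta> j * sgn (x - x')" for c x x' j
    using eta[of j] by (auto simp: sgn_if)
  then show ?thesis
    by (simp add: sgn3_distinct[of k "k + 1" "k + 2"] R_def sg_def)
qed

lemma colour_mult_left [simp]: "colour p * (colour p * z) = z"
  by (simp flip: mult.assoc)

text \<open>A code starts at the lower cube of its domino, and this is the one at relative
  coordinate 1 when the frame is reversed in that direction.\<close>

definition ex :: "int \<Rightarrow> int \<Rightarrow> (int ^ 3) \<times> 3" where
  "ex t w = (if \<eta> (k + 1) = 1 then R 0 t w else R 1 t w, k + 1)"

definition ey :: "int \<Rightarrow> int \<Rightarrow> (int ^ 3) \<times> 3" where
  "ey s w = (if \<eta> (k + 2) = 1 then R s 0 w else R s 1 w, k + 2)"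

definition ek :: "int \<Rightarrow> int \<Rightarrow> (int ^ 3) \<times> 3" where
  "ek s t = (if \<eta> k = 1 then R s t 0 else R s t 1, k)"

lemma edge_ex [simp]: "edge (ex t w) = {R 0 t w, R 1 t w}"
  using eta[of "k + 1"] by (auto simp: ex_def edge_def R_add)

lemma edge_ey [simp]: "edge (ey s w) = {R s 0 w, R s 1 w}"
  using eta[of "k + 2"] by (auto simp: ey_def edge_def R_add)

lemma edge_ek [simp]: "edge (ek s t) = {R s t 0, R s t 1}"
  using eta[of k] by (auto simp: ek_def edge_def R_add)

lemma snd_e [simp]: "snd (ex t w) = k + 1" "snd (ey s w) = k + 2" "snd (ek s t) = k"
  by (simp_all add: ex_def ey_def ek_def)

definition six :: "(int ^ 3) set" where
  "six = {R 1 0 0, R 0 1 0, R 0 0 1, R 1 1 0, R 1 0 1, R 0 1 1}"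

definition box8 :: "(int ^ 3) set" where
  "box8 = {h, R 1 1 1} \<union> six"

lemma box8_iff: "c \<in> box8 \<longleftrightarrow> (\<exists>s\<in>{0, 1}. \<exists>t\<in>{0, 1}. \<exists>w\<in>{0, 1}. c = R s t w)"
  by (auto simp: box8_def six_def)

lemma edge_in_box8:
  assumes "edge m \<subseteq> box8"
  shows "(\<exists>t\<in>{0, 1}. \<exists>w\<in>{0, 1}. m = ex t w) \<or> (\<exists>s\<in>{0, 1}. \<exists>w\<in>{0, 1}. m = ey s w)
    \<or> (\<exists>s\<in>{0, 1}. \<exists>t\<in>{0, 1}. m = ek s t)"
proof -
  obtain a j where m: "m = (a, j)" by (metis surj_pair)
  have in_box: "a \<in> box8" "a + ax j \<in> box8"
    using assms by (simp_all add: m edge_def)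
  obtain s t w where a: "a = R s t w" and stw: "s \<in> {0, 1}" "t \<in> {0, 1}" "w \<in> {0, 1}"
    using in_box(1) unfolding box8_iff by blast
  obtain s' t' w' where a': "a + ax j = R s' t' w'" and stw': "s' \<in> {0, 1}" "t' \<in> {0, 1}" "w' \<in>
      {0, 1}"
    using in_box(2) unfolding box8_iff by blast
  consider "j = k" | "j = k + 1" | "j = k + 2"
    using exhaust_3_rot by blast
  then show ?thesis
  proof cases
    case 1
    then have "m = ek s t"
      using a a' stw stw' eta[of k] by (auto simp: m ek_def R_add)
    then show ?thesis using stw by blast
  next
    case 2
    then have "m = ex t w"
      using a a' stw stw' eta[of "k + 1"] by (auto simp: m ex_def R_add)
    then show ?thesis using stw by blast
  next
    case 3
    then have "m = ey s w"
      using a a' stw stw' eta[of "k + 2"] by (auto simp: m ey_def R_add)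
    then show ?thesis using stw by blast
  qed
qed

text \<open>\<open>six\<close> is a cycle of six cubes in which neighbours share a face;
  \<open>alpha\<close> and \<open>beta\<close> are its two perfect matchings, each with one domino
  per direction.\<close>

definition alpha :: "((int ^ 3) \<times> 3) set" where
  "alpha = {ex 1 0, ey 0 1, ek 1 0}"

definition beta :: "((int ^ 3) \<times> 3) set" where
  "beta = {ex 0 1, ey 1 0, ek 0 1}"

lemma h_notin_six: "h \<notin> six" "R 1 1 1 \<notin> six"
  by (simp_all add: six_def)

lemma edge_in_six:
  assumes "edge m \<subseteq> six"
  shows "m \<in> alpha \<union> beta"
proof -
  have "edge m \<subseteq> box8" using assms by (auto simp: box8_def)
  from edge_in_box8[OF this] show ?thesis
  proof (elim disjE bexE)
    fix t w assume "t \<in> {0, 1}" "w \<in> {0, 1}" "m = ex t w"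
    then show ?thesis
      using assms h_notin_six by (auto simp: alpha_def beta_def)
  next
    fix s w assume "s \<in> {0, 1}" "w \<in> {0, 1}" "m = ey s w"
    then show ?thesis
      using assms h_notin_six by (auto simp: alpha_def beta_def)
  next
    fix s t assume "s \<in> {0, 1}" "t \<in> {0, 1}" "m = ek s t"
    then show ?thesis
      using assms h_notin_six by (auto simp: alpha_def beta_def)
  qed
qed

text \<open>Each cube of the hexagon lies in exactly two of the six possible dominoes, one from each
  matching, so the choice at one cube propagates around the cycle.\<close>

lemma hexagon_tilings:
  assumes n: "lattice_tiling six n"
  shows "n = alpha \<or> n = beta"
proof -
  have sub: "n \<subseteq> alpha \<union> beta"
    using n edge_in_six by (fastforce simp: lattice_tiling_def)
  have cover: "\<exists>m\<in>n. c \<in> edge m" if "c \<in> six" for c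
    using n that unfolding lattice_tiling_def by blast
  have c': "(ex 1 0 \<in> n \<and> c \<in> edge (ex 1 0)) \<or> (ey 0 1 \<in> n \<and> c \<in> edge (ey 0 1)) \<or> (ek 1 0 \<in> n \<and> c
      \<in> edge (ek 1 0))
    \<or> (ex 0 1 \<in> n \<and> c \<in> edge (ex 0 1)) \<or> (ey 1 0 \<in> n \<and> c \<in> edge (ey 1 0)) \<or> (ek 0 1 \<in> n \<and> c \<in> edge
        (ek 0 1))"
    if "c \<in> six" for c
    using cover[OF that] sub unfolding alpha_def beta_def by blast
  have c: "ek 1 0 \<in> n \<or> ey 1 0 \<in> n" "ex 1 0 \<in> n \<or> ek 0 1 \<in> n" "ey 0 1 \<in> n \<or> ex 0 1 \<in> n"
    "ex 1 0 \<in> n \<or> ey 1 0 \<in> n" "ek 1 0 \<in> n \<or> ex 0 1 \<in> n" "ey 0 1 \<in> n \<or> ek 0 1 \<in> n"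
    using c'[of "R 1 0 0"] c'[of "R 0 1 0"] c'[of "R 0 0 1"] c'[of "R 1 1 0"] c'[of "R 1 0 1"]
        c'[of "R 0 1 1"]
    by (auto simp: six_def)
  have d: "\<not> (m \<in> n \<and> m' \<in> n)" if "c \<in> edge m" "c \<in> edge m'" "snd m \<noteq> snd m'" for m m' c
    using lattice_tiling_eqI[OF n _ _ that(1,2)] that(3) by blast
  have "\<not> (ek 1 0 \<in> n \<and> ey 1 0 \<in> n)" "\<not> (ex 1 0 \<in> n \<and> ek 0 1 \<in> n)" "\<not> (ey 0 1 \<in> n \<and> ex 0 1 \<in> n)"
    "\<not> (ex 1 0 \<in> n \<and> ey 1 0 \<in> n)" "\<not> (ek 1 0 \<in> n \<and> ex 0 1 \<in> n)" "\<not> (ey 0 1 \<in> n \<and> ek 0 1 \<in> n)"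
    using d[of "R 1 0 0" "ek 1 0" "ey 1 0"] d[of "R 0 1 0" "ex 1 0" "ek 0 1"] d[of "R 0 0 1" "ey 0
        1" "ex 0 1"]
      d[of "R 1 1 0" "ex 1 0" "ey 1 0"] d[of "R 1 0 1" "ek 1 0" "ex 0 1"] d[of "R 0 1 1" "ey 0 1"
          "ek 0 1"]
    by simp_all
  with c sub show ?thesis
    unfolding alpha_def beta_def by blast
qed

text \<open>Dominoes of two directions that agree in the coordinate transverse to both would meet,
  whence \<open>w \<noteq> w'\<close>, \<open>s \<noteq> s'\<close>, \<open>t \<noteq> t'\<close>.
  Avoiding \<open>h\<close> leaves just two solutions, and both leave the opposite corner free as
  well.\<close>

lemma three_dominoes:
  assumes sub: "\<And>m. m \<in> n \<Longrightarrow> edge m \<subseteq> box8 - {h}"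
    and disj: "\<And>m m'. m \<in> n \<Longrightarrow> m' \<in> n \<Longrightarrow> m \<noteq> m' \<Longrightarrow> edge m \<inter> edge m' = {}"
    and inj: "inj_on snd n" and all: "snd ` n = UNIV"
  shows "n = alpha \<or> n = beta"
proof -
  have get: "\<exists>m\<in>n. snd m = j" for j
    using all by (metis UNIV_I imageE)
  have uniq: "m = m'" if "m \<in> n" "m' \<in> n" "snd m = snd m'" for m m'
    using inj that by (auto dest: inj_onD)
  obtain mx where mx: "mx \<in> n" "snd mx = k + 1" using get by blast
  obtain my where my: "my \<in> n" "snd my = k + 2" using get by blast
  obtain mz where mz: "mz \<in> n" "snd mz = k" using get by blast
  have box: "edge m \<subseteq> box8" "h \<notin> edge m" if "m \<in> n" for m
    using sub[OF that] by blast+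
  have ne: "mx \<noteq> ey s w" "mx \<noteq> ek s w" "my \<noteq> ex s w" "my \<noteq> ek s w" "mz \<noteq> ex s w" "mz \<noteq> ey s w" for
      s w
    using mx(2) my(2) mz(2) snd_e[of s w] by (metis rot_3(5-7))+
  obtain t w where tw: "t \<in> {0, 1}" "w \<in> {0, 1}" "mx = ex t w"
    using edge_in_box8[OF box(1)[OF mx(1)]] ne(1,2) by blast
  obtain s w' where sw: "s \<in> {0, 1}" "w' \<in> {0, 1}" "my = ey s w'"
    using edge_in_box8[OF box(1)[OF my(1)]] ne(3,4) by blast
  obtain s' t' where st: "s' \<in> {0, 1}" "t' \<in> {0, 1}" "mz = ek s' t'"
    using edge_in_box8[OF box(1)[OF mz(1)]] ne(5,6) by blast
  have nz: "\<not> (t = 0 \<and> w = 0)" "\<not> (s = 0 \<and> w' = 0)" "\<not> (s' = 0 \<and> t' = 0)"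
    using box(2)[OF mx(1)] box(2)[OF my(1)] box(2)[OF mz(1)] tw sw st by auto
  have "mx \<noteq> my" "my \<noteq> mz" "mx \<noteq> mz"
    using mx(2) my(2) mz(2) by auto
  then have "edge mx \<inter> edge my = {}" "edge my \<inter> edge mz = {}" "edge mx \<inter> edge mz = {}"
    using disj mx(1) my(1) mz(1) by auto
  then have "w \<noteq> w'" "s \<noteq> s'" "t \<noteq> t'"
    using tw(1,2) sw(1,2) st(1,2) unfolding tw(3) sw(3) st(3) by auto
  then have "{mx, my, mz} = alpha \<or> {mx, my, mz} = beta"
    using nz tw(1,2) sw(1,2) st(1,2) unfolding tw(3) sw(3) st(3) alpha_def beta_def by auto
  moreover have "n = {mx, my, mz}"
  proof -
    have "m \<in> {mx, my, mz}" if "m \<in> n" for m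
    proof -
      have "snd m = snd mx \<or> snd m = snd my \<or> snd m = snd mz"
        unfolding mx(2) my(2) mz(2) using exhaust_3_rot[of "snd m" k] by blast
      then show ?thesis
        using uniq[OF that mx(1)] uniq[OF that my(1)] uniq[OF that mz(1)] by blast
    qed
    then show ?thesis using mx(1) my(1) mz(1) by blast
  qed
  ultimately show ?thesis by simp
qed


lemma square_R:
  "{h, R 1 0 0, R 0 1 0, R 1 1 0} = square (R (if \<eta> (k + 1) = 1 then 0 else 1) (if \<eta> (k + 2) = 1
      then 0 else 1) 0) (k + 1) (k + 2)"
  "{h, R 0 1 0, R 0 0 1, R 0 1 1} = square (R 0 (if \<eta> (k + 2) = 1 then 0 else 1) (if \<eta> k = 1 then
      0 else 1)) (k + 2) k"
  "{h, R 1 0 0, R 0 0 1, R 1 0 1} = square (R (if \<eta> (k + 1) = 1 then 0 else 1) 0 (if \<eta> k = 1 then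
      0 else 1)) k (k + 1)"
  using eta[of k] eta[of "k + 1"] eta[of "k + 2"] by (auto simp: square_def R_add)

lemma sgn3_0 [simp]: "sgn3 0 = 0"
  by (simp add: sgn3_def)

lemma sgn3_R_h:
  "sgn3 (R s t w - h) = sg * (sgn s * sgn t * sgn w)"
  "sgn3 (h - R s t w) = - (sg * (sgn s * sgn t * sgn w))"
  using sgn3_R[of s t w 0 0 0] sgn3_minus[of h "R s t w"] by simp_all

text \<open>The square consists of \<open>h\<close> and cubes of the hexagon, so among the dominoes
  of \<open>U\<close> only the one covering \<open>h\<close> can meet it; all others of the
  orthogonal class pair to 0.\<close>

lemma pairing_three:
  assumes U: "lattice_tiling (C - six) U" and C: "finite C" and H: "H \<in> U" "h \<in> edge H" and six:
      "six \<subseteq> C"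
    and jlq: "j \<noteq> l" "l \<noteq> q" "j \<noteq> q" and sq: "square c j l \<subseteq> insert h six"
  shows "pairing (square c j l) (dir_cells q U) = (if snd H = q then pairing (square c j l) (edge
      H) else 0)"
proof -
  have fin: "finite (C - six)" using C by simp
  have zero: "pairing (square c j l) (edge m) = 0" if m: "m \<in> U" "snd m = q" "m \<noteq> H" for m
  proof -
    have "edge m \<subseteq> C - six" using U m(1) by (auto simp: lattice_tiling_def)
    moreover have "h \<notin> edge m" using lattice_tiling_eqI[OF U m(1) H(1) _ H(2)] m(3) by blast
    ultimately have "square c j l \<inter> edge m = {}" using sq by blast
    moreover have "m = (fst m, q)" using m(2) by (simp add: prod_eq_iff)
    ultimately show ?thesis using pairing_square_edge[OF jlq, of c "fst m"] by simp
  qed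
  have "pairing (square c j l) (dir_cells q U) = (\<Sum>m\<in>{m\<in>U. snd m = q}. if m = H then pairing
      (square c j l) (edge H) else 0)"
    unfolding pairing_dir_cells_right[OF U fin] by (intro sum.cong) (auto simp: zero)
  also have "\<dots> = (if snd H = q then pairing (square c j l) (edge H) else 0)"
    using lattice_tiling_finite[OF U fin] H(1) by simp
  finally show ?thesis .
qed

text \<open>The three neighbours of \<open>h\<close> inside the box belong to the hexagon, so the
  domino that covers \<open>h\<close> leaves the box.\<close>

lemma outer_edge:
  assumes "h \<in> edge H" "edge H \<inter> six = {}"
  shows "edge H = {h, (if snd H = k then R 0 0 (-1) else if snd H = k + 1 then R (-1) 0 0 else R 0
      (-1) 0)}"
proof -
  obtain a r where m: "H = (a, r)" by (metis surj_pair)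
  have ah: "a = h \<or> a + ax r = h" using assms(1) by (auto simp: m edge_def)
  have plus: "h + ax k = R 0 0 (\<eta> k)" "h + ax (k + 1) = R (\<eta> (k + 1)) 0 0" "h + ax (k + 2) = R 0
      (\<eta> (k + 2)) 0"
    using R_add[of 0 0 0] by simp_all
  have minus: "h = R 0 0 (- \<eta> k) + ax k" "h = R (- \<eta> (k + 1)) 0 0 + ax (k + 1)" "h = R 0 (- \<eta> (k +
      2)) 0 + ax (k + 2)"
    by (simp_all add: R_add)
  consider "r = k" | "r = k + 1" | "r = k + 2"
    using exhaust_3_rot by blast
  then show ?thesis
  proof cases
    case 1
    show ?thesis
    proof (cases "a = h")
      case True
      then show ?thesis using assms(2) plus(1) eta[of k] 1 by (auto simp: m edge_def six_def)
    next
      case False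
      then have "a + ax k = R 0 0 (- \<eta> k) + ax k" using ah minus(1) 1 by simp
      then have "a = R 0 0 (- \<eta> k)" by simp
      then show ?thesis using assms(2) ah False eta[of k] 1 by (auto simp: m edge_def six_def)
    qed
  next
    case 2
    show ?thesis
    proof (cases "a = h")
      case True
      then show ?thesis using assms(2) plus(2) eta[of "k + 1"] 2 by (auto simp: m edge_def six_def)
    next
      case False
      then have "a + ax (k + 1) = R (- \<eta> (k + 1)) 0 0 + ax (k + 1)" using ah minus(2) 2 by simp
      then have "a = R (- \<eta> (k + 1)) 0 0" by simp
      then show ?thesis using assms(2) ah False eta[of "k + 1"] 2 by (auto simp: m edge_def six_def)
    qed
  next
    case 3
    show ?thesis
    proof (cases "a = h")
      case True
      then show ?thesis using assms(2) plus(3) eta[of "k + 2"] 3 by (auto simp: m edge_def six_def)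
    next
      case False
      then have "a + ax (k + 2) = R 0 (- \<eta> (k + 2)) 0 + ax (k + 2)" using ah minus(3) 3 by simp
      then have "a = R 0 (- \<eta> (k + 2)) 0" by simp
      then show ?thesis using assms(2) ah False eta[of "k + 2"] 3 by (auto simp: m edge_def six_def)
    qed
  qed
qed

text \<open>Both squares at \<open>h\<close> that contain a domino of \<^term>\<open>alpha\<close> or \<^term>\<open>beta\<close> of a given direction
  share the edge at \<open>h\<close> in that direction, so the change of a class is a difference of two
  squares.\<close>

lemma twist4_trit:
  assumes D: "finite D" and C: "C = cyl_cells i k' D N"
    and U: "lattice_tiling (C - six) U" and six: "six \<subseteq> C" and h: "h \<in> C"
  shows "twist4 k (U \<union> beta) - twist4 k (U \<union> alpha) = 4 * sg"
proof -
  let ?x = "k + 1" and ?y = "k + 2"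
  have fin: "finite C" "finite (C - six)" using finite_cyl_cells[OF D] by (simp_all add: C)
  have finO: "finite (dir_cells q U)" for q by (rule finite_subset[OF dir_cells_subset[OF U]
      fin(2)])
  obtain H where H: "H \<in> U" "h \<in> edge H"
    using U h h_notin_six unfolding lattice_tiling_def by blast
  have "edge H \<inter> six = {}" using U H(1) by (auto simp: lattice_tiling_def)
  note edge_H = outer_edge[OF H(2) this]
  define Qxy Qyk Qkx where "Qxy = {h, R 1 0 0, R 0 1 0, R 1 1 0}"
    and "Qyk = {h, R 0 1 0, R 0 0 1, R 0 1 1}" and "Qkx = {h, R 1 0 0, R 0 0 1, R 1 0 1}"
  have Q_sub: "Qxy \<subseteq> insert h six" "Qyk \<subseteq> insert h six" "Qkx \<subseteq> insert h six"
    by (auto simp: Qxy_def Qyk_def Qkx_def six_def)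
  have h_in: "snd H = k \<Longrightarrow> pairing Qxy (edge H) = sg" "snd H = ?x \<Longrightarrow> pairing Qyk (edge H) = sg"
    "snd H = ?y \<Longrightarrow> pairing Qkx (edge H) = sg"
    unfolding edge_H Qxy_def Qyk_def Qkx_def pairing_def
    by (simp_all add: colour_R sgn3_R sgn3_R_h)
  \<comment> \<open>The domino \<open>H\<close> is orthogonal to exactly one of the three faces at
    \<open>h\<close>, and only this face has a nonzero pairing with its orthogonal class.\<close>
  have sum_h: "pairing Qxy (dir_cells k U) + pairing Qyk (dir_cells ?x U) + pairing Qkx (dir_cells
      ?y U) = sg"
  proof -
    have "pairing Qxy (dir_cells k U) = (if snd H = k then sg else 0)"
      "pairing Qyk (dir_cells ?x U) = (if snd H = ?x then sg else 0)"
      "pairing Qkx (dir_cells ?y U) = (if snd H = ?y then sg else 0)"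
      using pairing_three[OF U fin(1) H six, of ?x ?y k, folded square_R] pairing_three[OF U
          fin(1) H six, of ?y k ?x]
        pairing_three[OF U fin(1) H six, of k ?x ?y] Q_sub h_in
      unfolding Qxy_def Qyk_def Qkx_def square_R by auto
    then show ?thesis using exhaust_3_rot[of "snd H" k] by auto
  qed
  have "Qxy \<subseteq> C" using Q_sub(1) six h by blast
  then have "pairing Qxy C = 0"
    unfolding Qxy_def square_R by (intro pairing_square_cylinder[OF D C]) auto
  then have "pairing Qxy (C - six) = - pairing Qxy six"
    by (simp add: pairing_Diff_right[OF fin(1) six])
  then have sum_Q: "pairing Qxy (dir_cells k U) + pairing Qxy (dir_cells ?x U) + pairing Qxy
      (dir_cells ?y U) = - pairing Qxy six"
    using pairing_lattice_tiling[OF U fin(2), of Qxy k] by simp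
  define dx' dy' cx' cy' where "dx' = {R 0 1 0, R 1 1 0}" and "dy' = {R 0 0 1, R 0 1 1}"
    and "cx' = {R 0 0 1, R 1 0 1}" and "cy' = {R 1 0 0, R 1 1 0}"
  have covs: "dir_cells ?x alpha = dx'" "dir_cells ?y alpha = dy'" "dir_cells ?x beta = cx'"
      "dir_cells ?y beta = cy'"
  proof -
    have "{m \<in> alpha. snd m = ?x} = {ex 1 0}" "{m \<in> alpha. snd m = ?y} = {ey 0 1}"
      "{m \<in> beta. snd m = ?x} = {ex 0 1}" "{m \<in> beta. snd m = ?y} = {ey 1 0}"
      by (auto simp: alpha_def beta_def)
    then show "dir_cells ?x alpha = dx'" "dir_cells ?y alpha = dy'" "dir_cells ?x beta = cx'"
        "dir_cells ?y beta = cy'"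
      by (simp_all add: dir_cells_def dx'_def dy'_def cx'_def cy'_def)
  qed
  have csts: "pairing Qxy six = sg" "pairing cx' cy' = sg" "pairing dx' dy' = - sg"
    unfolding Qxy_def six_def cx'_def cy'_def dx'_def dy'_def pairing_def
    by (simp_all add: colour_R sgn3_R sgn3_R_h)
  have fins: "finite dx'" "finite dy'" "finite cx'" "finite cy'" by (simp_all add: dx'_def dy'_def
      cx'_def cy'_def)
  have disj: "dir_cells q U \<inter> dx' = {}" "dir_cells q U \<inter> dy' = {}" "dir_cells q U \<inter> cx' = {}"
      "dir_cells q U \<inter> cy' = {}" for q
    using dir_cells_subset[OF U, of q] by (auto simp: dx'_def dy'_def cx'_def cy'_def six_def)
  have diffs: "pairing P cy' - pairing P dy' = pairing P Qxy - pairing P Qyk"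
    "pairing P cx' - pairing P dx' = pairing P Qkx - pairing P Qxy" for P
  proof -
    have "Qxy = cy' \<union> {h, R 0 1 0}" "Qyk = dy' \<union> {h, R 0 1 0}" "cy' \<inter> {h, R 0 1 0} = {}" "dy' \<inter>
        {h, R 0 1 0} = {}"
      "Qkx = cx' \<union> {h, R 1 0 0}" "Qxy = dx' \<union> {h, R 1 0 0}" "cx' \<inter> {h, R 1 0 0} = {}" "dx' \<inter> {h, R
          1 0 0} = {}"
      by (auto simp: Qxy_def Qyk_def Qkx_def dx'_def dy'_def cx'_def cy'_def)
    then have "pairing P Qxy = pairing P cy' + pairing P {h, R 0 1 0}" "pairing P Qyk = pairing P
        dy' + pairing P {h, R 0 1 0}"
      "pairing P Qkx = pairing P cx' + pairing P {h, R 1 0 0}" "pairing P Qxy = pairing P dx' +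
          pairing P {h, R 1 0 0}"
      using fins by (metis pairing_Un_right finite.emptyI finite.insertI)+
    then show "pairing P cy' - pairing P dy' = pairing P Qxy - pairing P Qyk"
      "pairing P cx' - pairing P dx' = pairing P Qkx - pairing P Qxy" by simp_all
  qed
  have "twist4 k (U \<union> beta) - twist4 k (U \<union> alpha) =
      (pairing (dir_cells ?x U) cy' - pairing (dir_cells ?x U) dy') - (pairing (dir_cells ?y U)
          cx' - pairing (dir_cells ?y U) dx')
      + (pairing cx' cy' - pairing dx' dy')"
    using pairing_swap[of cx' "dir_cells ?y U"] pairing_swap[of dx' "dir_cells ?y U"]
    by (simp add: twist4_def dir_cells_Un covs pairing_Un_left pairing_Un_right fins finO disj)
  \<comment> \<open>The 4 is made up of 2 from the pairs inside the hexagon, 1 from the domino that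
    covers \<open>h\<close> by \<open>sum_h\<close>, and 1 from \<open>pairing Qxy six\<close> by
    \<open>sum_Q\<close>.\<close>
  also have "\<dots> = 4 * sg"
    unfolding diffs csts
    using sum_h sum_Q pairing_swap[of "dir_cells ?x U" Qxy] pairing_swap[of "dir_cells ?x U" Qyk]
      pairing_swap[of "dir_cells ?y U" Qxy] pairing_swap[of "dir_cells ?y U" Qkx] csts(1) by
          linarith
  finally show ?thesis .
qed

end

section \<open>The sign of a trit\<close>

lemma det3_rot:
  "det3 u v w = u $ k * (v $ (k + 1) * w $ (k + 2) - v $ (k + 2) * w $ (k + 1))
    - u $ (k + 1) * (v $ k * w $ (k + 2) - v $ (k + 2) * w $ k)
    + u $ (k + 2) * (v $ k * w $ (k + 1) - v $ (k + 1) * w $ k)"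
proof -
  have *: "(4 :: 3) = 1" "(5 :: 3) = 2" by simp_all
  show ?thesis
    using exhaust_3[of k] by (auto simp: det3_def det_3 * algebra_simps)
qed

lemma share_face_colour: "share_face p q \<Longrightarrow> colour q = - colour p"
  by (auto simp: share_face_def)

lemma basic_cube_subset_cbox:
  "basic_cube p \<subseteq> cbox (lattice_pt a) (lattice_pt b) \<longleftrightarrow> (\<forall>j. a $ j \<le> p $ j \<and> p $ j + 1 \<le> b $ j)"
proof
  assume sub: "basic_cube p \<subseteq> cbox (lattice_pt a) (lattice_pt b)"
  have "lattice_pt p \<in> basic_cube p" "lattice_pt (p + 1) \<in> basic_cube p"
    by (simp_all add: mem_basic_cube lattice_pt_def)
  then have "lattice_pt p \<in> cbox (lattice_pt a) (lattice_pt b)" "lattice_pt (p + 1) \<in> cbox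
      (lattice_pt a) (lattice_pt b)"
    using sub by blast+
  then have "real_of_int (a $ j) \<le> of_int (p $ j)" "real_of_int ((p + 1) $ j) \<le> of_int (b $ j)"
      for j
    unfolding mem_box_cart lattice_pt_def vec_lambda_beta by blast+
  then show "\<forall>j. a $ j \<le> p $ j \<and> p $ j + 1 \<le> b $ j"
    unfolding of_int_le_iff by simp
next
  assume *: "\<forall>j. a $ j \<le> p $ j \<and> p $ j + 1 \<le> b $ j"
  show "basic_cube p \<subseteq> cbox (lattice_pt a) (lattice_pt b)"
  proof
    fix x assume x: "x \<in> basic_cube p"
    have "of_int (a $ j) \<le> x $ j \<and> x $ j \<le> of_int (b $ j)" for j
    proof -
      have "of_int (p $ j) \<le> x $ j" "x $ j \<le> of_int (p $ j) + 1"
        using x by (auto simp: mem_basic_cube)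
      moreover have "a $ j \<le> p $ j" "p $ j + 1 \<le> b $ j" using * by auto
      ultimately show ?thesis by linarith
    qed
    then show "x \<in> cbox (lattice_pt a) (lattice_pt b)"
      by (simp add: mem_box_cart lattice_pt_def)
  qed
qed

context corner
begin

lemma R_nth [simp]:
  "R s t w $ k = h $ k + w * \<eta> k" "R s t w $ (k + 1) = h $ (k + 1) + s * \<eta> (k + 1)"
  "R s t w $ (k + 2) = h $ (k + 2) + t * \<eta> (k + 2)"
  by (simp_all add: R_def)

lemma share_face_R:
  "share_face (R s t 0) (R s t 1)" "share_face (R s t 1) (R s t 0)"
  "share_face (R 0 t w) (R 1 t w)" "share_face (R 1 t w) (R 0 t w)"
  "share_face (R s 0 w) (R s 1 w)" "share_face (R s 1 w) (R s 0 w)"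
proof -
  have sym: "share_face p q" if "share_face q p" for p q
    using that by (auto simp: share_face_def)
  have a: "share_face (R s t 0) (R s t 1)"
    unfolding share_face_def by (rule exI[of _ k]) (use eta[of k] in \<open>auto simp: R_add\<close>)
  have b: "share_face (R 0 t w) (R 1 t w)"
    unfolding share_face_def by (rule exI[of _ "k + 1"]) (use eta[of "k + 1"] in \<open>auto simp: R_add\<close>)
  have c: "share_face (R s 0 w) (R s 1 w)"
    unfolding share_face_def by (rule exI[of _ "k + 2"]) (use eta[of "k + 2"] in \<open>auto simp: R_add\<close>)
  show "share_face (R s t 0) (R s t 1)" "share_face (R s t 1) (R s t 0)"
    "share_face (R 0 t w) (R 1 t w)" "share_face (R 1 t w) (R 0 t w)"
    "share_face (R s 0 w) (R s 1 w)" "share_face (R s 1 w) (R s 0 w)"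
    by (rule a, rule sym[OF a], rule b, rule sym[OF b], rule c, rule sym[OF c])
qed

text \<open>The roles of \<open>a\<close> and \<open>b\<close> cannot be exchanged: a neighbour of
  \<open>h\<close> has the colour opposite to \<open>h\<close>, which \<open>b\<close> has not. So
  the description of the sign determines a single value.\<close>

lemma trit_sign_eq:
  assumes m: "edge m = {a, b}" and a: "share_face a h" "share_face b (R 1 1 1)" and b: "colour b =
      colour h"
  shows "trit_sign h (R 1 1 1) (domino_of m) = det3 (cube_center a - cube_center h) (cube_center b
      - cube_center a)
    (cube_center (R 1 1 1) - cube_center b)"
  unfolding trit_sign_def
proof (rule the_equality)
  show "\<exists>a' b'. domino_of m = basic_cube a' \<union> basic_cube b' \<and> share_face a' h \<and> share_face b' (R 1
      1 1) \<and>
      det3 (cube_center a - cube_center h) (cube_center b - cube_center a) (cube_center (R 1 1 1)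
          - cube_center b) =
      det3 (cube_center a' - cube_center h) (cube_center b' - cube_center a') (cube_center (R 1 1
          1) - cube_center b')"
    using m a by (intro exI[of _ a] exI[of _ b]) (auto simp: domino_of_def cubes_def)
next
  fix c assume "\<exists>a' b'. domino_of m = basic_cube a' \<union> basic_cube b' \<and> share_face a' h \<and> share_face
      b' (R 1 1 1) \<and>
      c = det3 (cube_center a' - cube_center h) (cube_center b' - cube_center a') (cube_center (R
          1 1 1) - cube_center b')"
  then obtain a' b' where ab: "domino_of m = basic_cube a' \<union> basic_cube b'" "share_face a' h"
      "share_face b' (R 1 1 1)"
    and c: "c = det3 (cube_center a' - cube_center h) (cube_center b' - cube_center a')
        (cube_center (R 1 1 1) - cube_center b')"
    by blast
  have "cubes {a, b} = cubes {a', b'}"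
    using ab(1) by (simp add: domino_of_def m cubes_def)
  then have "{a, b} = {a', b'}" by (rule cubes_inj)
  moreover have "a' \<noteq> b"
    using share_face_colour[OF ab(2)] b by (auto simp: colour_def split: if_splits)
  ultimately have "a' = a" "b' = b" by (auto simp: doubleton_eq_iff)
  then show "c = det3 (cube_center a - cube_center h) (cube_center b - cube_center a) (cube_center
      (R 1 1 1) - cube_center b)"
    using c by simp
qed

lemma trit_sign_beta: "trit_sign h (R 1 1 1) (domino_of (ex 0 1)) = of_int sg"
proof -
  have "share_face (R 0 0 1) h" using share_face_R(2)[of 0 0] by simp
  then show ?thesis
    by (subst trit_sign_eq[of _ "R 0 0 1" "R 1 0 1"])
      (simp_all add: share_face_R colour_R det3_rot[of _ _ _ k] cube_center_def sg_def)
qed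

lemma trit_sign_alpha: "trit_sign h (R 1 1 1) (domino_of (ex 1 0)) = - of_int sg"
proof -
  have "share_face (R 0 1 0) h" using share_face_R(6)[of 0 0] by simp
  then show ?thesis
    by (subst trit_sign_eq[of _ "R 0 1 0" "R 1 1 0"])
      (simp_all add: share_face_R colour_R det3_rot[of _ _ _ k] cube_center_def sg_def)
qed

lemma edges_alpha_beta: "(\<Union>m\<in>alpha. edge m) = six" "(\<Union>m\<in>beta. edge m) = six"
  by (auto simp: alpha_def beta_def six_def)

text \<open>With \<open>k\<close> the axis, \<open>R 0 0 1\<close> lies in the column of
  \<open>h\<close> and \<open>R 1 0 0\<close> in its layer. Hence in a tiling the corner is covered
  by a domino, although the box of a trit may stick out of the region.\<close>

lemma six_subset_cylinder:
  assumes C: "C = cyl_cells k k' D N" and six: "six \<subseteq> C"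
  shows "h \<in> C"
proof -
  have "R 0 0 1 \<in> C" "R 1 0 0 \<in> C" using six by (auto simp: six_def)
  then show ?thesis by (simp add: C cyl_cells_def)
qed

end

lemma Union_domino_of: "\<Union> (domino_of ` m) = cubes (\<Union>e\<in>m. edge e)"
  by (auto simp: domino_of_def cubes_def)

lemma codes_Un: "codes (t \<union> t') = codes t \<union> codes t'"
  by (auto simp: codes_def)

lemma codes_Diff: "codes (t - t') = codes t - codes t'"
  by (auto simp: codes_def)

lemma lattice_tiling_Diff:
  assumes "lattice_tiling C M" "m \<subseteq> M"
  shows "lattice_tiling (C - (\<Union>e\<in>m. edge e)) (M - m)"
  unfolding lattice_tiling_def
proof
  show "disjoint_family_on edge (M - m)"
    using assms(1) by (auto simp: lattice_tiling_def disjoint_family_on_def)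
  show "\<Union> (edge ` (M - m)) = C - (\<Union>e\<in>m. edge e)"
  proof (intro equalityI subsetI)
    fix c assume "c \<in> \<Union> (edge ` (M - m))"
    then obtain e where e: "e \<in> M" "e \<notin> m" "c \<in> edge e" by auto
    have "c \<notin> edge e'" if "e' \<in> m" for e'
      using lattice_tiling_eqI[OF assms(1) e(1) _ e(3), of e'] that e(2) assms(2) by auto
    moreover have "c \<in> C" using assms(1) e by (auto simp: lattice_tiling_def)
    ultimately show "c \<in> C - (\<Union>e\<in>m. edge e)" by auto
  next
    fix c assume "c \<in> C - (\<Union>e\<in>m. edge e)"
    moreover from this obtain e where "e \<in> M" "c \<in> edge e"
      using assms(1) by (auto simp: lattice_tiling_def)
    ultimately show "c \<in> \<Union> (edge ` (M - m))" by auto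
  qed
qed

lemma twist4_positive_trit:
  assumes D: "planar_exact D" "finite D" and C: "C = cyl_cells i k D N"
    and t0: "tiling (cubes C) t0" and t1: "tiling (cubes C) t1"
    and trit: "is_positive_trit (cubes C) t0 t1"
  shows "twist4 r (codes t1) - twist4 r (codes t0) = 4"
proof -
  let ?B = "\<lambda>l. cbox (lattice_pt l) (lattice_pt (l + 2))"
  obtain s s' h h' where step: "trit_step (cubes C) t0 t1 s s' h h'"
    and pos: "\<forall>d\<in>s'. trit_sign h h' d = 1"
    using trit unfolding is_positive_trit_def by (elim exE conjE)
  obtain l where l: "s = {d \<in> t0. d \<subseteq> ?B l \<inter> cubes C} \<and> card s = 3 \<and> pairwise (\<lambda>d d'. \<not> parallel d
      d') s
      \<and> h \<noteq> h' \<and> {h, h'} = {p. basic_cube p \<subseteq> ?B l \<and> \<not> basic_cube p \<subseteq> \<Union>s}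
      \<and> tiling (\<Union>s) s' \<and> card s' = 3 \<and> s' \<noteq> s \<and> t1 = (t0 - s) \<union> s'"
    using step unfolding trit_step_def Let_def by (elim exE)
  have s: "s = {d \<in> t0. d \<subseteq> ?B l \<inter> cubes C}" and card_s: "card s = 3"
    and npar: "pairwise (\<lambda>d d'. \<not> parallel d d') s" and "h \<noteq> h'"
    and hh': "{h, h'} = {p. basic_cube p \<subseteq> ?B l \<and> \<not> basic_cube p \<subseteq> \<Union>s}"
    and s': "tiling (\<Union>s) s'" "s' \<noteq> s" and t1_eq: "t1 = (t0 - s) \<union> s'"
    using l by - (elim conjE, assumption)+
  have sign: "trit_sign h h' d = 1" if "d \<in> s'" for d
    using pos that by (rule bspec)
  define \<eta> where "\<eta> = (\<lambda>j. if h $ j = l $ j then 1 else - 1 :: int)"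
  \<comment> \<open>The frame takes the cylinder axis as its \<open>k\<close>, as
    \<open>six_subset_cylinder\<close> requires; the change of \<open>twist4\<close> is computed
    along this axis only.\<close>
  interpret corner h i \<eta>
    by standard (simp add: \<eta>_def)
  have in_box: "basic_cube p \<subseteq> cbox (lattice_pt l) (lattice_pt (l + 2)) \<longleftrightarrow> (\<forall>j. l $ j \<le> p $ j \<and> p $
      j \<le> l $ j + 1)" for p
  proof -
    have "(l $ j \<le> p $ j \<and> p $ j + 1 \<le> (l + 2) $ j) \<longleftrightarrow> (l $ j \<le> p $ j \<and> p $ j \<le> l $ j + 1)" for j
      by (auto simp: numeral_index)
    then show ?thesis unfolding basic_cube_subset_cbox by simp
  qed
  have h_box: "l $ j \<le> h $ j" "h $ j \<le> l $ j + 1" for j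
  proof -
    have "h \<in> {h, h'}" by simp
    then have "\<forall>j. l $ j \<le> h $ j \<and> h $ j \<le> l $ j + 1"
      unfolding hh' mem_Collect_eq in_box by simp
    then show "l $ j \<le> h $ j" "h $ j \<le> l $ j + 1" by simp_all
  qed
  have box8: "p \<in> box8 \<longleftrightarrow> basic_cube p \<subseteq> cbox (lattice_pt l) (lattice_pt (l + 2))" for p
  proof -
    have coord: "l $ j \<le> x \<and> x \<le> l $ j + 1 \<longleftrightarrow> (\<exists>c\<in>{0, 1}. x = h $ j + c * \<eta> j)" for x j
    proof -
      have "l $ j \<le> x \<and> x \<le> l $ j + 1 \<longleftrightarrow> x = l $ j \<or> x = l $ j + 1"
        by presburger
      moreover have "h $ j = l $ j \<or> h $ j = l $ j + 1"
        using h_box[of j] by presburger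
      ultimately show ?thesis
        by (elim disjE) (simp_all add: \<eta>_def disj_commute)
    qed
    have "(\<forall>j. l $ j \<le> p $ j \<and> p $ j \<le> l $ j + 1) \<longleftrightarrow>
      (\<exists>c\<in>{0, 1}. p $ i = h $ i + c * \<eta> i) \<and> (\<exists>c\<in>{0, 1}. p $ (i + 1) = h $ (i + 1) + c * \<eta> (i + 1))
      \<and> (\<exists>c\<in>{0, 1}. p $ (i + 2) = h $ (i + 2) + c * \<eta> (i + 2))"
      unfolding coord[symmetric]
    proof (intro iffI conjI allI)
      fix j
      assume "(l $ i \<le> p $ i \<and> p $ i \<le> l $ i + 1) \<and> (l $ (i + 1) \<le> p $ (i + 1) \<and> p $ (i + 1) \<le> l $
          (i + 1) + 1)
        \<and> l $ (i + 2) \<le> p $ (i + 2) \<and> p $ (i + 2) \<le> l $ (i + 2) + 1"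
      then show "l $ j \<le> p $ j" "p $ j \<le> l $ j + 1"
        using exhaust_3_rot[of j i] by auto
    qed auto
    also have "\<dots> \<longleftrightarrow> p \<in> box8"
    proof
      assume "p \<in> box8"
      then show "(\<exists>c\<in>{0, 1}. p $ i = h $ i + c * \<eta> i) \<and> (\<exists>c\<in>{0, 1}. p $ (i + 1) = h $ (i + 1) + c
          * \<eta> (i + 1))
      \<and> (\<exists>c\<in>{0, 1}. p $ (i + 2) = h $ (i + 2) + c * \<eta> (i + 2))"
        unfolding box8_iff
      proof (elim bexE)
        fix s t w :: int
        assume "s \<in> {0, 1}" "t \<in> {0, 1}" "w \<in> {0, 1}" and p: "p = R s t w"
        then show ?thesis
          unfolding p R_nth by - (intro conjI; (rule bexI, rule refl, assumption))
      qed
    next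
      assume "(\<exists>c\<in>{0, 1}. p $ i = h $ i + c * \<eta> i) \<and> (\<exists>c\<in>{0, 1}. p $ (i + 1) = h $ (i + 1) + c * \<eta>
          (i + 1))
      \<and> (\<exists>c\<in>{0, 1}. p $ (i + 2) = h $ (i + 2) + c * \<eta> (i + 2))"
      then show "p \<in> box8"
      proof (elim conjE bexE)
        fix w s t :: int
        assume "w \<in> {0, 1}" "s \<in> {0, 1}" "t \<in> {0, 1}"
          and c: "p $ i = h $ i + w * \<eta> i" "p $ (i + 1) = h $ (i + 1) + s * \<eta> (i + 1)" "p $ (i +
              2) = h $ (i + 2) + t * \<eta> (i + 2)"
        moreover have "p = R s t w" by (rule vec_3_eqI[of _ i]) (simp_all add: c)
        ultimately show ?thesis unfolding box8_iff by blast
      qed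
    qed
    finally show ?thesis unfolding in_box by simp
  qed
  define M0 m m' where "M0 = codes t0" and "m = codes s" and "m' = codes s'"
  have M0: "lattice_tiling C M0" "t0 = domino_of ` M0" using tiling_codes[OF t0] by (simp_all add:
      M0_def)
  have m_sub: "m \<subseteq> M0" by (auto simp: m_def M0_def s codes_def)
  have sm: "s = domino_of ` m"
    using M0(2) by (auto simp: m_def s codes_def)
  have m_iff: "e \<in> m \<longleftrightarrow> e \<in> M0 \<and> edge e \<subseteq> box8" for e
  proof -
    have "domino_of e \<subseteq> cbox (lattice_pt l) (lattice_pt (l + 2)) \<longleftrightarrow> edge e \<subseteq> box8"
      unfolding domino_of_def cubes_def UN_subset_iff box8[symmetric] by auto
    moreover have "domino_of e \<subseteq> cubes C" if "e \<in> M0"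
      using M0(1) that unfolding domino_of_def cubes_subset_iff by (auto simp: lattice_tiling_def)
    ultimately show ?thesis by (auto simp: m_def M0_def s codes_def)
  qed
  define X where "X = (\<Union>e\<in>m. edge e)"
  have Us: "\<Union> s = cubes X" unfolding sm Union_domino_of X_def ..
  have hX: "{h, h'} = box8 - X"
    unfolding hh' Us basic_cube_subset_cubes box8[symmetric] by auto
  have disj: "edge e \<inter> edge e' = {}" if "e \<in> M0" "e' \<in> M0" "e \<noteq> e'" for e e'
    using M0(1) that by (auto simp: lattice_tiling_def disjoint_family_on_def)
  have inj: "inj_on snd m"
  proof (rule inj_onI, rule ccontr)
    fix e e' assume e: "e \<in> m" "e' \<in> m" "snd e = snd e'" "e \<noteq> e'"
    have "domino_of e \<noteq> domino_of e'" using e(4) inj_domino_of by (auto dest: injD)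
    then have "\<not> parallel (domino_of e) (domino_of e')"
      using npar e(1,2) unfolding sm pairwise_def by blast
    moreover have "parallel (domino_of e) (domino_of e')"
    proof -
      have "domino_dir (domino_of e) = of_int (colour (fst e)) *\<^sub>R axis (snd e) 1" for e
        using domino_dir_domino_of[of "fst e" "snd e"] by simp
      then show ?thesis
        using colour_cases[of "fst e"] colour_cases[of "fst e'"] e(3) by (auto simp: parallel_def)
    qed
    ultimately show False by simp
  qed
  have "card m = 3"
    using card_s unfolding sm by (subst (asm) card_image) (use inj_domino_of in \<open>auto intro:
        inj_on_subset\<close>)
  then have all: "snd ` m = UNIV"
    using card_image[OF inj] by (intro card_subset_eq) auto
  have "edge e \<subseteq> box8 - {h}" if "e \<in> m" for e
  proof -
    have "h \<in> box8 - X" unfolding hX[symmetric] by simp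
    then have "h \<notin> X" by simp
    then have "h \<notin> edge e" using that by (auto simp: X_def)
    then show ?thesis using that m_iff[of e] by blast
  qed
  from three_dominoes[OF this _ inj all] have m: "m = alpha \<or> m = beta"
    using disj m_sub by blast
  then have X_six: "X = six" using edges_alpha_beta by (auto simp: X_def)
  have h'_eq: "h' = R 1 1 1"
  proof -
    have "h' \<in> box8 - X" unfolding hX[symmetric] by simp
    then show ?thesis using \<open>h \<noteq> h'\<close> by (auto simp: X_six box8_def)
  qed
  have m': "m' = alpha \<or> m' = beta" "s' = domino_of ` m'"
    using tiling_codes[OF s'(1)[unfolded Us X_six]] hexagon_tilings by (auto simp: m'_def)
  have "m \<noteq> m'" using s'(2) sm m'(2) by auto
  have six: "six \<subseteq> C" using X_six m_sub M0(1) by (auto simp: X_def lattice_tiling_def)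
  have hC: "h \<in> C" by (rule six_subset_cylinder[OF C six])
  have U: "lattice_tiling (C - six) (M0 - m)"
    using lattice_tiling_Diff[OF M0(1) m_sub] X_six by (simp add: X_def)
  have t1_codes: "codes t1 = (M0 - m) \<union> m'" by (simp add: t1_eq codes_Un codes_Diff M0_def m_def
      m'_def)
  have t0_codes: "codes t0 = (M0 - m) \<union> m" using m_sub by (auto simp: M0_def)
  have delta: "twist4 i ((M0 - m) \<union> beta) - twist4 i ((M0 - m) \<union> alpha) = 4 * sg"
    by (rule twist4_trit[OF D(2) C U six hC])
  \<comment> \<open>Positivity holds for every new domino, so one of them determines
    \<open>sg\<close>: it is 1 if \<open>beta\<close> is new and -1 if \<open>alpha\<close> is, and
    either way \<open>delta\<close> yields 4.\<close>
  have "twist4 i (codes t1) - twist4 i (codes t0) = 4"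
  proof (cases "m = alpha")
    case True
    then have "m' = beta" using m' \<open>m \<noteq> m'\<close> by auto
    then have "domino_of (ex 0 1) \<in> s'" using m'(2) by (simp add: beta_def)
    from sign[OF this] have "sg = 1" unfolding h'_eq trit_sign_beta by simp
    then show ?thesis using delta True \<open>m' = beta\<close> by (simp add: t1_codes t0_codes)
  next
    case False
    then have "m = beta" "m' = alpha" using m m' \<open>m \<noteq> m'\<close> by auto
    then have "domino_of (ex 1 0) \<in> s'" using m'(2) by (simp add: alpha_def)
    from sign[OF this] have "sg = - 1" unfolding h'_eq trit_sign_alpha by simp
    then show ?thesis using delta \<open>m = beta\<close> \<open>m' = alpha\<close> by (simp add: t1_codes t0_codes)
  qed
  moreover have "lattice_tiling C (codes t1)" using tiling_codes[OF t1] by simp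
  ultimately show ?thesis
    using twist4_cylinder_eq[OF D C, of "codes t1" r i] twist4_cylinder_eq[OF D C, of "codes t0" r
        i] M0(1)
    by (simp add: M0_def)
qed

section \<open>Duplex regions\<close>

definition cyc_edges :: "'a list \<Rightarrow> ('a \<times> 'a) set" where
  "cyc_edges xs = set (zip xs (rotate1 xs))"

lemma cyc_edges_iff: "(a, b) \<in> cyc_edges xs \<longleftrightarrow> (\<exists>i<length xs. a = xs ! i \<and> b = xs ! (Suc i mod
    length xs))"
  by (auto simp: cyc_edges_def set_zip nth_rotate1)

definition cycles_in :: "('a \<times> 'a) set \<Rightarrow> ('a \<times> 'a) set set" where
  "cycles_in E = {C. C \<subseteq> E \<and> (\<exists>xs. xs \<noteq> [] \<and> distinct xs \<and> C = cyc_edges xs)}"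

text \<open>Successors are unique in \<open>E\<close>, so from a common edge onwards both cycles
  take the same steps, and one turn around \<open>C'\<close> stays in \<open>C\<close>.\<close>

lemma cycles_in_subset:
  assumes sv: "single_valued E" and C: "C \<in> cycles_in E" and C': "C' \<in> cycles_in E" and e: "e \<in> C"
      "e \<in> C'"
  shows "C' \<subseteq> C"
proof -
  obtain xs where xs: "xs \<noteq> []" "C = cyc_edges xs" "C \<subseteq> E" using C by (auto simp: cycles_in_def)
  obtain ys where ys: "ys \<noteq> []" "C' = cyc_edges ys" "C' \<subseteq> E" using C' by (auto simp: cycles_in_def)
  let ?n = "length ys"
  have n: "?n > 0" using ys(1) by simp
  have next_edge: "\<exists>c. (b, c) \<in> C" if "(a, b) \<in> C" for a b
  proof -
    obtain i where i: "i < length xs" "b = xs ! (Suc i mod length xs)"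
      using \<open>(a, b) \<in> C\<close> unfolding xs(2) cyc_edges_iff by blast
    have "Suc i mod length xs < length xs" using i(1) by (intro mod_less_divisor) linarith
    then show ?thesis unfolding xs(2) cyc_edges_iff using i(2) by blast
  qed
  obtain a b where ab: "e = (a, b)" by (metis surj_pair)
  obtain i where i: "i < ?n" "a = ys ! i" "b = ys ! (Suc i mod ?n)"
    using e(2) unfolding ab ys(2) cyc_edges_iff by blast
  have step: "(ys ! ((i + j) mod ?n), ys ! (Suc (i + j) mod ?n)) \<in> C" for j
  proof (induction j)
    case 0
    then show ?case using e(1) i by (simp add: ab)
  next
    case (Suc j)
    have "(ys ! (Suc (i + j) mod ?n), ys ! (Suc (Suc (i + j) mod ?n) mod ?n)) \<in> C'"
      unfolding ys(2) cyc_edges_iff using n by (intro exI[of _ "Suc (i + j) mod ?n"]) simp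
    then have "(ys ! (Suc (i + j) mod ?n), ys ! (Suc (Suc (i + j)) mod ?n)) \<in> E"
      using ys(3) by (auto simp: mod_Suc_eq)
    moreover obtain c where c: "(ys ! (Suc (i + j) mod ?n), c) \<in> C"
      using next_edge[OF Suc.IH] by blast
    ultimately have "c = ys ! (Suc (Suc (i + j)) mod ?n)"
      using sv xs(3) by (auto dest: single_valuedD)
    then show ?case using c by simp
  qed
  show ?thesis
  proof
    fix e' assume "e' \<in> C'"
    then obtain l where l: "l < ?n" "e' = (ys ! l, ys ! (Suc l mod ?n))"
      unfolding ys(2) by (cases e') (auto simp: cyc_edges_iff)
    have eq: "(i + (l + ?n - i)) = l + ?n" using i(1) by simp
    have "(l + ?n) mod ?n = l" "Suc (l + ?n) mod ?n = Suc l mod ?n"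
      using l(1) by simp_all (metis add_Suc mod_add_self2)
    then show "e' \<in> C" using step[of "l + ?n - i"] unfolding eq l(2) by simp
  qed
qed

text \<open>The relation is an injective self-map of its finite domain, hence a permutation, and the
  orbit of the starting point of an edge is a cycle through this edge.\<close>

lemma cycles_in_cover:
  assumes fin: "finite E" and sv: "single_valued E" and inj: "single_valued (E\<inverse>)" and ran: "Range
      E \<subseteq> Domain E"
  shows "\<Union> (cycles_in E) = E"
proof (intro equalityI subsetI)
  fix e assume e: "e \<in> E"
  obtain a b where ab: "e = (a, b)" by (metis surj_pair)
  \<comment> \<open>Outside the domain \<open>f\<close> is the identity, as \<open>permutes\<close>
    demands.\<close>
  define f where "f = (\<lambda>v. if v \<in> Domain E then (THE w. (v, w) \<in> E) else v)"
  have f: "(v, w) \<in> E \<Longrightarrow> f v = w" for v w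
    using sv by (auto simp: f_def single_valued_def intro!: the_equality)
  have fE: "(v, f v) \<in> E" if v: "v \<in> Domain E" for v
    using v f by auto
  have "inj_on f (Domain E)"
  proof (rule inj_onI)
    fix v w assume "v \<in> Domain E" "w \<in> Domain E" "f v = f w"
    then have "(f v, v) \<in> E\<inverse>" "(f v, w) \<in> E\<inverse>" using fE by force+
    then show "v = w" using inj by (auto dest: single_valuedD)
  qed
  moreover have finD: "finite (Domain E)" using fin by (rule finite_Domain)
  moreover have "f ` Domain E \<subseteq> Domain E" using fE ran by fastforce
  ultimately have "bij_betw f (Domain E) (Domain E)"
    by (simp add: bij_betw_def endo_inj_surj)
  then have perm: "f permutes Domain E"
    by (rule bij_imp_permutes) (simp add: f_def)
  then have permutation: "permutation f" using finD by (auto simp: permutation_permutes)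
  define n where "n = least_power f a"
  have n: "(f ^^ n) a = a" "n > 0"
    using least_power_of_permutation[OF permutation] by (auto simp: n_def)
  define xs where "xs = map (\<lambda>i. (f ^^ i) a) [0..<n]"
  have dist: "distinct xs"
    using cycle_of_permutation[OF permutation, of a] by (simp add: xs_def n_def)
  have len: "length xs = n" and nth: "i < n \<Longrightarrow> xs ! i = (f ^^ i) a" for i by (simp_all add: xs_def)
  have in_domino_of: "(f ^^ i) a \<in> Domain E" for i
  proof (induction i)
    case 0
    then show ?case using e ab by auto
  next
    case (Suc i)
    then show ?case using fE ran by fastforce
  qed
  have next_nth: "xs ! (Suc i mod n) = f (xs ! i)" if "i < n" for i
  proof (cases "Suc i = n")
    case True
    then show ?thesis using n nth[of 0] nth[OF that] by (metis comp_apply funpow.simps(2) funpow_0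
        mod_self)
  next
    case False
    then show ?thesis using that by (simp add: nth)
  qed
  have "cyc_edges xs \<subseteq> E"
  proof
    fix e' assume "e' \<in> cyc_edges xs"
    then obtain i where "i < n" "e' = (xs ! i, xs ! (Suc i mod n))"
      by (cases e') (auto simp: cyc_edges_iff len)
    then show "e' \<in> E"
      using fE[OF in_domino_of[of i]] next_nth[of i] nth[of i] by simp
  qed
  then have "cyc_edges xs \<in> cycles_in E"
    using dist n(2) len by (auto simp: cycles_in_def)
  moreover have "e \<in> cyc_edges xs"
    unfolding ab cyc_edges_iff len
    using n(2) next_nth[OF n(2)] nth[OF n(2)] f[of a b] e ab by (intro exI[of _ 0]) simp
  ultimately show "e \<in> \<Union> (cycles_in E)" by blast
qed (auto simp: cycles_in_def)

lemma sum_cycles_in: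
  assumes "finite E" "single_valued E" "single_valued (E\<inverse>)" "Range E \<subseteq> Domain E"
  shows "(\<Sum>C\<in>cycles_in E. \<Sum>e\<in>C. g e) = (\<Sum>e\<in>E. g e)"
proof -
  have "sum g (\<Union> (cycles_in E)) = (\<Sum>C\<in>cycles_in E. \<Sum>e\<in>C. g e)"
  proof (subst sum.Union_disjoint)
    show "\<forall>C\<in>cycles_in E. finite C"
      using finite_subset[OF _ assms(1)] by (auto simp: cycles_in_def)
    show "\<forall>C\<in>cycles_in E. \<forall>C'\<in>cycles_in E. C \<noteq> C' \<longrightarrow> C \<inter> C' = {}"
    proof (intro ballI impI)
      fix C C' assume C: "C \<in> cycles_in E" "C' \<in> cycles_in E" "C \<noteq> C'"
      show "C \<inter> C' = {}"
      proof (rule ccontr)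
        assume "C \<inter> C' \<noteq> {}"
        then obtain e where e: "e \<in> C" "e \<in> C'" by blast
        have "C' \<subseteq> C" "C \<subseteq> C'"
          using cycles_in_subset[OF assms(2) C(1,2) e] cycles_in_subset[OF assms(2) C(2,1) e(2,1)] .
        then show False using C(3) by simp
      qed
    qed
  qed simp
  then show ?thesis by (simp add: cycles_in_cover[OF assms])
qed

lemma successively_zip: "successively P xs \<longleftrightarrow> (\<forall>(a, b)\<in>set (zip xs (tl xs)). P a b)"
  by (induction xs rule: induct_list012) auto

lemma path_sum_zip: "path_sum w xs = (\<Sum>(a, b)\<leftarrow>zip xs (tl xs). w a b)"
  by (induction xs rule: induct_list012) auto

lemma zip_closed: "ys \<noteq> [] \<Longrightarrow> zip (ys @ [hd ys]) (tl (ys @ [hd ys])) = zip ys (rotate1 ys)"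
  using zip_append1[of ys "[hd ys]" "rotate1 ys"] by (cases ys) simp_all

lemma path_sum_closed:
  fixes w :: "'a \<Rightarrow> 'a \<Rightarrow> 'b :: comm_monoid_add"
  assumes "ys \<noteq> []" "distinct ys"
  shows "path_sum w (ys @ [hd ys]) = (\<Sum>(a, b)\<in>cyc_edges ys. w a b)"
  unfolding path_sum_zip zip_closed[OF assms(1)] cyc_edges_def
  by (rule sum_list_distinct_conv_sum_set) (simp add: distinct_zipI1 assms(2))

text \<open>The winding number about \<open>j\<close> is, up to sign, the number of crossings with any of the four
  half-rows of edges adjacent to the row of \<open>j\<close>; the formula for the twist produces the sum of
  all four.\<close>

definition cross4 :: "int \<times> int \<Rightarrow> int \<times> int \<Rightarrow> int \<times> int \<Rightarrow> int" where
  "cross4 j a b = up_step (snd j) (\<lambda>x. x > fst j) a b + up_step (snd j - 1) (\<lambda>x. x > fst j) a b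
     + - up_step (snd j) (\<lambda>x. x < fst j) a b + - up_step (snd j - 1) (\<lambda>x. x < fst j) a b"

lemma closed_walk_cross4:
  assumes ys: "ys \<noteq> []" "distinct ys" "\<forall>(a, b)\<in>cyc_edges ys. adj2 a b" and p: "p \<notin> set ys"
  obtains W where "winding_number (polyline (map jewel_center ys @ [hd (map jewel_center ys)]))
      (jewel_center p) = of_int W"
    and "4 * W = (\<Sum>(a, b)\<in>cyc_edges ys. cross4 p a b)"
proof -
  let ?zs = "ys @ [hd ys]"
  have zs: "?zs \<noteq> []" "successively adj2 ?zs" "hd ?zs = last ?zs" "p \<notin> set ?zs"
    using ys p by (auto simp: successively_zip zip_closed[OF ys(1), unfolded
        cyc_edges_def[symmetric]] cyc_edges_def
        simp del: tl_append2)
  have map_eq: "map jewel_center ys @ [hd (map jewel_center ys)] = map jewel_center ?zs"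
    using ys(1) by (simp add: hd_map)
  define W where "W = path_sum (jump p) ?zs"
  have W: "winding_number (polyline (map jewel_center ?zs)) (jewel_center p) = of_int W"
    unfolding W_def by (rule closed_walk_winding(1)[OF zs])
  have "path_sum (cross4 p) ?zs = 4 * W"
    unfolding cross4_def path_sum_add path_sum_uminus closed_walk_up_steps[OF zs W] by simp
  then show ?thesis
    using that[of W] W path_sum_closed[OF ys(1,2), of "cross4 p"] by (simp add: map_eq)
qed

section \<open>Jewels and curves of a duplex tiling\<close>

lemma parallel_z_domino_of: "parallel_z (domino_of m) \<longleftrightarrow> snd m = 3"
proof -
  have dir: "domino_dir (domino_of m) = of_int (colour (fst m)) *\<^sub>R axis (snd m) 1"
    using domino_dir_domino_of[of "fst m" "snd m"] by simp
  have "axis i (1 :: real) = axis 3 1 \<longleftrightarrow> i = (3 :: 3)" "axis i (1 :: real) = - axis 3 1 \<longleftrightarrow> False"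
    "- axis i (1 :: real) = axis 3 1 \<longleftrightarrow> False" for i :: 3
    by (auto simp: vec_eq_iff axis_def)
  then show ?thesis
    using colour_cases[of "fst m"] unfolding parallel_z_def dir by auto
qed

definition flat :: "int ^ 3 \<Rightarrow> int \<times> int" where
  "flat p = (p $ 1, p $ 2)"

lemma proj_cube_center: "proj (cube_center p) = jewel_center (flat p)"
  by (simp add: proj_def cube_center_def jewel_center_def flat_def)

locale duplex_tiling =
  fixes B :: "(int \<times> int) set" and C :: "(int ^ 3) set" and t :: "(real ^ 3) set set" and M ::
      "((int ^ 3) \<times> 3) set"
  assumes fin_B: "finite B" and C_def: "C = cyl_cells 3 0 B 2" and tiling: "lattice_tiling C M"
      and t: "t = domino_of ` M"
begin

definition wht :: "(int ^ 3) \<times> 3 \<Rightarrow> int ^ 3" where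
  "wht m = white_cube (domino_of m)"

definition blk :: "(int ^ 3) \<times> 3 \<Rightarrow> int ^ 3" where
  "blk m = black_cube (domino_of m)"

definition H :: "((int ^ 3) \<times> 3) set" where
  "H = {m \<in> M. snd m \<noteq> 3}"

definition E :: "((int \<times> int) \<times> (int \<times> int)) set" where
  "E = (\<lambda>m. (flat (wht m), flat (blk m))) ` H"

definition J :: "((int ^ 3) \<times> 3) set" where
  "J = {m \<in> M. snd m = 3}"

lemma mem_C: "p \<in> C \<longleftrightarrow> flat p \<in> B \<and> (p $ 3 = 0 \<or> p $ 3 = 1)"
proof -
  have *: "(4 :: 3) = 1" "(5 :: 3) = 2" by simp_all
  show ?thesis by (auto simp: C_def cyl_cells_def flat_def *)
qed

lemma fin_C: "finite C"
  by (simp add: C_def finite_cyl_cells fin_B)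

lemma fin_M: "finite M"
  using lattice_tiling_finite[OF tiling fin_C] .

lemma wht_blk: "edge m = {wht m, blk m}" "white (wht m)" "\<not> white (blk m)"
proof -
  obtain a i where m: "m = (a, i)" by (metis surj_pair)
  show "edge m = {wht m, blk m}" "white (wht m)" "\<not> white (blk m)"
    by (auto simp: m edge_def wht_def blk_def white_cube_domino_of black_cube_domino_of
        white_add_ax)
qed

lemma unique_domino: "m \<in> M \<Longrightarrow> m' \<in> M \<Longrightarrow> p \<in> edge m \<Longrightarrow> p \<in> edge m' \<Longrightarrow> m = m'"
  using lattice_tiling_eqI[OF tiling] .

lemma edge_C: "m \<in> M \<Longrightarrow> edge m \<subseteq> C"
  using tiling by (auto simp: lattice_tiling_def)

text \<open>A column of a duplex region consists of one white and one black cube.\<close>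

lemma same_cube:
  assumes "p \<in> C" "q \<in> C" "flat p = flat q" "white p \<longleftrightarrow> white q"
  shows "p = q"
proof -
  have "p $ 3 = q $ 3"
    using assms by (auto simp: mem_C white_def flat_def)
  then show ?thesis
    using assms(3) by (simp add: vec_eq_iff forall_3 flat_def)
qed

text \<open>By \<open>same_cube\<close> a base square has only one white and one black cube above
  it, so at most one arrow starts there and at most one ends there.\<close>

lemma E_single: "single_valued E" "single_valued (E\<inverse>)"
proof -
  have uniq: "m = m'" if "m \<in> H" "m' \<in> H" "flat (wht m) = flat (wht m') \<or> flat (blk m) = flat (blk
      m')" for m m'
  proof -
    have M: "m \<in> M" "m' \<in> M" using that by (auto simp: H_def)
    have "wht m \<in> C" "wht m' \<in> C" "blk m \<in> C" "blk m' \<in> C"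
      using edge_C[OF M(1)] edge_C[OF M(2)] wht_blk(1)[of m] wht_blk(1)[of m'] by auto
    then have "wht m = wht m' \<or> blk m = blk m'"
      using that(3) same_cube wht_blk(2,3) by metis
    then show ?thesis
      using unique_domino[OF M] wht_blk(1)[of m] wht_blk(1)[of m'] by auto
  qed
  have get: "\<exists>m\<in>H. x = flat (wht m) \<and> y = flat (blk m)" if "(x, y) \<in> E" for x y
    using that unfolding E_def by blast
  show "single_valued E"
    by (rule single_valuedI) (use get uniq in metis)
  show "single_valued (E\<inverse>)"
    by (rule single_valuedI) (use get uniq in \<open>metis converseD\<close>)
qed

lemma E_inj: "inj_on (\<lambda>m. (flat (wht m), flat (blk m))) H"
proof (rule inj_onI)
  fix m m' assume m: "m \<in> H" "m' \<in> H" "(flat (wht m), flat (blk m)) = (flat (wht m'), flat (blk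
      m'))"
  then have M: "m \<in> M" "m' \<in> M" by (auto simp: H_def)
  have "wht m \<in> C" "wht m' \<in> C"
    using edge_C[OF M(1)] edge_C[OF M(2)] wht_blk(1)[of m] wht_blk(1)[of m'] by auto
  then have "wht m = wht m'"
    using m(3) same_cube wht_blk(2) by auto
  then show "m = m'"
    using unique_domino[OF M] wht_blk(1)[of m] wht_blk(1)[of m'] by auto
qed

text \<open>A jewel occupies both cubes of its column, so the curves avoid its square.\<close>

lemma jewel_not_flat:
  assumes "m \<in> J" "m' \<in> H" "p \<in> edge m'"
  shows "flat p \<noteq> flat (fst m)"
proof
  assume eq: "flat p = flat (fst m)"
  have M: "m \<in> M" "m' \<in> M" "snd m = 3" "snd m' \<noteq> 3" using assms by (auto simp: J_def H_def)
  have m: "m = (fst m, 3)" using M(3) by (simp add: prod_eq_iff)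
  have e: "edge m = {fst m, fst m + ax 3}" using M(3) by (simp add: edge_def)
  then have "fst m \<in> C" "fst m + ax 3 \<in> C" using edge_C[OF M(1)] by auto
  then have "fst m $ 3 = 0" by (auto simp: mem_C ax_nth)
  moreover have "p \<in> C" using edge_C[OF M(2)] assms(3) by auto
  ultimately have "p = fst m \<or> p = fst m + ax 3"
    using eq by (auto simp: mem_C vec_eq_iff forall_3 flat_def ax_nth)
  then have "m = m'"
    using unique_domino[OF M(1,2)] assms(3) e by auto
  then show False using M(3,4) by simp
qed

text \<open>Where an arrow ends, the black cube of the column is covered by a horizontal domino. The
  white cube of the column then belongs to no jewel and starts an arrow.\<close>

lemma E_range: "Range E \<subseteq> Domain E"
proof
  fix v assume "v \<in> Range E"
  then obtain m where m: "m \<in> H" "v = flat (blk m)" by (auto simp: E_def)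
  have mM: "m \<in> M" using m(1) by (simp add: H_def)
  define p where "p = blk m"
  have p: "p \<in> edge m" "p \<in> C" "\<not> white p"
    using wht_blk[of m] edge_C[OF mM] by (auto simp: p_def)
  define q where "q = (if p $ 3 = 0 then p + ax 3 else p - ax 3)"
  have pq: "p = q + ax 3 \<or> q = p + ax 3" by (simp add: q_def)
  have q: "q \<in> C" "flat q = flat p" "white q"
    using p(2,3) white_add_ax[of p 3] white_add_ax[of "p - ax 3" 3]
    by (auto simp: q_def mem_C flat_def ax_nth)
  obtain m' where m': "m' \<in> M" "q \<in> edge m'"
    using q(1) tiling by (auto simp: lattice_tiling_def)
  have "m' \<in> H"
  proof (rule ccontr)
    assume "m' \<notin> H"
    then have J: "m' \<in> J" using m'(1) by (auto simp: H_def J_def)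
    then have "flat q = flat (fst m')"
      using m'(2) by (auto simp: edge_def J_def flat_def ax_nth)
    then show False using jewel_not_flat[OF J m(1) p(1)] q(2) by simp
  qed
  moreover have "q = wht m'"
    using m'(2) q(3) wht_blk[of m'] by auto
  ultimately show "v \<in> Domain E"
    using m(2) q(2) by (force simp: E_def p_def)
qed


lemma adj_E: "(a, b) \<in> E \<Longrightarrow> adj2 a b"
proof -
  assume "(a, b) \<in> E"
  then obtain m where m: "m \<in> H" "a = flat (wht m)" "b = flat (blk m)" by (auto simp: E_def)
  obtain p i where mp: "m = (p, i)" by (metis surj_pair)
  have "i = 1 \<or> i = 2" using m(1) exhaust_3[of i] by (auto simp: H_def mp)
  then show ?thesis
    by (auto simp: m mp adj2_def flat_def wht_def blk_def white_cube_domino_of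
        black_cube_domino_of ax_nth)
qed

lemma jewel_notin_E:
  assumes "m \<in> J" "(a, b) \<in> E"
  shows "a \<noteq> flat (fst m)" "b \<noteq> flat (fst m)"
proof -
  obtain m' where m': "m' \<in> H" "a = flat (wht m')" "b = flat (blk m')" using assms(2) by (auto
      simp: E_def)
  show "a \<noteq> flat (fst m)" "b \<noteq> flat (fst m)"
    using jewel_not_flat[OF assms(1) m'(1)] wht_blk(1)[of m'] by (auto simp: m')
qed

lemma segments_eq: "segments t = map_prod jewel_center jewel_center ` E"
proof -
  have "{d \<in> t. \<not> parallel_z d} = domino_of ` H"
    by (auto simp: t H_def parallel_z_domino_of)
  then show ?thesis
    by (simp add: segments_def E_def image_image proj_cube_center wht_def blk_def)
qed

lemma inj_jewel_center: "inj jewel_center"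
  by (rule injI) simp

lemma segments_single: "single_valued (segments t)" "single_valued ((segments t)\<inverse>)"
  "Range (segments t) \<subseteq> Domain (segments t)" "finite (segments t)"
proof -
  show "single_valued (segments t)"
    by (rule single_valuedI) (use E_single(1) in \<open>auto simp: segments_eq dest: single_valuedD\<close>)
  show "single_valued ((segments t)\<inverse>)"
  proof (rule single_valuedI)
    fix x y z assume "(x, y) \<in> (segments t)\<inverse>" "(x, z) \<in> (segments t)\<inverse>"
    then obtain a b c where "(b, a) \<in> E" "(c, a) \<in> E" "y = jewel_center b" "z = jewel_center c"
      by (auto simp: segments_eq)
    then show "y = z" using E_single(2) by (auto dest: single_valuedD)
  qed
  show "Range (segments t) \<subseteq> Domain (segments t)"
  proof
    fix x assume "x \<in> Range (segments t)"
    then obtain a b where "(a, b) \<in> E" "x = jewel_center b" by (auto simp: segments_eq)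
    moreover from this obtain c where "(b, c) \<in> E" using E_range by blast
    ultimately show "x \<in> Domain (segments t)" by (force simp: segments_eq)
  qed
  have "finite E" using fin_M by (simp add: E_def H_def)
  then show "finite (segments t)" by (simp add: segments_eq)
qed

lemma curves_eq: "curves t = cycles_in (segments t)"
  by (simp add: curves_def cycles_in_def traverses_def cyc_edges_def)

definition wcross :: "int \<times> int \<Rightarrow> complex \<times> complex \<Rightarrow> int" where
  "wcross j e = cross4 j (inv jewel_center (fst e)) (inv jewel_center (snd e))"

text \<open>Whatever cyclic sequence the choice operator in \<open>curve_wind\<close> returns, it is
  the image of a closed lattice walk that avoids the square of the jewel, so
  \<open>closed_walk_cross4\<close> applies.\<close>

lemma curve_wind_cross4:
  assumes X: "X \<in> curves t" and m: "m \<in> J"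
  shows "\<exists>W. curve_wind X (jewel_center (flat (fst m))) = of_int W \<and> 4 * W = (\<Sum>e\<in>X. wcross (flat
      (fst m)) e)"
proof -
  define j where "j = flat (fst m)"
  define xs where "xs = (SOME xs. traverses xs X)"
  have "\<exists>xs. traverses xs X" using X by (simp add: curves_def)
  then have "traverses xs X" unfolding xs_def by (rule someI_ex)
  then have xs: "xs \<noteq> []" "distinct xs" "X = cyc_edges xs" by (auto simp: traverses_def
      cyc_edges_def)
  define ys where "ys = map (inv jewel_center) xs"
  have "x \<in> range jewel_center" if x: "x \<in> set xs" for x
  proof -
    from x obtain i where "i < length xs" "x = xs ! i" by (auto simp: in_set_conv_nth)
    then have "(x, xs ! (Suc i mod length xs)) \<in> X" unfolding xs(3) cyc_edges_iff by blast
    then have "(x, xs ! (Suc i mod length xs)) \<in> segments t" using X by (auto simp: curves_def)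
    then show ?thesis by (auto simp: segments_eq)
  qed
  then have xs_ys: "xs = map jewel_center ys"
    unfolding ys_def by (auto simp: f_inv_into_f intro!: nth_equalityI)
  have X_ys: "X = map_prod jewel_center jewel_center ` cyc_edges ys"
    unfolding xs(3) xs_ys cyc_edges_def rotate1_map zip_map_map
    by (simp add: map_prod_def)
  have sub: "cyc_edges ys \<subseteq> E"
  proof
    fix e assume "e \<in> cyc_edges ys"
    then have "map_prod jewel_center jewel_center e \<in> segments t"
      using X X_ys by (auto simp: curves_def)
    then show "e \<in> E"
      unfolding segments_eq by (cases e) auto
  qed
  have "ys \<noteq> []" "distinct ys" using xs(1,2) by (auto simp: xs_ys distinct_map)
  moreover have "\<forall>(a, b)\<in>cyc_edges ys. adj2 a b" using sub adj_E by auto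
  moreover have "j \<notin> set ys"
  proof
    assume "j \<in> set ys"
    then obtain i where "i < length ys" "j = ys ! i" by (auto simp: in_set_conv_nth)
    then have "(j, ys ! (Suc i mod length ys)) \<in> cyc_edges ys" unfolding cyc_edges_iff by blast
    then have "(j, ys ! (Suc i mod length ys)) \<in> E" using sub by blast
    from jewel_notin_E(1)[OF m this] show False by (simp add: j_def)
  qed
  ultimately obtain W where W: "winding_number (polyline (map jewel_center ys @ [hd (map
      jewel_center ys)])) (jewel_center j) = of_int W"
    "4 * W = (\<Sum>(a, b)\<in>cyc_edges ys. cross4 j a b)"
    by (rule closed_walk_cross4)
  have "curve_wind X (jewel_center j) = of_int W"
    unfolding curve_wind_def Let_def xs_def[symmetric] using W(1) by (simp add: xs_ys)
  moreover have "(\<Sum>e\<in>X. wcross j e) = (\<Sum>(a, b)\<in>cyc_edges ys. cross4 j a b)"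
  proof -
    have "inj_on (map_prod jewel_center jewel_center) (cyc_edges ys)"
      by (auto simp: inj_on_def)
    then show ?thesis
      unfolding X_ys
      by (simp add: sum.reindex wcross_def case_prod_beta inv_f_f[OF inj_jewel_center])
  qed
  ultimately show ?thesis using W(2) unfolding j_def by metis
qed

text \<open>The curves partition the segments, so the crossings of the single curves add up to a sum
  over all horizontal dominoes. The winding numbers are integers, so the description in
  \<open>jewel_wind\<close> denotes their sum.\<close>

lemma jewel_wind_eq:
  assumes m: "m \<in> J"
  shows "4 * jewel_wind t (flat (fst m)) = (\<Sum>m'\<in>H. cross4 (flat (fst m)) (flat (wht m')) (flat
      (blk m')))"
proof -
  define j where "j = flat (fst m)"
  obtain W where W: "\<And>X. X \<in> curves t \<Longrightarrow> curve_wind X (jewel_center j) = of_int (W X) \<and> 4 * W X =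
      (\<Sum>e\<in>X. wcross j e)"
    using curve_wind_cross4[OF _ m] unfolding j_def[symmetric] by metis
  have total: "(\<Sum>X\<in>curves t. curve_wind X (jewel_center j)) = of_int (\<Sum>X\<in>curves t. W X)"
    unfolding of_int_sum using W by (intro sum.cong) auto
  have "jewel_wind t j = (\<Sum>X\<in>curves t. W X)"
    unfolding jewel_wind_def total of_int_eq_iff by (rule the_equality) auto
  then have "4 * jewel_wind t j = (\<Sum>X\<in>curves t. 4 * W X)"
    by (simp add: sum_distrib_left)
  also have "\<dots> = (\<Sum>X\<in>curves t. \<Sum>e\<in>X. wcross j e)"
    using W by (intro sum.cong refl) blast
  also have "\<dots> = (\<Sum>e\<in>segments t. wcross j e)"
    unfolding curves_eq by (rule sum_cycles_in[OF segments_single(4,1,2,3)])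
  also have "\<dots> = (\<Sum>e\<in>E. cross4 j (fst e) (snd e))"
  proof -
    have "inj_on (map_prod jewel_center jewel_center) E" by (auto simp: inj_on_def)
    then show ?thesis
      unfolding segments_eq by (simp add: sum.reindex wcross_def inv_f_f[OF inj_jewel_center])
  qed
  also have "\<dots> = (\<Sum>m'\<in>H. cross4 j (flat (wht m')) (flat (blk m')))"
    unfolding E_def by (simp add: sum.reindex[OF E_inj])
  finally show ?thesis by (simp add: j_def)
qed

lemma jewel_flat: "m \<in> J \<Longrightarrow> m = (fst m, 3) \<and> fst m $ 3 = 0"
proof -
  assume m: "m \<in> J"
  then have "fst m \<in> C" "fst m + ax 3 \<in> C" using edge_C[of m] by (auto simp: J_def edge_def)
  then show ?thesis using m by (auto simp: mem_C ax_nth J_def prod_eq_iff)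
qed

text \<open>Summing over the two cubes of the jewel makes the vertical sign independent of the layer
  of \<open>m'\<close>. The factor \<open>sgn x\<close> separates right from left, and the
  difference of signs in \<open>y\<close> selects the two rows next to the jewel: these are the four
  half-rows of \<open>cross4\<close>.\<close>

lemma pairing_jewel:
  assumes m: "m \<in> J" and m': "m' \<in> H" "snd m' = 2"
  shows "pairing (edge m') (edge m) = colour (fst m) * cross4 (flat (fst m)) (flat (wht m')) (flat
      (blk m'))"
proof -
  obtain a where a: "m = (a, 3)" "a $ 3 = 0" using jewel_flat[OF m] by metis
  obtain b where b: "m' = (b, 2)" using m'(2) by (metis prod.collapse)
  have "b \<in> C" using edge_C[of m'] m' by (auto simp: H_def b edge_def)
  then have b3: "b $ 3 = 0 \<or> b $ 3 = 1" by (simp add: mem_C)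
  define x y where "x = a $ 1 - b $ 1" and "y = a $ 2 - b $ 2"
  have "pairing (edge m') (edge m) =
      colour a * (- (colour b * sgn x * (sgn y - sgn (y - 1))))"
    using b3 by (elim disjE) (simp_all add: a b pairing_def edge_sum sgn3_def ax_nth x_def y_def
        algebra_simps)
  moreover have "- (colour b * sgn x * (sgn y - sgn (y - 1))) = cross4 (flat a) (flat (wht m'))
      (flat (blk m'))"
    by (cases "white b")
      (auto simp: colour_def b wht_def blk_def white_cube_domino_of black_cube_domino_of flat_def
          cross4_def up_step_def
         ax_nth x_def y_def sgn_if)
  ultimately show ?thesis by (simp add: a)
qed

lemma cross4_x:
  assumes "m' \<in> H" "snd m' \<noteq> 2"
  shows "cross4 j (flat (wht m')) (flat (blk m')) = 0"
proof -
  have "snd m' = 1" using assms exhaust_3[of "snd m'"] by (auto simp: H_def)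
  then obtain b where "m' = (b, 1)" by (metis prod.collapse)
  then show ?thesis
    by (simp add: wht_def blk_def white_cube_domino_of black_cube_domino_of flat_def cross4_def
        up_step_def ax_nth)
qed

lemma twist4_jewels: "twist4 1 M = (\<Sum>m\<in>J. colour (fst m) * (4 * jewel_wind t (flat (fst m))))"
proof -
  have "twist4 1 M = pairing (dir_cells 2 M) (dir_cells 3 M)" by (simp add: twist4_def)
  also have "\<dots> = (\<Sum>m\<in>J. \<Sum>m'\<in>{m'\<in>M. snd m' = 2}. pairing (edge m') (edge m))"
    unfolding pairing_dir_cells_right[OF tiling fin_C] pairing_dir_cells_left[OF tiling fin_C]
        J_def ..
  also have "\<dots> = (\<Sum>m\<in>J. colour (fst m) * (4 * jewel_wind t (flat (fst m))))"
  proof (intro sum.cong refl)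
    fix m assume m: "m \<in> J"
    have "(\<Sum>m'\<in>{m'\<in>M. snd m' = 2}. pairing (edge m') (edge m)) =
      (\<Sum>m'\<in>{m'\<in>M. snd m' = 2}. colour (fst m) * cross4 (flat (fst m)) (flat (wht m')) (flat (blk
          m')))"
      by (intro sum.cong refl pairing_jewel[OF m]) (auto simp: H_def)
    also have "\<dots> = (\<Sum>m'\<in>H. colour (fst m) * cross4 (flat (fst m)) (flat (wht m')) (flat (blk m')))"
    proof (rule sum.mono_neutral_left)
      show "finite H" using fin_M by (simp add: H_def)
      show "{m' \<in> M. snd m' = 2} \<subseteq> H" by (auto simp: H_def)
      show "\<forall>m'\<in>H - {m' \<in> M. snd m' = 2}. colour (fst m) * cross4 (flat (fst m)) (flat (wht m'))
          (flat (blk m')) = 0"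
        using cross4_x by (auto simp: H_def)
    qed
    also have "\<dots> = colour (fst m) * (4 * jewel_wind t (flat (fst m)))"
      by (simp add: jewel_wind_eq[OF m] sum_distrib_left)
    finally show "(\<Sum>m'\<in>{m'\<in>M. snd m' = 2}. pairing (edge m') (edge m)) = colour (fst m) * (4 *
        jewel_wind t (flat (fst m)))" .
  qed
  finally show ?thesis .
qed

lemma jewels_eq: "jewels t = (\<lambda>m. flat (fst m)) ` J"
proof -
  have "{d \<in> t. parallel_z d} = domino_of ` J"
    by (auto simp: t J_def parallel_z_domino_of)
  moreover have "(white_cube (domino_of m) $ 1, white_cube (domino_of m) $ 2) = flat (fst m)" if
      m: "m \<in> J" for m
  proof -
    obtain a where "m = (a, 3)" using jewel_flat[OF m] by metis
    then show ?thesis by (simp add: white_cube_domino_of flat_def ax_nth)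
  qed
  ultimately show ?thesis
    unfolding jewels_def by (simp add: image_image cong: image_cong)
qed

text \<open>At 1 the derivative of \<open>q powi k\<close> is \<open>k\<close>, which leads to the
  sum in \<open>twist4_jewels\<close>. The lower cube of a jewel lies in layer 0, where the spatial
  colour agrees with the planar one.\<close>

lemma duplex_poly_deriv: "deriv (duplex_poly t) 1 = of_int (twist4 1 M) / 4"
proof -
  have fin: "finite (jewels t)" using fin_M by (simp add: jewels_eq J_def)
  have "(duplex_poly t has_field_derivative (\<Sum>j\<in>jewels t. jewel_color j * of_int (jewel_wind t
      j))) (at 1)"
    unfolding duplex_poly_def[abs_def]
    by (rule DERIV_sum) (auto intro!: derivative_eq_intros)
  then have "deriv (duplex_poly t) 1 = (\<Sum>j\<in>jewels t. jewel_color j * of_int (jewel_wind t j))"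
    by (rule DERIV_imp_deriv)
  also have "\<dots> = (\<Sum>m\<in>J. jewel_color (flat (fst m)) * of_int (jewel_wind t (flat (fst m))))"
  proof -
    have "inj_on (\<lambda>m. flat (fst m)) J"
    proof (rule inj_onI)
      fix m m' assume m: "m \<in> J" "m' \<in> J" "flat (fst m) = flat (fst m')"
      then have "fst m = fst m'"
        using jewel_flat[OF m(1)] jewel_flat[OF m(2)] by (simp add: vec_eq_iff forall_3 flat_def)
      then show "m = m'" using jewel_flat[OF m(1)] jewel_flat[OF m(2)] by (metis)
    qed
    then show ?thesis unfolding jewels_eq by (simp add: sum.reindex)
  qed
  also have "\<dots> = (\<Sum>m\<in>J. of_int (colour (fst m) * (4 * jewel_wind t (flat (fst m)))) / 4)"
  proof (intro sum.cong refl)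
    fix m assume "m \<in> J"
    then have "jewel_color (flat (fst m)) = of_int (colour (fst m))"
      using jewel_flat[of m] by (simp add: jewel_color_def colour_def white_def flat_def)
    then show "jewel_color (flat (fst m)) * of_int (jewel_wind t (flat (fst m))) =
        of_int (colour (fst m) * (4 * jewel_wind t (flat (fst m)))) / 4" by simp
  qed
  also have "\<dots> = of_int (twist4 1 M) / 4"
    unfolding twist4_jewels by (simp add: sum_divide_distrib)
  finally show ?thesis .
qed

end

section \<open>The properties of the twist for geometric cylinders\<close>

definition cyl_region :: "(int ^ 3) set \<Rightarrow> bool" where
  "cyl_region C \<longleftrightarrow> (\<exists>i k B N. finite B \<and> planar_exact B \<and> C = cyl_cells i k B N)"

lemma cylinder_region:
  assumes "cylinder R"
  shows "\<exists>C. cyl_region C \<and> R = cubes C"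
proof -
  obtain i k D N where D: "planar_region i k D" "simply_connected D" and N: "N > 0"
    and R: "R = extrude D N (axis i 1)"
    using assms by (auto simp: cylinder_def cylinder_base_def)
  obtain B where "finite B" "planar_exact B" "\<And>N. N > 0 \<Longrightarrow> extrude D N (axis i 1) = cubes
      (cyl_cells i k B N)"
    using cylinder_cells[OF D] by blast
  then show ?thesis
    using N unfolding R cyl_region_def by blast
qed

lemma cyl_region_finite: "cyl_region C \<Longrightarrow> finite C"
  using finite_cyl_cells by (auto simp: cyl_region_def)

lemma twist4_region_eq: "cyl_region C \<Longrightarrow> lattice_tiling C M \<Longrightarrow> twist4 j M = twist4 l M"
  using twist4_cylinder_eq by (auto simp: cyl_region_def)

lemma twist_region:
  assumes "cyl_region C" "lattice_tiling C M"
  shows "twist (domino_of ` M) = of_int (twist4 j M) / 4"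
  by (rule twist_codes[OF assms(2) cyl_region_finite[OF assms(1)]], rule twist4_region_eq[OF assms])

lemma twist_Ints:
  assumes C: "cyl_region C" and M: "lattice_tiling C M"
  shows "twist (domino_of ` M) \<in> \<int>"
proof -
  obtain i k B N where B: "finite B" "C = cyl_cells i k B N"
    using C by (auto simp: cyl_region_def)
  interpret tiled_cylinder i k B N M C
    using B M by unfold_locales
  obtain K where "twist4 i M = 4 * K" using four_dvd_twist4 by (rule dvdE)
  then show ?thesis
    using twist_region[OF C M, of i] by simp
qed

lemma twist_flip:
  assumes C: "cyl_region C" and t0: "tiling (cubes C) t0" and t1: "tiling (cubes C) t1" and flip:
      "is_flip t0 t1"
  shows "twist t1 = twist t0"
proof -
  obtain a k B N where B: "finite B" "planar_exact B" "C = cyl_cells a k B N"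
    using C by (auto simp: cyl_region_def)
  obtain p i j s s' where ij: "i \<noteq> j" and Q: "let Q = cbox (lattice_pt p) (lattice_pt (p + 1 +
      axis i 1 + axis j 1)) in
          s \<subseteq> t0 \<and> tiling Q s \<and> tiling Q s' \<and> s' \<noteq> s \<and> t1 = (t0 - s) \<union> s'"
    using flip unfolding is_flip_def by (elim exE conjE)
  have s: "s \<subseteq> t0" "tiling (cubes (square p i j)) s" "tiling (cubes (square p i j)) s'" "t1 = (t0
      - s) \<union> s'"
    using Q unfolding Let_def cubes_square[OF ij] by simp_all
  have codes1: "codes t1 = (codes t0 - codes s) \<union> codes s'"
    by (simp add: s(4) codes_Un codes_Diff)
  have "codes s \<subseteq> codes t0" using s(1) by (auto simp: codes_def)
  from twist4_flip[OF B(2,1,3) tiling_codes(1)[OF t0] tiling_codes(1)[OF t1, unfolded codes1] ij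
      this
      tiling_codes(1)[OF s(2)] tiling_codes(1)[OF s(3)], of 1]
  have "twist4 1 (codes t1) = twist4 1 (codes t0)" by (simp add: codes1)
  then show ?thesis
    using twist_region[OF C tiling_codes(1)[OF t0], of 1] twist_region[OF C tiling_codes(1)[OF
        t1], of 1]
    by (simp flip: tiling_codes(2)[OF t0] tiling_codes(2)[OF t1])
qed

lemma twist_positive_trit:
  assumes C: "cyl_region C" and t0: "tiling (cubes C) t0" and t1: "tiling (cubes C) t1"
    and trit: "is_positive_trit (cubes C) t0 t1"
  shows "twist t1 - twist t0 = 1"
proof -
  obtain a k B N where B: "finite B" "planar_exact B" "C = cyl_cells a k B N"
    using C by (auto simp: cyl_region_def)
  have "twist4 1 (codes t1) - twist4 1 (codes t0) = 4"
    by (rule twist4_positive_trit[OF B(2,1,3) t0 t1 trit])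
  then have "of_int (twist4 1 (codes t1)) / 4 - of_int (twist4 1 (codes t0)) / 4 = (1 :: real)"
    by (simp flip: diff_divide_distrib of_int_diff)
  then show ?thesis
    using twist_region[OF C tiling_codes(1)[OF t0], of 1] twist_region[OF C tiling_codes(1)[OF
        t1], of 1]
    by (simp flip: tiling_codes(2)[OF t0] tiling_codes(2)[OF t1])
qed

lemma twist_duplex:
  assumes R: "duplex R" and t: "tiling R t"
  shows "twist t = deriv (duplex_poly t) 1"
proof -
  obtain D where D: "planar_region 3 0 D" "simply_connected D" and R_eq: "R = extrude D 2 (axis 3
      1)"
    using R by (auto simp: duplex_def cylinder_base_def)
  obtain B where B: "finite B" "planar_exact B" "\<And>N. N > 0 \<Longrightarrow> extrude D N (axis 3 1) = cubes
      (cyl_cells 3 0 B N)"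
    using cylinder_cells[OF D] by blast
  define C where "C = cyl_cells 3 0 B 2"
  have RC: "R = cubes C" unfolding R_eq C_def by (rule B(3)) simp
  have M: "lattice_tiling C (codes t)" "t = domino_of ` codes t"
    using tiling_codes[of C t] t by (simp_all add: RC)
  interpret duplex_tiling B C t "codes t"
    using B(1) M C_def by unfold_locales
  have "cyl_region C" using B by (auto simp: cyl_region_def C_def)
  then show ?thesis
    using twist_region[OF _ M(1), of 1] M(2) duplex_poly_deriv by simp
qed

lemma lattice_tiling_UN:
  assumes "\<And>i. i \<in> I \<Longrightarrow> lattice_tiling (Cs i) (Ms i)"
    and "\<And>i j. i \<in> I \<Longrightarrow> j \<in> I \<Longrightarrow> i \<noteq> j \<Longrightarrow> Cs i \<inter> Cs j = {}"
  shows "lattice_tiling (\<Union>i\<in>I. Cs i) (\<Union>i\<in>I. Ms i)"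
  unfolding lattice_tiling_def
proof
  show "(\<Union>m\<in>(\<Union>i\<in>I. Ms i). edge m) = (\<Union>i\<in>I. Cs i)"
    using assms(1) by (auto simp: lattice_tiling_def)
  have "m = m'" if "i \<in> I" "m \<in> Ms i" "j \<in> I" "m' \<in> Ms j" "c \<in> edge m" "c \<in> edge m'" for i j m m' c
  proof -
    have "c \<in> Cs i" "c \<in> Cs j" using that assms(1) by (auto simp: lattice_tiling_def)
    then have "i = j" using assms(2)[of i j] that by blast
    then show ?thesis using lattice_tiling_eqI[OF assms(1)[OF that(1)] that(2) _ that(5,6)]
        that(4) by simp
  qed
  then show "disjoint_family_on edge (\<Union>i\<in>I. Ms i)"
    unfolding disjoint_family_on_def by blast
qed

text \<open>All pieces other than \<open>a\<close> together form the outer tiling of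
  \<open>twist4_Un_swap\<close>.\<close>

lemma twist4_UN_replace:
  assumes I: "finite I" "a \<in> I" and C: "cyl_region (\<Union>i\<in>I. Cs i)" "cyl_region (Cs a)"
    and disj: "\<And>i j. i \<in> I \<Longrightarrow> j \<in> I \<Longrightarrow> i \<noteq> j \<Longrightarrow> Cs i \<inter> Cs j = {}"
    and M: "\<And>i. i \<in> I \<Longrightarrow> lattice_tiling (Cs i) (Ms i)" and M': "lattice_tiling (Cs a) M'"
  shows "twist4 r (\<Union>i\<in>I. (Ms(a := M')) i) - (\<Sum>i\<in>I. twist4 r ((Ms(a := M')) i)) =
    twist4 r (\<Union>i\<in>I. Ms i) - (\<Sum>i\<in>I. twist4 r (Ms i))"
proof -
  let ?C = "\<Union>i\<in>I. Cs i" and ?U = "\<Union>i\<in>I - {a}. Ms i"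
  obtain x k B N where B: "finite B" "?C = cyl_cells x k B N"
    using C(1) by (auto simp: cyl_region_def)
  obtain x' k' B' N' where B': "finite B'" "planar_exact B'" "Cs a = cyl_cells x' k' B' N'"
    using C(2) by (auto simp: cyl_region_def)
  have "?C - Cs a = (\<Union>i\<in>I - {a}. Cs i)"
    using disj[OF _ I(2)] I(2) by fastforce
  then have U: "lattice_tiling (?C - Cs a) ?U"
    using lattice_tiling_UN[of "I - {a}" Cs Ms] M disj by auto
  have sub: "Cs a \<subseteq> ?C" using I(2) by blast
  have "twist4 r (?U \<union> M') - twist4 r M' = twist4 r (?U \<union> Ms a) - twist4 r (Ms a)"
    by (rule twist4_Un_swap[OF B B'(2,1,3) sub U M' M[OF I(2)]])
  moreover have "(\<Union>i\<in>I. (Ms(a := M')) i) = ?U \<union> M'" "(\<Union>i\<in>I. Ms i) = ?U \<union> Ms a"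
    using I(2) by (auto split: if_splits)
  moreover have "(\<Sum>i\<in>I. twist4 r ((Ms(a := M')) i)) = twist4 r M' + (\<Sum>i\<in>I - {a}. twist4 r (Ms i))"
    by (subst sum.remove[OF I]) (auto intro!: sum.cong)
  moreover have "(\<Sum>i\<in>I. twist4 r (Ms i)) = twist4 r (Ms a) + (\<Sum>i\<in>I - {a}. twist4 r (Ms i))"
    by (rule sum.remove[OF I])
  ultimately show ?thesis by simp
qed

text \<open>The tilings are exchanged one piece at a time; \<open>hyb S\<close> is the family
  already exchanged on \<open>S\<close>.\<close>

lemma twist4_UN_indep:
  assumes I: "finite I" and C: "cyl_region (\<Union>i\<in>I. Cs i)" "\<And>i. i \<in> I \<Longrightarrow> cyl_region (Cs i)"
    and disj: "\<And>i j. i \<in> I \<Longrightarrow> j \<in> I \<Longrightarrow> i \<noteq> j \<Longrightarrow> Cs i \<inter> Cs j = {}"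
    and M: "\<And>i. i \<in> I \<Longrightarrow> lattice_tiling (Cs i) (Ms i)" and M': "\<And>i. i \<in> I \<Longrightarrow> lattice_tiling (Cs i)
        (Ms' i)"
  shows "twist4 r (\<Union>i\<in>I. Ms' i) - (\<Sum>i\<in>I. twist4 r (Ms' i)) = twist4 r (\<Union>i\<in>I. Ms i) - (\<Sum>i\<in>I. twist4
      r (Ms i))"
proof -
  define hyb where "hyb = (\<lambda>S i. if i \<in> S then Ms' i else Ms i)"
  have "twist4 r (\<Union>i\<in>I. hyb S i) - (\<Sum>i\<in>I. twist4 r (hyb S i)) = twist4 r (\<Union>i\<in>I. Ms i) - (\<Sum>i\<in>I.
      twist4 r (Ms i))"
    if "S \<subseteq> I" for S
    using finite_subset[OF that I] that
  proof (induction S rule: finite_induct)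
    case empty
    then show ?case by (simp add: hyb_def)
  next
    case (insert a S)
    have "hyb (insert a S) = (hyb S)(a := Ms' a)" by (auto simp: hyb_def fun_eq_iff)
    moreover have "lattice_tiling (Cs i) (hyb S i)" if "i \<in> I" for i
      using M M' that by (simp add: hyb_def)
    ultimately show ?case
      using twist4_UN_replace[OF I _ C(1) C(2) disj, of a "hyb S" "Ms' a" r] insert M' by simp
  qed
  from this[of I] have "twist4 r (\<Union>i\<in>I. hyb I i) - (\<Sum>i\<in>I. twist4 r (hyb I i)) = twist4 r (\<Union>i\<in>I. Ms
      i) - (\<Sum>i\<in>I. twist4 r (Ms i))"
    by simp
  then show ?thesis by (simp add: hyb_def cong: SUP_cong)
qed

lemma twist_additive:
  fixes Rs :: "nat \<Rightarrow> (real ^ 3) set"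
  assumes C: "cyl_region C" and Rs: "\<forall>i\<in>I. cylinder (Rs i)" and R: "cubes C = (\<Union>i\<in>I. Rs i)" and I:
      "finite I"
    and disj: "\<forall>i\<in>I. \<forall>j\<in>I. i \<noteq> j \<longrightarrow> interior (Rs i) \<inter> interior (Rs j) = {}"
  shows "\<exists>K::int. \<forall>ts. (\<forall>i\<in>I. tiling (Rs i) (ts i)) \<longrightarrow>
    twist (\<Union>i\<in>I. ts i) = of_int K + (\<Sum>i\<in>I. twist (ts i))"
proof -
  have "\<forall>i\<in>I. \<exists>D. cyl_region D \<and> Rs i = cubes D"
    using Rs cylinder_region by blast
  then obtain Cs where Cs: "\<And>i. i \<in> I \<Longrightarrow> cyl_region (Cs i)" "\<And>i. i \<in> I \<Longrightarrow> Rs i = cubes (Cs i)"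
    by metis
  have "cubes C = cubes (\<Union>i\<in>I. Cs i)"
    unfolding R using Cs(2) by (auto simp: cubes_def)
  then have C_eq: "C = (\<Union>i\<in>I. Cs i)" by (rule cubes_inj)
  have disjC: "Cs i \<inter> Cs j = {}" if "i \<in> I" "j \<in> I" "i \<noteq> j" for i j
    using disj that Cs(2) by (intro interior_cubes_disjoint) auto
  have M: "lattice_tiling (Cs i) (codes (ts i))" "ts i = domino_of ` codes (ts i)"
    if "\<forall>i\<in>I. tiling (Rs i) (ts i)" "i \<in> I" for ts i
    using tiling_codes[of "Cs i" "ts i"] that Cs(2) by auto
  have MU: "lattice_tiling C (\<Union>i\<in>I. codes (ts i))" if "\<forall>i\<in>I. tiling (Rs i) (ts i)" for ts
    unfolding C_eq using M(1)[OF that] disjC by (intro lattice_tiling_UN)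
  have ts_U: "(\<Union>i\<in>I. ts i) = domino_of ` (\<Union>i\<in>I. codes (ts i))" if "\<forall>i\<in>I. tiling (Rs i) (ts i)" for
      ts
    using M(2)[OF that] by blast
  have diff: "twist (\<Union>i\<in>I. ts i) - (\<Sum>i\<in>I. twist (ts i)) =
      of_int (twist4 1 (\<Union>i\<in>I. codes (ts i)) - (\<Sum>i\<in>I. twist4 1 (codes (ts i)))) / 4"
    if ts: "\<forall>i\<in>I. tiling (Rs i) (ts i)" for ts
  proof -
    have "(\<Sum>i\<in>I. twist (ts i)) = (\<Sum>i\<in>I. of_int (twist4 1 (codes (ts i))) / 4)"
    proof (rule sum.cong[OF refl])
      fix i assume i: "i \<in> I"
      show "twist (ts i) = of_int (twist4 1 (codes (ts i))) / 4"
        using twist_region[OF Cs(1)[OF i] M(1)[OF ts i], of 1] M(2)[OF ts i] by simp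
    qed
    moreover have "twist (\<Union>i\<in>I. ts i) = of_int (twist4 1 (\<Union>i\<in>I. codes (ts i))) / 4"
      unfolding ts_U[OF ts] by (rule twist_region[OF C MU[OF ts]])
    ultimately show ?thesis
      by (simp add: sum_divide_distrib diff_divide_distrib)
  qed
  show ?thesis
  \<comment> \<open>Without a family of tilings any \<open>K\<close> works. Otherwise one family
    determines \<open>K\<close>, and \<open>K\<close> is an integer because all twists involved
    are.\<close>
  proof (cases "\<exists>ts. \<forall>i\<in>I. tiling (Rs i) (ts i)")
    case True
    then obtain ts0 where ts0: "\<forall>i\<in>I. tiling (Rs i) (ts0 i)" by blast
    have "twist (\<Union>i\<in>I. ts0 i) \<in> \<int>"
      unfolding ts_U[OF ts0] by (rule twist_Ints[OF C MU[OF ts0]])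
    moreover have "(\<Sum>i\<in>I. twist (ts0 i)) \<in> \<int>"
    proof (rule Ints_sum)
      fix i assume "i \<in> I"
      then show "twist (ts0 i) \<in> \<int>"
        using twist_Ints[OF Cs(1) M(1)[OF ts0]] M(2)[OF ts0] by metis
    qed
    ultimately have "twist (\<Union>i\<in>I. ts0 i) - (\<Sum>i\<in>I. twist (ts0 i)) \<in> \<int>" by (rule Ints_diff)
    then obtain K where K: "twist (\<Union>i\<in>I. ts0 i) - (\<Sum>i\<in>I. twist (ts0 i)) = of_int K" by (rule
        Ints_cases)
    have "twist (\<Union>i\<in>I. ts i) = of_int K + (\<Sum>i\<in>I. twist (ts i))" if ts: "\<forall>i\<in>I. tiling (Rs i) (ts
        i)" for ts
    proof -
      have "twist4 1 (\<Union>i\<in>I. codes (ts i)) - (\<Sum>i\<in>I. twist4 1 (codes (ts i))) =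
          twist4 1 (\<Union>i\<in>I. codes (ts0 i)) - (\<Sum>i\<in>I. twist4 1 (codes (ts0 i)))"
        using C[unfolded C_eq] Cs(1) disjC M(1)[OF ts0] M(1)[OF ts] by (rule twist4_UN_indep[OF I])
      then show ?thesis using diff[OF ts] diff[OF ts0] K by simp
    qed
    then show ?thesis by blast
  qed blast
qed

theorem theorem1p3:
  fixes R :: "(real ^ 3) set"
  assumes "cylinder R"
  shows "(\<forall>t. tiling R t \<longrightarrow> twist t \<in> \<int>)
    \<and> (\<forall>t0 t1. tiling R t0 \<longrightarrow> tiling R t1 \<longrightarrow> is_flip t0 t1 \<longrightarrow> twist t1 = twist t0)
    \<and> (\<forall>t0 t1. tiling R t0 \<longrightarrow> tiling R t1 \<longrightarrow> is_positive_trit R t0 t1 \<longrightarrow>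
          twist t1 - twist t0 = 1)
    \<and> (duplex R \<longrightarrow> (\<forall>t. tiling R t \<longrightarrow> twist t = deriv (duplex_poly t) 1))
    \<and> (\<forall>m (Rs :: nat \<Rightarrow> (real ^ 3) set).
          (\<forall>i\<in>{1..m}. cylinder (Rs i)) \<longrightarrow>
          R = (\<Union>i\<in>{1..m}. Rs i) \<longrightarrow>
          (\<forall>i\<in>{1..m}. \<forall>j\<in>{1..m}. i \<noteq> j \<longrightarrow> interior (Rs i) \<inter> interior (Rs j) = {}) \<longrightarrow>
          (\<exists>K::int. \<forall>ts. (\<forall>i\<in>{1..m}. tiling (Rs i) (ts i)) \<longrightarrow>
             twist (\<Union>i\<in>{1..m}. ts i) = of_int K + (\<Sum>i\<in>{1..m}. twist (ts i))))"
proof -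
  obtain C where C: "cyl_region C" and R: "R = cubes C"
    using cylinder_region[OF assms] by blast
  show ?thesis
    unfolding R
  proof (intro conjI allI impI)
    fix t assume t: "tiling (cubes C) t"
    show "twist t \<in> \<int>"
      using twist_Ints[OF C tiling_codes(1)[OF t]] by (simp flip: tiling_codes(2)[OF t])
  qed (auto intro: twist_flip[OF C] twist_positive_trit[OF C] twist_duplex twist_additive[OF C])
qed

end
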